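(* Fix $k\in\{1,2,3,4\}$ and let $n_1=\dots=n_d=n^{1/d}$. Let $g\in\mathbb{R}^{n^{1/d}\times\cdots\times n^{1/d}}$ be arbitrary. Let $S\subseteq\times_{i\in[d]}[k+2:n^{1/d}-1]$ be an arbitrary set of size $s:=|S|$ defining a regular grid of cardinality $s^{1/d}\times\cdots\times s^{1/d}$ parallel to the coordinate axes. For a large enough constant $C>0$ depending only on $k$, choose $$\lambda\ \ge\ C\,d^{3/2}\,\frac{\lambda_0(\log(2n))}{s^{\frac{2k-1}{2d}}}.$$ Then, with probability at least $1-1/n$, it holds that $$\frac{\|(\hat f-f^0)_{\mathcal N_k^\perp}\|_2^2}{n}\ \le\ \frac{\|g-f^0_{\mathcal N_k^\perp}\|_2^2}{n}+4\lambda\,\|(D^kg)_{-S}\|_1+\mathcal O\!\left(\lambda^2\,s^{2k}\log(n/s)\right).$$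
   Context: Notation: $[i:j]=\{i,\dots,j\}$, $[j]=[1:j]$. For a tensor $a$, $\|a\|_2$ is the Frobenius norm and $\|a\|_1$ the sum of absolute values of the entries; $a_{-S}$ denotes the entries of $a$ with index not in $S$. Model: $Y=f^0+\epsilon$ with $Y,f^0,\epsilon\in\mathbb{R}^{n_1\times\cdots\times n_d}$, $n=n_1\cdots n_d$, where $f^0$ is fixed and $\epsilon$ has i.i.d. $\mathcal N(0,\sigma^2)$ entries, $\sigma\in(0,\infty)$ known. Difference operator: the $k$-th order difference along coordinate $i$ is $(D_i^kf)(j_1,\dots,j_d)=n_i^{k-1}\sum_{l=0}^k(-1)^l\binom kl f(j_1,\dots,j_i-l,\dots,j_d)$ for $j_i\in[k+1:n_i]$. The total difference operator is $D^k=\prod_{i=1}^dD_i^k$; its output is indexed by $\times_{i\in[d]}[k+1:n_i]$. The $k$-th order Vitali total variation is $\mathrm{TV}_k(f)=\|D^kf\|_1$. $\mathcal N_k=\{f:D^kf=0\}$, $\mathcal N_k^\perp$ is its orthogonal complement, and $f_{\mathcal N_k^\perp}$ is the orthogonal projection of $f$ onto $\mathcal N_k^\perp$. Estimator: $\hat f_{\mathcal N_k^\perp}:=\arg\min_{\mathrm f}\{\|(Y-\mathrm f)_{\mathcal N_k^\perp}\|_2^2/n+2\lambda\,\mathrm{TV}_k(\mathrm f)\}$, where the objective depends on $\mathrm f$ only through its projection onto $\mathcal N_k^\perp$ and the minimizer is taken in $\mathcal N_k^\perp$ (where it is unique). $(\hat f-f^0)_{\mathcal N_k^\perp}$ means $\hat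 f_{\mathcal N_k^\perp}-f^0_{\mathcal N_k^\perp}$. Universal choice: $\lambda_0(t):=\sigma\sqrt{(2\log(2n)+2t)/n}$, $t>0$. Regular grid: $S$ is a product of $d$ one-dimensional sets, each of $s^{1/d}$ (asymptotically) equispaced indices, so that $\times_{i\in[d]}[k+1:n_i]$ can be covered by $s$ hyperrectangles (overlapping at most in boundary points), the one associated with $t_m=(t_{1,m},\dots,t_{d,m})\in S$ being $\times_i[t_{i,m}^-:t_{i,m}^+]$, with the block $\times_i[t_{i,m}:t_{i,m}+k-1]$ in its interior, with $t_{i,m}-t_{i,m}^-$ and $t_{i,m}^+-t_{i,m}-k+1$ all at least $k(k+2)$ and of order $n^{1/d}s^{-1/d}$. The constant in $\mathcal O(\cdot)$ may depend on $k$ and $d$. *)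

theory Defs
  imports "HOL-Probability.Probability"
begin

text \<open>Dimensions \<open>n\<^sub>1, \<dots>, n\<^sub>d\<close> are given by a function \<open>ns\<close>. A multi-index is a function in
  \<open>{1..d} \<rightarrow>\<^sub>E nat\<close>; a tensor is a real function of multi-indices that is normalised to vanish
  outside its index set, so that equality of tensors is equality of functions.\<close>

definition idx :: "nat \<Rightarrow> (nat \<Rightarrow> nat) \<Rightarrow> nat \<Rightarrow> (nat \<Rightarrow> nat) set" where
  "idx d ns a = (\<Pi>\<^sub>E i\<in>{1..d}. {a..ns i})"

abbreviation full_idx :: "nat \<Rightarrow> (nat \<Rightarrow> nat) \<Rightarrow> (nat \<Rightarrow> nat) set" where
  "full_idx d ns \<equiv> idx d ns 1"

abbreviation diff_idx :: "nat \<Rightarrow> (nat \<Rightarrow> nat) \<Rightarrow> nat \<Rightarrow> (nat \<Rightarrow> nat) set" where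
  "diff_idx d ns k \<equiv> idx d ns (k + 1)"

definition tensors :: "nat \<Rightarrow> (nat \<Rightarrow> nat) \<Rightarrow> ((nat \<Rightarrow> nat) \<Rightarrow> real) set" where
  "tensors d ns = {f. \<forall>j. j \<notin> full_idx d ns \<longrightarrow> f j = 0}"

text \<open>\<open>partial_diff\<close> and \<open>total_diff\<close> are meaningful only at indices in \<open>diff_idx d ns k\<close>, where the
  subtraction \<open>j i - l\<close> does not truncate and only entries of \<open>f\<close> in \<open>full_idx d ns\<close> are used.
  The factors of the composition \<open>total_diff\<close> commute there.\<close>

definition partial_diff ::
  "(nat \<Rightarrow> nat) \<Rightarrow> nat \<Rightarrow> nat \<Rightarrow> ((nat \<Rightarrow> nat) \<Rightarrow> real) \<Rightarrow> (nat \<Rightarrow> nat) \<Rightarrow> real" where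
  "partial_diff ns k i f j =
     real (ns i) ^ (k - 1) * (\<Sum>l=0..k. (-1) ^ l * real (k choose l) * f (j(i := j i - l)))"

definition total_diff ::
  "nat \<Rightarrow> (nat \<Rightarrow> nat) \<Rightarrow> nat \<Rightarrow> ((nat \<Rightarrow> nat) \<Rightarrow> real) \<Rightarrow> (nat \<Rightarrow> nat) \<Rightarrow> real" where
  "total_diff d ns k f = foldr (partial_diff ns k) [1..<d + 1] f"

definition TV :: "nat \<Rightarrow> (nat \<Rightarrow> nat) \<Rightarrow> nat \<Rightarrow> ((nat \<Rightarrow> nat) \<Rightarrow> real) \<Rightarrow> real" where
  "TV d ns k f = (\<Sum>j\<in>diff_idx d ns k. \<bar>total_diff d ns k f j\<bar>)"

definition tinner ::
  "nat \<Rightarrow> (nat \<Rightarrow> nat) \<Rightarrow> ((nat \<Rightarrow> nat) \<Rightarrow> real) \<Rightarrow> ((nat \<Rightarrow> nat) \<Rightarrow> real) \<Rightarrow> real" where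
  "tinner d ns f h = (\<Sum>j\<in>full_idx d ns. f j * h j)"

definition tnorm :: "nat \<Rightarrow> (nat \<Rightarrow> nat) \<Rightarrow> ((nat \<Rightarrow> nat) \<Rightarrow> real) \<Rightarrow> real" where
  "tnorm d ns f = L2_set f (full_idx d ns)"

definition null_space :: "nat \<Rightarrow> (nat \<Rightarrow> nat) \<Rightarrow> nat \<Rightarrow> ((nat \<Rightarrow> nat) \<Rightarrow> real) set" where
  "null_space d ns k = {f \<in> tensors d ns. \<forall>j\<in>diff_idx d ns k. total_diff d ns k f j = 0}"

definition null_perp :: "nat \<Rightarrow> (nat \<Rightarrow> nat) \<Rightarrow> nat \<Rightarrow> ((nat \<Rightarrow> nat) \<Rightarrow> real) set" where
  "null_perp d ns k = {f \<in> tensors d ns. \<forall>h\<in>null_space d ns k. tinner d ns f h = 0}"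

text \<open>Orthogonal projection of \<open>f\<close> onto \<open>null_perp d ns k\<close>; only the entries of \<open>f\<close> in
  \<open>full_idx d ns\<close> matter.\<close>

definition proj_perp ::
  "nat \<Rightarrow> (nat \<Rightarrow> nat) \<Rightarrow> nat \<Rightarrow> ((nat \<Rightarrow> nat) \<Rightarrow> real) \<Rightarrow> (nat \<Rightarrow> nat) \<Rightarrow> real" where
  "proj_perp d ns k f =
     (THE p. p \<in> null_perp d ns k \<and>
             (\<forall>u\<in>null_perp d ns k. tinner d ns (\<lambda>j. f j - p j) u = 0))"

definition objective ::
  "nat \<Rightarrow> (nat \<Rightarrow> nat) \<Rightarrow> nat \<Rightarrow> real \<Rightarrow> ((nat \<Rightarrow> nat) \<Rightarrow> real) \<Rightarrow> ((nat \<Rightarrow> nat) \<Rightarrow> real) \<Rightarrow> real" where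
  "objective d ns k lam Y f =
     (tnorm d ns (proj_perp d ns k (\<lambda>j. Y j - f j)))\<^sup>2 / real (\<Prod>i\<in>{1..d}. ns i)
     + 2 * lam * TV d ns k f"

definition estimator ::
  "nat \<Rightarrow> (nat \<Rightarrow> nat) \<Rightarrow> nat \<Rightarrow> real \<Rightarrow> ((nat \<Rightarrow> nat) \<Rightarrow> real) \<Rightarrow> (nat \<Rightarrow> nat) \<Rightarrow> real" where
  "estimator d ns k lam Y = arg_min (objective d ns k lam Y) (\<lambda>f. f \<in> null_perp d ns k)"

definition lambda0 :: "real \<Rightarrow> nat \<Rightarrow> real \<Rightarrow> real" where
  "lambda0 \<sigma> n t = \<sigma> * sqrt ((2 * ln (2 * real n) + 2 * t) / real n)"

definition gaussian_noise ::
  "'w measure \<Rightarrow> (nat \<Rightarrow> nat) set \<Rightarrow> real \<Rightarrow> ((nat \<Rightarrow> nat) \<Rightarrow> 'w \<Rightarrow> real) \<Rightarrow> bool" where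
  "gaussian_noise M I \<sigma> \<epsilon> \<longleftrightarrow>
     prob_space M \<and>
     prob_space.indep_vars M (\<lambda>_. borel) \<epsilon> I \<and>
     (\<forall>j\<in>I. distributed M lborel (\<epsilon> j) (normal_density 0 \<sigma>))"

text \<open>Asymptotic equispacedness is made quantitative: neighbouring points have distance
  \<open>(1 \<plusminus> \<delta>) \<cdot> \<Delta>\<close> for a common spacing \<open>\<Delta>\<close>; exact equispacedness is \<open>\<delta> = 0\<close>.\<close>

definition equispaced :: "real \<Rightarrow> nat set \<Rightarrow> bool" where
  "equispaced \<delta> T \<longleftrightarrow>
     (\<exists>\<Delta>>0. \<forall>a\<in>T. \<forall>b\<in>T. a < b \<and> T \<inter> {a<..<b} = {} \<longrightarrow>
        \<bar>(real b - real a) - \<Delta>\<bar> \<le> \<delta> * \<Delta>)"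

definition hyperrect :: "nat \<Rightarrow> (nat \<Rightarrow> nat) \<Rightarrow> (nat \<Rightarrow> nat) \<Rightarrow> (nat \<Rightarrow> nat) set" where
  "hyperrect d lo hi = (\<Pi>\<^sub>E i\<in>{1..d}. {lo i..hi i})"

definition hyperrect_interior :: "nat \<Rightarrow> (nat \<Rightarrow> nat) \<Rightarrow> (nat \<Rightarrow> nat) \<Rightarrow> (nat \<Rightarrow> nat) set" where
  "hyperrect_interior d lo hi = (\<Pi>\<^sub>E i\<in>{1..d}. {lo i<..<hi i})"

text \<open>\<open>regular_grid d N k c1 c2 \<delta> S\<close>: regular grid in the index set of \<open>D\<^sup>k\<close> for an
  \<open>N \<times> \<dots> \<times> N\<close> tensor, so \<open>N = n\<^bsup>1/d\<^esup>\<close>. The functions \<open>lo t\<close> and \<open>hi t\<close> are the corners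
  \<open>t\<^sup>-\<close> and \<open>t\<^sup>+\<close> of the hyperrectangle associated with \<open>t \<in> S\<close>. ``Of order
  \<open>n\<^bsup>1/d\<^esup> s\<^bsup>-1/d\<^esup>\<close>'' means between \<open>c1\<close> and \<open>c2\<close> times this quantity.\<close>

definition regular_grid ::
  "nat \<Rightarrow> nat \<Rightarrow> nat \<Rightarrow> real \<Rightarrow> real \<Rightarrow> real \<Rightarrow> (nat \<Rightarrow> nat) set \<Rightarrow> bool" where
  "regular_grid d N k c1 c2 \<delta> S \<longleftrightarrow>
     S \<noteq> {} \<and>
     (\<exists>T :: nat \<Rightarrow> nat set.
        S = (\<Pi>\<^sub>E i\<in>{1..d}. T i) \<and>
        (\<forall>i\<in>{1..d}. finite (T i) \<and> card (T i) ^ d = card S \<and> equispaced \<delta> (T i))) \<and>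
     (\<exists>lo hi :: (nat \<Rightarrow> nat) \<Rightarrow> nat \<Rightarrow> nat.
        (\<Union>t\<in>S. hyperrect d (lo t) (hi t)) = diff_idx d (\<lambda>_. N) k \<and>
        (\<forall>t\<in>S. \<forall>t'\<in>S. t \<noteq> t' \<longrightarrow>
           hyperrect d (lo t) (hi t) \<inter> hyperrect_interior d (lo t') (hi t') = {}) \<and>
        (\<forall>t\<in>S. hyperrect d t (\<lambda>i. t i + k - 1) \<subseteq> hyperrect_interior d (lo t) (hi t)) \<and>
        (\<forall>t\<in>S. \<forall>i\<in>{1..d}.
           (let L = real N * real (card S) powr (- 1 / real d);
                dminus = real (t i) - real (lo t i);
                dplus = real (hi t i) - real (t i) - real k + 1
            in real (k * (k + 2)) \<le> dminus \<and> real (k * (k + 2)) \<le> dplus \<and>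
               c1 * L \<le> dminus \<and> dminus \<le> c2 * L \<and>
               c1 * L \<le> dplus \<and> dplus \<le> c2 * L)))"

end

theory Submission
  imports Defs "HOL-Computational_Algebra.Polynomial"
begin

text \<open>
  The estimator minimises a strongly convex objective, so for \<open>h = f\<^bsub>hat\<^esub> - g\<^sub>\<bottom>\<close> (both in
  \<open>null_perp\<close>) the error of the estimator is at most that of \<open>g\<close>, plus \<open>4\<lambda>\<parallel>(D g)\<^bsub>-S\<^esub>\<parallel>\<^sub>1\<close>, plus
  \<open>2\<langle>\<epsilon>,h\<rangle>/n + 2\<lambda>(\<parallel>(D h)\<^sub>S\<parallel>\<^sub>1 - \<parallel>(D h)\<^bsub>-S\<^esub>\<parallel>\<^sub>1) - \<parallel>h\<parallel>\<^sup>2/n\<close>.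

  Noise: \<open>h\<close> is a combination of dictionary tensors with coefficients \<open>D h\<close>. Projecting off a
  space of \<open>O(s)\<close> products of truncated polynomials with knots in \<open>S\<close> and in an auxiliary mesh
  leaves atoms of norm \<open>\<lesssim> \<surd>n (dist(j, knots)/N)\<^bsup>k-1/2\<^esup>\<close>; a union bound over at most \<open>2n\<close>
  Gaussians turns \<open>\<langle>\<epsilon>,h\<rangle>\<close> into \<open>n\<lambda>\<Sum> v\<^sub>j\<bar>(D h)\<^sub>j\<bar>\<close> and a term of the order of the claimed remainder.
  The mesh may be refined by any factor depending on \<open>k\<close>, \<open>d\<close>, \<open>c1\<close> at the expense of \<open>K\<close> only,
  which makes \<open>v\<close> as small as desired, so that \<open>C = 1\<close> is enough.

  Sparsity: given the signs of \<open>D h\<close> on \<open>S\<close>, a tensor \<open>w\<close> that interpolates them and satisfies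
  \<open>\<bar>w\<^sub>j\<bar> \<le> 1 - v\<^sub>j\<close> off \<open>S\<close> bounds the rest by \<open>\<langle>D\<^sup>T w, h\<rangle> \<le> \<parallel>D\<^sup>T w\<parallel>\<parallel>h\<parallel>\<close>. Around each
  point of \<open>S\<close> we take \<open>w = \<plusminus>\<Prod>\<psi>(u\<^sub>i) (1 - (1/d) \<Sum> \<bar>u\<^sub>i\<bar>\<^bsup>k-1/2\<^esup>)\<close> with a compactly supported \<open>\<psi>\<close>: the
  cusp \<open>\<bar>u\<bar>\<^bsup>k-1/2\<^esup>\<close> matches \<open>v\<close>, and its \<open>k\<close>-th difference \<open>\<bar>u\<bar>\<^bsup>-1/2\<^esup>\<close> is square summable
  up to the logarithm.
\<close>

text \<open>One number \<open>a\<close> fixes both the width \<open>a * L\<close> of the auxiliary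
  mesh and the radius \<open>R = max (a * L) 1\<close> of the bumps, where \<open>L = N/m\<close> is
  the spacing scale of the grid. Where \<open>w\<close> vanishes, \<open>v \<le> 1\<close> is
  required, and the distance to \<open>S\<close> alone may be too large for that, hence the mesh;
  inside a bump the deficit \<open>1 - \<bar>w\<bar>\<close> has to dominate \<open>v\<close>. At
  the common scale one smallness condition on \<open>a ^ (2 * k - 1)\<close> gives both. The
  exponent k - 1/2 is borderline: for large \<open>R\<close>, a bump that is flat to order k at its
  centre has too small a deficit next to \<open>S\<close>, while a smaller exponent would cost a
  power of \<open>R\<close> in the norm of D^T w instead of a logarithm. Terms without a logarithm
  are absorbed because \<open>2 * m \<le> N\<close> keeps \<open>ln (n/s)\<close> above
  \<open>ln 2\<close>. The inequality on a good event of large probability is not the end: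
  \<open>measure\<close> is 0 on non-measurable sets, so the event of the theorem has to be
  measurable. For this the estimator is shown to be Lipschitz in the data.\<close>

abbreviation "cube d N \<equiv> full_idx d (\<lambda>_. N)"
abbreviation "diff_cube d N k \<equiv> diff_idx d (\<lambda>_. N) k"
abbreviation "perp_space d N k \<equiv> null_perp d (\<lambda>_. N) k"
abbreviation "null_cube d N k \<equiv> null_space d (\<lambda>_. N) k"
abbreviation "perp_proj d N k \<equiv> proj_perp d (\<lambda>_. N) k"
abbreviation "cube_diff d N k \<equiv> total_diff d (\<lambda>_. N) k"
abbreviation "cube_estimator d N k \<equiv> estimator d (\<lambda>_. N) k"
abbreviation "cube_objective d N k \<equiv> objective d (\<lambda>_. N) k"
abbreviation "cube_TV d N k \<equiv> TV d (\<lambda>_. N) k"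
abbreviation "cube_norm d N \<equiv> tnorm d (\<lambda>_. N)"

section \<open>Orthonormal systems of real functions on a finite index set\<close>

definition ip :: "'a set \<Rightarrow> ('a \<Rightarrow> real) \<Rightarrow> ('a \<Rightarrow> real) \<Rightarrow> real" where
  "ip I f g = (\<Sum>i\<in>I. f i * g i)"

definition orthonormal :: "'a set \<Rightarrow> ('a \<Rightarrow> real) set \<Rightarrow> bool" where
  "orthonormal I E \<longleftrightarrow> finite E \<and> (\<forall>e\<in>E. \<forall>e'\<in>E. ip I e e' = (if e = e' then 1 else 0))"

definition proj :: "'a set \<Rightarrow> ('a \<Rightarrow> real) set \<Rightarrow> ('a \<Rightarrow> real) \<Rightarrow> 'a \<Rightarrow> real" where
  "proj I E f = (\<lambda>x. \<Sum>e\<in>E. ip I f e * e x)"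

lemma ip_commute: "ip I f g = ip I g f"
  by (simp add: ip_def mult.commute)

lemma ip_cong: "(\<And>i. i \<in> I \<Longrightarrow> f i = f' i) \<Longrightarrow> (\<And>i. i \<in> I \<Longrightarrow> g i = g' i) \<Longrightarrow> ip I f g = ip I f' g'"
  by (simp add: ip_def)

lemma ip_add_left: "ip I (\<lambda>x. f x + g x) h = ip I f h + ip I g h"
  and ip_diff_left: "ip I (\<lambda>x. f x - g x) h = ip I f h - ip I g h"
  and ip_scale_left: "ip I (\<lambda>x. c * f x) h = c * ip I f h"
  by (simp_all add: ip_def algebra_simps sum.distrib sum_subtractf sum_distrib_left)

lemma ip_add_right: "ip I h (\<lambda>x. f x + g x) = ip I h f + ip I h g"
  and ip_diff_right: "ip I h (\<lambda>x. f x - g x) = ip I h f - ip I h g"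
  and ip_scale_right: "ip I h (\<lambda>x. c * f x) = c * ip I h f"
  by (simp_all add: ip_def algebra_simps sum.distrib sum_subtractf sum_distrib_left)

lemma ip_sum_left: "ip I (\<lambda>x. \<Sum>e\<in>E. f e x) h = (\<Sum>e\<in>E. ip I (f e) h)"
  by (simp add: ip_def sum_distrib_right) (rule sum.swap)

lemma ip_sum_right: "ip I h (\<lambda>x. \<Sum>e\<in>E. f e x) = (\<Sum>e\<in>E. ip I h (f e))"
  by (simp add: ip_commute[of I h] ip_sum_left)

lemma ip_self_nonneg: "0 \<le> ip I f f"
  by (simp add: ip_def sum_nonneg)

lemma ip_self_eq_0_iff: "finite I \<Longrightarrow> ip I f f = 0 \<longleftrightarrow> (\<forall>i\<in>I. f i = 0)"
  by (simp add: ip_def sum_nonneg_eq_0_iff)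

lemma ip_self_scale: "ip I (\<lambda>x. c * f x) (\<lambda>x. c * f x) = c\<^sup>2 * ip I f f"
  by (simp add: ip_scale_left ip_scale_right power2_eq_square)

lemma ip_self_diff: "ip I (\<lambda>x. f x - g x) (\<lambda>x. f x - g x) = ip I f f - 2 * ip I f g + ip I g g"
  by (simp add: ip_diff_left ip_diff_right ip_commute[of I g f])

lemma ip_Cauchy_Schwarz: "\<bar>ip I f g\<bar> \<le> sqrt (ip I f f) * sqrt (ip I g g)"
proof -
  have "\<bar>ip I f g\<bar> \<le> (\<Sum>i\<in>I. \<bar>f i\<bar> * \<bar>g i\<bar>)"
    unfolding ip_def by (rule order_trans[OF sum_abs]) (simp add: abs_mult)
  also have "\<dots> \<le> L2_set f I * L2_set g I"
    by (rule L2_set_mult_ineq)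
  finally show ?thesis
    by (simp add: ip_def L2_set_def power2_eq_square)
qed

lemma ip_proj:
  assumes "orthonormal I E" "e \<in> E"
  shows "ip I (proj I E f) e = ip I f e"
proof -
  have "ip I (proj I E f) e = (\<Sum>e'\<in>E. ip I f e' * ip I e' e)"
    by (simp add: proj_def ip_sum_left ip_scale_left)
  also have "\<dots> = (\<Sum>e'\<in>E. if e' = e then ip I f e else 0)"
    using assms by (intro sum.cong) (auto simp: orthonormal_def)
  also have "\<dots> = ip I f e" using assms by (simp add: orthonormal_def)
  finally show ?thesis .
qed

lemma ip_proj_right: "ip I h (proj I E f) = (\<Sum>e\<in>E. ip I f e * ip I h e)"
  by (simp add: proj_def ip_sum_right ip_scale_right)

lemma ip_proj_self: "orthonormal I E \<Longrightarrow> ip I (proj I E f) (proj I E f) = (\<Sum>e\<in>E. (ip I f e)\<^sup>2)"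
  unfolding ip_proj_right by (intro sum.cong) (auto simp: ip_proj power2_eq_square)

lemma ip_proj_symmetric: "ip I (proj I E f) h = ip I f (proj I E h)"
  by (simp add: ip_proj_right ip_commute[of I "proj I E f" h] mult.commute ip_commute[of I f] ip_commute[of I h])

lemma proj_add: "proj I E (\<lambda>x. f x + g x) = (\<lambda>x. proj I E f x + proj I E g x)"
  and proj_scale: "proj I E (\<lambda>x. c * f x) = (\<lambda>x. c * proj I E f x)"
  by (simp_all add: proj_def ip_add_left ip_scale_left algebra_simps sum.distrib sum_distrib_left)

lemma proj_sum: "proj I E (\<lambda>x. \<Sum>a\<in>A. f a x) = (\<lambda>x. \<Sum>a\<in>A. proj I E (f a) x)"
  by (simp add: proj_def ip_sum_left sum_distrib_right) (subst sum.swap, rule refl)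

lemma ip_diff_proj:
  "orthonormal I E \<Longrightarrow> ip I (\<lambda>x. f x - proj I E f x) (\<lambda>x. f x - proj I E f x)
     = ip I f f - (\<Sum>e\<in>E. (ip I f e)\<^sup>2)"
  unfolding ip_self_diff ip_proj_self by (simp add: ip_proj_right power2_eq_square)

lemma bessel: "orthonormal I E \<Longrightarrow> (\<Sum>e\<in>E. (ip I f e)\<^sup>2) \<le> ip I f f"
  using ip_diff_proj[of I E f] ip_self_nonneg[of I "\<lambda>x. f x - proj I E f x"] by simp

text \<open>Bessel's inequality at the indicator of a point bounds the sum of
  \<open>(e i)\<^sup>2\<close> over \<open>E\<close> by 1; summing over \<open>i\<close> turns the
  norms into \<open>card E\<close>. The bound makes a largest orthonormal subset of a subspace exist
  and later limits the number of Gaussian events.\<close>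

lemma orthonormal_card_le:
  assumes "finite I" "orthonormal I E"
  shows "card E \<le> card I"
proof -
  have *: "(\<Sum>e\<in>E. (e i)\<^sup>2) \<le> 1" if "i \<in> I" for i
  proof -
    let ?u = "\<lambda>x. if x = i then 1 else (0::real)"
    have "ip I ?u e = e i" for e
      using that assms(1) unfolding ip_def by (simp add: if_distrib[of "\<lambda>c. c * _"] cong: if_cong)
    moreover have "ip I ?u ?u = 1" using that assms(1) unfolding ip_def
      by (simp add: if_distrib[of "\<lambda>c. c * _"] cong: if_cong)
    ultimately show ?thesis using bessel[OF assms(2), of ?u] by simp
  qed
  have "real (card E) = (\<Sum>e\<in>E. ip I e e)" using assms(2) by (simp add: orthonormal_def)
  also have "\<dots> = (\<Sum>i\<in>I. \<Sum>e\<in>E. (e i)\<^sup>2)"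
    unfolding ip_def by (subst sum.swap) (simp add: power2_eq_square)
  also have "\<dots> \<le> (\<Sum>i\<in>I. 1)" using * by (intro sum_mono)
  finally show ?thesis by simp
qed

lemma orthonormal_extend:
  assumes "finite I" "orthonormal I E" "i \<in> I" "f i \<noteq> proj I E f i"
  obtains c e where "e = (\<lambda>x. c * (f x - proj I E f x))" "c \<noteq> 0" "e \<notin> E" "orthonormal I (insert e E)"
proof -
  let ?r = "\<lambda>x. f x - proj I E f x"
  define c where "c = 1 / sqrt (ip I ?r ?r)"
  define e where "e = (\<lambda>x. c * ?r x)"
  have pos: "ip I ?r ?r > 0"
    using ip_self_eq_0_iff[OF assms(1), of ?r] assms(3,4) ip_self_nonneg[of I ?r] by force
  have ee: "ip I e e = 1"
    using pos unfolding e_def ip_self_scale by (simp add: c_def power_divide)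
  have eo: "ip I e e' = 0" if "e' \<in> E" for e'
    using that by (simp add: e_def ip_scale_left ip_diff_left ip_proj[OF assms(2)])
  have "e \<notin> E" using eo[of e] ee by auto
  moreover have "orthonormal I (insert e E)"
    using assms(2) ee eo eo[unfolded ip_commute[of I e]] by (auto simp: orthonormal_def)
  moreover have "c \<noteq> 0" using pos by (simp add: c_def)
  ultimately show ?thesis using that e_def by blast
qed

lemma proj_insert: "finite E \<Longrightarrow> e \<notin> E \<Longrightarrow> proj I (insert e E) f x = ip I f e * e x + proj I E f x"
  by (simp add: proj_def)

lemma gram_schmidt:
  assumes "finite I" "finite B"
  shows "\<exists>E. orthonormal I E \<and> card E \<le> card B \<and> (\<forall>b\<in>B. \<forall>x\<in>I. proj I E b x = b x)"
  using assms(2)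
proof induction
  case empty
  then show ?case by (intro exI[of _ "{}"]) (simp add: orthonormal_def)
next
  case (insert b B)
  then obtain E where E: "orthonormal I E" "card E \<le> card B" "\<And>b x. b \<in> B \<Longrightarrow> x \<in> I \<Longrightarrow> proj I E b x = b x"
    by blast
  show ?case
  proof (cases "\<forall>x\<in>I. proj I E b x = b x")
    case True
    then show ?thesis using E insert by (intro exI[of _ E]) auto
  next
    case False
    then obtain i where i: "i \<in> I" "b i \<noteq> proj I E b i" by force
    obtain c e where e: "e = (\<lambda>x. c * (b x - proj I E b x))" "c \<noteq> 0" "e \<notin> E"
      "orthonormal I (insert e E)"
      by (rule orthonormal_extend[OF assms(1) E(1) i])
    have fin: "finite E" using E(1) by (simp add: orthonormal_def)
    have b': "b = (\<lambda>x. e x / c + proj I E b x)" using e by (auto simp: e(1))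
    \<comment> \<open>What \<open>E\<close> already reproduces is orthogonal to the new vector, so
      the insertion leaves those projections unchanged.\<close>
    have orth: "ip I f e = 0" if "\<And>x. x \<in> I \<Longrightarrow> proj I E f x = f x" for f
    proof -
      have "ip I f e = ip I (proj I E f) e" by (rule ip_cong) (use that in auto)
      also have "\<dots> = (\<Sum>e'\<in>E. ip I f e' * ip I e' e)" by (simp add: proj_def ip_sum_left ip_scale_left)
      also have "\<dots> = 0"
        using e(3,4) by (intro sum.neutral) (auto simp: orthonormal_def)
      finally show ?thesis .
    qed
    have ee: "ip I e e = 1" using e(4) by (simp add: orthonormal_def)
    have pe: "ip I (proj I E b) e = 0"
      using e(3,4) unfolding proj_def ip_sum_left ip_scale_left
      by (intro sum.neutral) (auto simp: orthonormal_def)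
    have "ip I b e = ip I (\<lambda>x. (1 / c) * e x + proj I E b x) e" using b' by simp
    also have "\<dots> = 1 / c" by (simp add: ip_add_left ip_scale_left ee pe del: times_divide_eq_left)
    finally have be: "ip I b e = 1 / c" .
    have "proj I (insert e E) b' x = b' x" if "b' \<in> insert b B" "x \<in> I" for b' x
    proof (cases "b' = b")
      case True
      then show ?thesis using fin e(3) be fun_cong[OF b', of x] by (simp add: proj_insert)
    next
      case False
      then have "b' \<in> B" using that by auto
      then show ?thesis using fin e(3) orth[of b'] E(3) that(2) by (simp add: proj_insert)
    qed
    then show ?thesis using e E insert fin by (intro exI[of _ "insert e E"]) auto
  qed
qed

section \<open>Linear subspaces and their orthonormal bases\<close>

definition fsubspace :: "('a \<Rightarrow> real) set \<Rightarrow> bool" where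
  "fsubspace V \<longleftrightarrow> (\<lambda>_. 0) \<in> V \<and> (\<forall>f\<in>V. \<forall>g\<in>V. \<forall>c. (\<lambda>x. f x + c * g x) \<in> V)"

lemma fsubspace_lincomb: "fsubspace V \<Longrightarrow> f \<in> V \<Longrightarrow> g \<in> V \<Longrightarrow> (\<lambda>x. f x + c * g x) \<in> V"
  by (simp add: fsubspace_def)

lemma fsubspace_scale: "fsubspace V \<Longrightarrow> g \<in> V \<Longrightarrow> (\<lambda>x. c * g x) \<in> V"
  using fsubspace_lincomb[of V "\<lambda>_. 0" g c] by (simp add: fsubspace_def)

lemma fsubspace_diff: "fsubspace V \<Longrightarrow> f \<in> V \<Longrightarrow> g \<in> V \<Longrightarrow> (\<lambda>x. f x - g x) \<in> V"
  using fsubspace_lincomb[of V f g "-1"] by simp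

lemma fsubspace_add: "fsubspace V \<Longrightarrow> f \<in> V \<Longrightarrow> g \<in> V \<Longrightarrow> (\<lambda>x. f x + g x) \<in> V"
  using fsubspace_lincomb[of V f g 1] by simp

lemma fsubspace_sum:
  assumes "fsubspace V" "\<And>a. a \<in> A \<Longrightarrow> f a \<in> V"
  shows "(\<lambda>x. \<Sum>a\<in>A. f a x) \<in> V"
proof (cases "finite A")
  case True
  from this assms(2) show ?thesis
    by (induction A) (use assms(1) in \<open>simp_all add: fsubspace_add, simp add: fsubspace_def\<close>)
next
  case False
  then show ?thesis using assms(1) by (simp add: fsubspace_def)
qed

lemma proj_in_fsubspace: "fsubspace V \<Longrightarrow> E \<subseteq> V \<Longrightarrow> proj I E f \<in> V"
  unfolding proj_def by (intro fsubspace_sum fsubspace_scale) auto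

text \<open>An orthonormal subset of \<open>V\<close> of greatest size exists because
  \<open>card I\<close> bounds all sizes; a vector that it failed to reproduce would supply one more
  element.\<close>

lemma fsubspace_orthonormal_basis:
  assumes "finite I" "fsubspace V"
  shows "\<exists>E. orthonormal I E \<and> E \<subseteq> V \<and> (\<forall>v\<in>V. \<forall>x\<in>I. proj I E v x = v x)"
proof -
  let ?P = "\<lambda>c. \<exists>E. orthonormal I E \<and> E \<subseteq> V \<and> card E = c"
  have "?P 0" by (intro exI[of _ "{}"]) (simp add: orthonormal_def)
  moreover have "\<And>c. ?P c \<Longrightarrow> c \<le> card I" using orthonormal_card_le[OF assms(1)] by auto
  ultimately have "?P (Greatest ?P)" "\<And>c'. ?P c' \<Longrightarrow> c' \<le> Greatest ?P"
    using GreatestI_nat[of ?P 0 "card I"] Greatest_le_nat[of ?P _ "card I"] by blast+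
  then obtain c where c: "?P c" "\<And>c'. ?P c' \<Longrightarrow> c' \<le> c" by blast
  then obtain E where E: "orthonormal I E" "E \<subseteq> V" "card E = c" by blast
  have "proj I E v x = v x" if v: "v \<in> V" "x \<in> I" for v x
  proof (rule ccontr)
    assume "proj I E v x \<noteq> v x"
    then have ne: "v x \<noteq> proj I E v x" by simp
    obtain a e where e: "e = (\<lambda>y. a * (v y - proj I E v y))" "a \<noteq> 0" "e \<notin> E"
      "orthonormal I (insert e E)"
      by (rule orthonormal_extend[where f = v, OF assms(1) E(1) v(2) ne])
    have "e \<in> V" unfolding e(1)
      by (intro fsubspace_scale fsubspace_diff proj_in_fsubspace assms v E)
    moreover have "card (insert e E) = Suc c"
      using e(3) E(1,3) by (simp add: orthonormal_def)
    ultimately have "?P (Suc c)" using e(4) E(2)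
      by (intro exI[of _ "insert e E"]) simp
    then show False using c(2)[of "Suc c"] by (meson Suc_n_not_le_n)
  qed
  then show ?thesis using E by blast
qed

section \<open>Gaussian tail bounds\<close>

text \<open>Since \<open>a * a \<le> a * x\<close>, the tail of the centred density can be traded
  for the density of mean \<open>a\<close>, whose total mass is 1. No tail integral has to be
  computed.\<close>

lemma normal_density_tilt:
  assumes "\<sigma> > 0" "0 \<le> a" "a \<le> x"
  shows "normal_density 0 \<sigma> x \<le> exp (- (a / \<sigma>)\<^sup>2 / 2) * normal_density a \<sigma> x"
proof -
  have "a * a \<le> a * x" using assms by (intro mult_left_mono) auto
  then have "- x\<^sup>2 \<le> - a\<^sup>2 - (x - a)\<^sup>2"
    by (simp add: power2_eq_square algebra_simps)
  then have "- x\<^sup>2 / (2 * \<sigma>\<^sup>2) \<le> (- a\<^sup>2 - (x - a)\<^sup>2) / (2 * \<sigma>\<^sup>2)"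
    by (intro divide_right_mono) auto
  then have "exp (- x\<^sup>2 / (2 * \<sigma>\<^sup>2)) \<le> exp (- (a / \<sigma>)\<^sup>2 / 2 + - (x - a)\<^sup>2 / (2 * \<sigma>\<^sup>2))"
    by (simp add: power_divide diff_divide_distrib)
  then show ?thesis
    unfolding normal_density_def exp_add by (simp add: divide_right_mono mult_ac)
qed

lemma (in prob_space) gaussian_tail:
  assumes X: "distributed M lborel X (normal_density 0 \<sigma>)" and "\<sigma> > 0" "\<tau> \<ge> 0"
  shows "prob {\<omega> \<in> space M. \<bar>X \<omega>\<bar> > \<tau> * \<sigma>} \<le> 2 * exp (- \<tau>\<^sup>2 / 2)"
proof -
  let ?A = "{x::real. \<bar>x\<bar> > \<tau> * \<sigma>}" and ?c = "exp (- \<tau>\<^sup>2 / 2)"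
  have nn: "(\<integral>\<^sup>+x. ennreal (normal_density m \<sigma> x) \<partial>lborel) = 1" for m
    using nn_integral_eq_integral[OF integrable_normal_density[OF assms(2), of m]]
      integral_normal_density[OF assms(2), of m] by simp
  \<comment> \<open>The factor 2 of the tail bound is the total mass of the two shifted densities,
    one for each side.\<close>
  have bound: "ennreal (normal_density 0 \<sigma> x) * indicator ?A x
      \<le> ennreal ?c * (ennreal (normal_density (\<tau> * \<sigma>) \<sigma> x) + ennreal (normal_density (- (\<tau> * \<sigma>)) \<sigma> x))" for x
  proof (cases "x \<in> ?A")
    case True
    have "normal_density 0 \<sigma> x \<le> ?c * normal_density (\<tau> * \<sigma>) \<sigma> x
       \<or> normal_density 0 \<sigma> x \<le> ?c * normal_density (- (\<tau> * \<sigma>)) \<sigma> x"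
    proof (cases "x \<ge> 0")
      case True
      with \<open>x \<in> ?A\<close> normal_density_tilt[of \<sigma> "\<tau> * \<sigma>" x] assms show ?thesis by simp
    next
      case False
      with \<open>x \<in> ?A\<close> normal_density_tilt[of \<sigma> "\<tau> * \<sigma>" "-x"] assms
      moreover have "(- x - \<tau> * \<sigma>)\<^sup>2 = (x + \<tau> * \<sigma>)\<^sup>2"
        by (simp add: power2_eq_square algebra_simps)
      ultimately show ?thesis by (simp add: normal_density_def)
    qed
    then have "normal_density 0 \<sigma> x \<le>
        ?c * (normal_density (\<tau> * \<sigma>) \<sigma> x + normal_density (- (\<tau> * \<sigma>)) \<sigma> x)"
      by (auto simp: distrib_left intro: order_trans add_increasing add_increasing2)
    then show ?thesis using True
      by (simp add: ennreal_mult[symmetric] ennreal_plus[symmetric] ennreal_leI del: ennreal_plus)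
  qed simp
  have "emeasure M (X -` ?A \<inter> space M) = (\<integral>\<^sup>+x. ennreal (normal_density 0 \<sigma> x) * indicator ?A x \<partial>lborel)"
    by (rule distributed_emeasure[OF X]) measurable
  also have "\<dots> \<le> (\<integral>\<^sup>+x. ennreal ?c * (ennreal (normal_density (\<tau> * \<sigma>) \<sigma> x)
       + ennreal (normal_density (- (\<tau> * \<sigma>)) \<sigma> x)) \<partial>lborel)"
    by (intro nn_integral_mono bound)
  also have "\<dots> = ennreal ?c * (1 + 1)"
    by (subst nn_integral_cmult, measurable) (subst nn_integral_add, auto simp: nn)
  also have "\<dots> = ennreal (2 * ?c)"
    by (simp add: ennreal_mult' mult.commute)
  finally have "emeasure M (X -` ?A \<inter> space M) \<le> ennreal (2 * ?c)" .
  moreover have "X -` ?A \<inter> space M = {\<omega> \<in> space M. \<bar>X \<omega>\<bar> > \<tau> * \<sigma>}" by auto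
  ultimately show ?thesis
    by (simp add: emeasure_eq_measure)
qed

lemma gaussian_noise_measurable:
  "gaussian_noise M I \<sigma> \<epsilon> \<Longrightarrow> j \<in> I \<Longrightarrow> \<epsilon> j \<in> borel_measurable M"
  unfolding gaussian_noise_def by (metis distributed_measurable measurable_lborel1)

lemma gaussian_noise_ip_measurable:
  "gaussian_noise M I \<sigma> \<epsilon> \<Longrightarrow> (\<lambda>\<omega>. ip I (\<lambda>i. \<epsilon> i \<omega>) z) \<in> borel_measurable M"
  unfolding ip_def by (intro borel_measurable_sum borel_measurable_times) (auto simp: gaussian_noise_measurable)

lemma gaussian_noise_ip_tail:
  assumes g: "gaussian_noise M I \<sigma> \<epsilon>" and "finite I" "\<sigma> > 0" "\<tau> \<ge> 0"
  shows "measure M {\<omega> \<in> space M. \<bar>ip I (\<lambda>i. \<epsilon> i \<omega>) z\<bar> > \<tau> * \<sigma> * sqrt (ip I z z)} \<le> 2 * exp (- \<tau>\<^sup>2 / 2)"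
proof -
  interpret prob_space M using g by (simp add: gaussian_noise_def)
  \<comment> \<open>The normal laws that are summed must have positive variance, so coordinates of
    weight zero are removed. If none is left, the form vanishes and the strict inequality describes
    the empty event.\<close>
  define I' where "I' = {i \<in> I. z i \<noteq> 0}"
  have I': "finite I'" "I' \<subseteq> I" using assms(2) by (auto simp: I'_def)
  have ipI': "ip I f z = (\<Sum>i\<in>I'. z i * f i)" for f
    unfolding ip_def using assms(2) by (intro sum.mono_neutral_cong_right) (auto simp: I'_def)
  show ?thesis
  proof (cases "I' = {}")
    case True
    then have "ip I f z = 0" for f using ipI' by simp
    then show ?thesis by simp
  next
    case False
    have ind: "indep_vars (\<lambda>_. borel) \<epsilon> I'"
      using g I'(2) indep_vars_subset unfolding gaussian_noise_def by blast
    have "indep_vars (\<lambda>_. borel) (\<lambda>i \<omega>. z i * \<epsilon> i \<omega>) I'"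
      by (rule indep_vars_compose2[OF ind]) measurable
    moreover have "distributed M lborel (\<lambda>\<omega>. z i * \<epsilon> i \<omega>) (normal_density 0 (\<bar>z i\<bar> * \<sigma>))"
      if "i \<in> I'" for i
    proof -
      have "distributed M lborel (\<epsilon> i) (normal_density 0 \<sigma>)"
        using g that I'(2) by (auto simp: gaussian_noise_def)
      from normal_density_affine[OF this assms(3), of "z i" 0] that show ?thesis
        by (simp add: I'_def)
    qed
    ultimately have "distributed M lborel (\<lambda>\<omega>. \<Sum>i\<in>I'. z i * \<epsilon> i \<omega>)
        (normal_density (\<Sum>i\<in>I'. 0) (sqrt (\<Sum>i\<in>I'. (\<bar>z i\<bar> * \<sigma>)\<^sup>2)))"
      using I' False assms(3) by (intro sum_indep_normal) (auto simp: I'_def)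
    moreover have "(\<Sum>i\<in>I'. (\<bar>z i\<bar> * \<sigma>)\<^sup>2) = \<sigma>\<^sup>2 * ip I z z"
      unfolding ipI' sum_distrib_left by (intro sum.cong) (auto simp: power_mult_distrib power2_eq_square)
    then have "sqrt (\<Sum>i\<in>I'. (\<bar>z i\<bar> * \<sigma>)\<^sup>2) = \<sigma> * sqrt (ip I z z)"
      using assms(3) by (simp add: real_sqrt_mult)
    ultimately have *: "distributed M lborel (\<lambda>\<omega>. ip I (\<lambda>i. \<epsilon> i \<omega>) z) (normal_density 0 (\<sigma> * sqrt (ip I z z)))"
      by (simp add: ipI')
    have "ip I z z > 0"
      using ip_self_nonneg[of I z] ip_self_eq_0_iff[OF assms(2), of z] False by (force simp: I'_def)
    then show ?thesis
      using gaussian_tail[OF *, of \<tau>] assms by (simp add: mult.assoc)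
  qed
qed

lemma gaussian_noise_union:
  assumes g: "gaussian_noise M I \<sigma> \<epsilon>" and "finite I" "\<sigma> > 0" "\<tau> \<ge> 0" "finite Z"
  defines "A \<equiv> {\<omega> \<in> space M. \<forall>z\<in>Z. \<bar>ip I (\<lambda>i. \<epsilon> i \<omega>) z\<bar> \<le> \<tau> * \<sigma> * sqrt (ip I z z)}"
  shows "A \<in> sets M" "measure M A \<ge> 1 - real (card Z) * (2 * exp (- \<tau>\<^sup>2 / 2))"
proof -
  interpret prob_space M using g by (simp add: gaussian_noise_def)
  note [measurable] = gaussian_noise_ip_measurable[OF g]
  let ?B = "\<lambda>z. {\<omega> \<in> space M. \<bar>ip I (\<lambda>i. \<epsilon> i \<omega>) z\<bar> > \<tau> * \<sigma> * sqrt (ip I z z)}"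
  have B: "?B z \<in> sets M" for z by measurable
  have A: "A = space M - (\<Union>z\<in>Z. ?B z)" by (auto simp: A_def not_le)
  have "(\<Union>z\<in>Z. ?B z) \<in> sets M" using B assms(5) by (intro sets.finite_UN) auto
  then show "A \<in> sets M" unfolding A by (rule sets.compl_sets)
  have "prob (\<Union>z\<in>Z. ?B z) \<le> (\<Sum>z\<in>Z. prob (?B z))"
    using B assms(5) by (intro finite_measure_subadditive_finite) auto
  also have "\<dots> \<le> (\<Sum>z\<in>Z. 2 * exp (- \<tau>\<^sup>2 / 2))"
    by (intro sum_mono gaussian_noise_ip_tail assms)
  finally have "prob (\<Union>z\<in>Z. ?B z) \<le> real (card Z) * (2 * exp (- \<tau>\<^sup>2 / 2))" by simp
  then show "prob A \<ge> 1 - real (card Z) * (2 * exp (- \<tau>\<^sup>2 / 2))"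
    unfolding A using B assms(5) by (subst prob_compl) auto
qed

section \<open>The difference operator as a matrix, and its dictionary\<close>

text \<open>Row \<open>j\<close>, column \<open>y\<close> of the one-dimensional difference matrix.
  Matrix entries turn the iterated operator into a product over the coordinates and give access to
  its transpose.\<close>

definition dcoef :: "nat \<Rightarrow> nat \<Rightarrow> nat \<Rightarrow> nat \<Rightarrow> real" where
  "dcoef k N j y = (if y \<le> j \<and> j \<le> y + k
     then real N ^ (k - 1) * ((-1) ^ (j - y) * real (k choose (j - y))) else 0)"

lemma sum_dcoef:
  assumes "j \<in> {k + 1..N}"
  shows "(\<Sum>y=1..N. dcoef k N j y * F y) =
    real N ^ (k - 1) * (\<Sum>l=0..k. (-1) ^ l * real (k choose l) * F (j - l))"
proof -
  have "(\<Sum>y=1..N. dcoef k N j y * F y) = (\<Sum>y\<in>{j - k..j}. dcoef k N j y * F y)"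
    using assms by (intro sum.mono_neutral_right) (auto simp: dcoef_def)
  also have "\<dots> = (\<Sum>l=0..k. dcoef k N j (j - l) * F (j - l))"
    using assms by (intro sum.reindex_bij_witness[of _ "\<lambda>l. j - l" "\<lambda>y. j - y"]) auto
  also have "\<dots> = (\<Sum>l=0..k. real N ^ (k - 1) * ((-1) ^ l * real (k choose l) * F (j - l)))"
    using assms by (intro sum.cong) (auto simp: dcoef_def)
  finally show ?thesis by (simp add: sum_distrib_left)
qed

lemma partial_diff_eq:
  assumes "j i \<in> {k + 1..N}"
  shows "partial_diff (\<lambda>_. N) k i f j = (\<Sum>y=1..N. dcoef k N (j i) y * f (j(i := y)))"
  unfolding sum_dcoef[OF assms] by (simp add: partial_diff_def)

lemma sum_PiE_insert:
  fixes G :: "('a \<Rightarrow> 'b) \<Rightarrow> 'c::comm_monoid_add"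
  assumes "x \<notin> A"
  shows "(\<Sum>y\<in>PiE (insert x A) T. G y) = (\<Sum>y0\<in>T x. \<Sum>y\<in>PiE A T. G (y(x := y0)))"
proof -
  have "(\<Sum>y\<in>PiE (insert x A) T. G y) = (\<Sum>p\<in>T x \<times> PiE A T. G ((snd p)(x := fst p)))"
    unfolding PiE_insert_eq
    by (subst sum.reindex[OF inj_combinator[OF assms]]) (auto simp: case_prod_unfold)
  then show ?thesis by (simp add: sum.cartesian_product case_prod_unfold)
qed

text \<open>The range condition covers the coordinates from \<open>m\<close> on only: before the
  inner operators are evaluated, coordinate \<open>m\<close> is overwritten by a summation index
  from \<open>{1..N}\<close>, which may lie below \<open>k + 1\<close>. Hence \<open>j\<close> is
  arbitrary in the induction, which runs down from \<open>d + 1\<close>.\<close>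

lemma foldr_partial_diff:
  assumes "m \<le> d + 1" "\<And>i. i \<in> {m..d} \<Longrightarrow> j i \<in> {k + 1..N}"
  shows "foldr (partial_diff (\<lambda>_. N) k) [m..<d + 1] f j =
    (\<Sum>y\<in>PiE {m..d} (\<lambda>_. {1..N}). (\<Prod>i\<in>{m..d}. dcoef k N (j i) (y i)) * f (\<lambda>i. if i \<in> {m..d} then y i else j i))"
  using assms
proof (induction arbitrary: j rule: inc_induct)
  case base
  then show ?case by simp
next
  case (step m)
  have m: "{m..d} = insert m {Suc m..d}" using step by auto
  have upt: "[m..<d + 1] = m # [Suc m..<d + 1]" using step by (simp add: upt_conv_Cons)
  have "foldr (partial_diff (\<lambda>_. N) k) [m..<d + 1] f j
     = (\<Sum>y0=1..N. dcoef k N (j m) y0 * foldr (partial_diff (\<lambda>_. N) k) [Suc m..<d + 1] f (j(m := y0)))"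
    unfolding upt using step by (simp add: partial_diff_eq del: upt_Suc)
  also have "\<dots> = (\<Sum>y0=1..N. dcoef k N (j m) y0 *
      (\<Sum>y\<in>PiE {Suc m..d} (\<lambda>_. {1..N}). (\<Prod>i\<in>{Suc m..d}. dcoef k N ((j(m := y0)) i) (y i))
         * f (\<lambda>i. if i \<in> {Suc m..d} then y i else (j(m := y0)) i)))"
    using step.prems by (intro sum.cong refl arg_cong2[where f="(*)"] step.IH) auto
  also have "\<dots> = (\<Sum>y0=1..N. (\<Sum>y\<in>PiE {Suc m..d} (\<lambda>_. {1..N}).
      (\<Prod>i\<in>{m..d}. dcoef k N (j i) ((y(m := y0)) i)) * f (\<lambda>i. if i \<in> {m..d} then (y(m := y0)) i else j i)))"
  proof (intro sum.cong refl, subst sum_distrib_left, intro sum.cong refl)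
    fix y0 y
    have "(\<Prod>i\<in>{Suc m..d}. dcoef k N ((j(m := y0)) i) (y i))
        = (\<Prod>i\<in>{Suc m..d}. dcoef k N (j i) ((y(m := y0)) i))"
      by (intro prod.cong) auto
    moreover have "(\<lambda>i. if i \<in> {Suc m..d} then y i else (j(m := y0)) i)
       = (\<lambda>i. if i \<in> {m..d} then (y(m := y0)) i else j i)"
      unfolding m by auto
    ultimately show "dcoef k N (j m) y0 * ((\<Prod>i\<in>{Suc m..d}. dcoef k N ((j(m := y0)) i) (y i))
         * f (\<lambda>i. if i \<in> {Suc m..d} then y i else (j(m := y0)) i)) =
      (\<Prod>i\<in>{m..d}. dcoef k N (j i) ((y(m := y0)) i)) * f (\<lambda>i. if i \<in> {m..d} then (y(m := y0)) i else j i)"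
      unfolding m by (subst prod.insert) (auto simp: mult_ac)
  qed
  also have "\<dots> = (\<Sum>y\<in>PiE {m..d} (\<lambda>_. {1..N}). (\<Prod>i\<in>{m..d}. dcoef k N (j i) (y i)) * f (\<lambda>i. if i \<in> {m..d} then y i else j i))"
    using sum_PiE_insert[of m "{Suc m..d}" "\<lambda>y. (\<Prod>i\<in>{m..d}. dcoef k N (j i) (y i)) * f (\<lambda>i. if i \<in> {m..d} then y i else j i)" "\<lambda>_. {1..N}"]
    unfolding m by simp
  finally show ?case .
qed

lemma total_diff_eq:
  assumes "j \<in> diff_cube d N k"
  shows "cube_diff d N k f j =
    (\<Sum>y\<in>cube d N. (\<Prod>i=1..d. dcoef k N (j i) (y i)) * f y)"
proof -
  have "cube_diff d N k f j = (\<Sum>y\<in>PiE {1..d} (\<lambda>_. {1..N}).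
     (\<Prod>i=1..d. dcoef k N (j i) (y i)) * f (\<lambda>i. if i \<in> {1..d} then y i else j i))"
    unfolding total_diff_def
    by (rule foldr_partial_diff) (use assms in \<open>auto simp: idx_def PiE_iff\<close>)
  also have "\<dots> = (\<Sum>y\<in>PiE {1..d} (\<lambda>_. {1..N}). (\<Prod>i=1..d. dcoef k N (j i) (y i)) * f y)"
  proof (intro sum.cong refl arg_cong2[where f="(*)"] arg_cong[where f=f] ext)
    fix y i assume "y \<in> PiE {1..d} (\<lambda>_. {1..N})"
    then show "(if i \<in> {1..d} then y i else j i) = y i"
      using assms by (auto simp: idx_def PiE_iff extensional_def)
  qed
  finally show ?thesis by (simp add: idx_def)
qed

text \<open>Polymorphic in the argument: splines are differenced over the integers, cutoff functions
  over the reals, and neither subtraction truncates.\<close>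

definition fdiff :: "nat \<Rightarrow> ('a::ring_1 \<Rightarrow> real) \<Rightarrow> 'a \<Rightarrow> real" where
  "fdiff k F x = (\<Sum>l\<le>k. (-1) ^ l * real (k choose l) * F (x - of_nat l))"

lemma fdiff_0 [simp]: "fdiff 0 F x = F x"
  by (simp add: fdiff_def)

lemma fdiff_Suc: "fdiff (Suc k) F x = fdiff k F x - fdiff k F (x - 1)"
proof -
  let ?G = "\<lambda>l. F (x - of_nat l)"
  have "fdiff (Suc k) F x = ?G 0 + (\<Sum>l\<le>k. (-1) ^ Suc l * real (Suc k choose Suc l) * ?G (Suc l))"
    unfolding fdiff_def by (subst sum.atMost_Suc_shift) simp
  also have "\<dots> = (?G 0 + (\<Sum>l\<le>k. (-1) ^ Suc l * real (k choose Suc l) * ?G (Suc l)))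
      - (\<Sum>l\<le>k. (-1) ^ l * real (k choose l) * ?G (Suc l))"
    by (simp add: algebra_simps sum.distrib sum_negf sum_subtractf)
  also have "?G 0 + (\<Sum>l\<le>k. (-1) ^ Suc l * real (k choose Suc l) * ?G (Suc l))
     = (\<Sum>l\<le>Suc k. (-1) ^ l * real (k choose l) * ?G l)"
    by (subst sum.atMost_Suc_shift) simp
  also have "\<dots> = fdiff k F x" by (simp add: fdiff_def)
  also have "(\<Sum>l\<le>k. (-1) ^ l * real (k choose l) * ?G (Suc l)) = fdiff k F (x - 1)"
    unfolding fdiff_def by (intro sum.cong) (auto simp: algebra_simps)
  finally show ?thesis .
qed

lemma fdiff_linear: "fdiff k (\<lambda>x. F x - G x) x = fdiff k F x - fdiff k G x"
  by (simp add: fdiff_def algebra_simps sum_subtractf)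

lemma fdiff_shift: "fdiff k (\<lambda>x. F (x - c)) x = fdiff k F (x - c)"
  by (simp add: fdiff_def algebra_simps)

lemma fdiff_Suc': "fdiff (Suc k) F x = fdiff k (\<lambda>x. F x - F (x - 1)) x"
  by (simp add: fdiff_Suc fdiff_linear fdiff_shift)

text \<open>The binomial coefficient \<open>z + k - 1\<close> over \<open>k - 1\<close>, set to zero
  for negative \<open>z\<close>: the fundamental solution of the k-th backward difference.\<close>

definition kspline :: "nat \<Rightarrow> int \<Rightarrow> real" where
  "kspline k z = (if z \<ge> 0 then pochhammer (of_int z + 1) (k - 1) / fact (k - 1) else 0)"

lemma kspline_diff:
  assumes "k \<ge> 1"
  shows "kspline (Suc k) z - kspline (Suc k) (z - 1) = kspline k z"
proof -
  obtain r where r: "k = Suc r" using assms by (cases k) auto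
  have *: "pochhammer (x + 1) (Suc r) - pochhammer x (Suc r) = real (Suc r) * pochhammer (x + 1) r" for x :: real
    unfolding pochhammer_rec[of x] pochhammer_Suc[of "x + 1"] by (simp add: algebra_simps)
  consider "z \<ge> 1" | "z = 0" | "z < 0" by linarith
  then show ?thesis
  proof cases
    case 1
    have "(pochhammer (of_int z + 1) (Suc r) - pochhammer (of_int z) (Suc r)) / fact (Suc r)
        = (real (Suc r) * pochhammer (of_int z + 1 :: real) r) / (real (Suc r) * fact r)"
      unfolding * by simp
    also have "\<dots> = pochhammer (of_int z + 1 :: real) r / fact r"
      by (rule mult_divide_mult_cancel_left) simp
    finally show ?thesis using 1 by (simp add: kspline_def r diff_divide_distrib)
  next
    case 2
    then show ?thesis by (simp add: kspline_def r pochhammer_fact[symmetric])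
  next
    case 3
    then show ?thesis by (simp add: kspline_def)
  qed
qed

lemma fdiff_kspline:
  assumes "k \<ge> 1"
  shows "fdiff k (kspline k) z = (if z = 0 then 1 else 0)"
  using assms
proof (induction k arbitrary: z rule: dec_induct)
  case base
  show ?case by (simp add: fdiff_Suc[of 0, simplified] kspline_def)
next
  case (step k)
  then show ?case by (simp add: fdiff_Suc' kspline_diff)
qed

text \<open>Green's function of the difference matrix: column \<open>j\<close> of a right inverse,
  the power of \<open>N\<close> cancelling the normalisation of \<open>dcoef\<close>.\<close>

definition dict :: "nat \<Rightarrow> nat \<Rightarrow> nat \<Rightarrow> nat \<Rightarrow> real" where
  "dict k N j y = kspline k (int y - int j) / real N ^ (k - 1)"

lemma sum_dcoef_dict:
  assumes "k \<ge> 1" "j \<in> {k + 1..N}"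
  shows "(\<Sum>y=1..N. dcoef k N j y * dict k N j' y) = (if j = j' then 1 else 0)"
proof -
  have "(\<Sum>y=1..N. dcoef k N j y * dict k N j' y) = fdiff k (kspline k) (int j - int j')"
    unfolding sum_dcoef[OF assms(2)] fdiff_def sum_distrib_left dict_def atMost_atLeast0
    using assms by (intro sum.cong) (auto simp: algebra_simps of_nat_diff)
  then show ?thesis using assms by (simp add: fdiff_kspline)
qed

lemma total_diff_dict:
  assumes "k \<ge> 1" "j \<in> diff_cube d N k" "j' \<in> diff_cube d N k"
  shows "cube_diff d N k (\<lambda>y. \<Prod>i=1..d. dict k N (j' i) (y i)) j = (if j = j' then 1 else 0)"
proof -
  have "cube_diff d N k (\<lambda>y. \<Prod>i=1..d. dict k N (j' i) (y i)) j
     = (\<Sum>y\<in>PiE {1..d} (\<lambda>_. {1..N}). \<Prod>i=1..d. dcoef k N (j i) (y i) * dict k N (j' i) (y i))"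
    unfolding total_diff_eq[OF assms(2)] by (simp add: prod.distrib idx_def)
  also have "\<dots> = (\<Prod>i=1..d. \<Sum>y=1..N. dcoef k N (j i) y * dict k N (j' i) y)"
    by (rule prod_sum_PiE[symmetric]) auto
  also have "\<dots> = (\<Prod>i=1..d. if j i = j' i then 1 else 0)"
    using assms by (intro prod.cong refl sum_dcoef_dict) (auto simp: idx_def PiE_iff)
  also have "\<dots> = (if j = j' then 1 else 0)"
  proof (cases "j = j'")
    case False
    then obtain i where "j i \<noteq> j' i" by auto
    moreover from this have "i \<in> {1..d}"
      using assms(2,3) unfolding idx_def by (metis PiE_arb)
    ultimately show ?thesis by (auto simp: prod_zero_iff)
  qed simp
  finally show ?thesis .
qed

section \<open>Finite differences of cutoff functions\<close>

text \<open>\<open>F\<close> lists a function together with its derivatives. The classical mean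
  value theorem is applied to one increment of \<open>fdiff k (F 0)\<close>, whose derivative is
  \<open>fdiff k (F 1)\<close>; the induction continues with the family shifted by one.\<close>

lemma fdiff_MVT:
  fixes F :: "nat \<Rightarrow> real \<Rightarrow> real"
  assumes "\<And>i x. i < k \<Longrightarrow> a - real k \<le> x \<Longrightarrow> x \<le> a \<Longrightarrow> (F i has_real_derivative F (Suc i) x) (at x)"
  shows "\<exists>\<xi>. a - real k \<le> \<xi> \<and> \<xi> \<le> a \<and> fdiff k (F 0) a = F k \<xi>"
  using assms
proof (induction k arbitrary: F a)
  case 0
  then show ?case by (intro exI[of _ a]) simp
next
  case (Suc k)
  have der: "(fdiff k (F 0) has_real_derivative fdiff k (F 1) x) (at x)" if "a - 1 \<le> x" "x \<le> a" for x
  proof -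
    have "((\<lambda>y. (-1) ^ l * real (k choose l) * F 0 (y - of_nat l)) has_real_derivative
        (-1) ^ l * real (k choose l) * F 1 (x - of_nat l)) (at x)" if "l \<le> k" for l
    proof -
      have "(F 0 has_real_derivative F 1 (x - real l)) (at (x - real l))"
        using Suc.prems[of 0 "x - real l"] that \<open>a - 1 \<le> x\<close> \<open>x \<le> a\<close> by simp
      then have "((\<lambda>y. F 0 (y - real l)) has_real_derivative F 1 (x - real l)) (at x)"
        using DERIV_shift[of "F 0" "F 1 (x - real l)" x "- real l"] by simp
      then show ?thesis by (intro DERIV_cmult) simp
    qed
    then show ?thesis unfolding fdiff_def[abs_def] by (intro DERIV_sum) auto
  qed
  have "\<exists>z>a - 1. z < a \<and> fdiff k (F 0) a - fdiff k (F 0) (a - 1) = (a - (a - 1)) * fdiff k (F 1) z"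
    by (rule MVT2) (use der in auto)
  then obtain z where z: "a - 1 < z" "z < a" "fdiff (Suc k) (F 0) a = fdiff k (F 1) z"
    by (auto simp: fdiff_Suc)
  have "\<exists>\<xi>. z - real k \<le> \<xi> \<and> \<xi> \<le> z \<and> fdiff k ((\<lambda>i. F (Suc i)) 0) z = (\<lambda>i. F (Suc i)) k \<xi>"
    using z(1,2) by (intro Suc.IH Suc.prems) auto
  then obtain \<xi> where "z - real k \<le> \<xi>" "\<xi> \<le> z" "fdiff k (F 1) z = F (Suc k) \<xi>" by auto
  then show ?case using z by (intro exI[of _ \<xi>]) auto
qed

lemma fdiff_bound:
  assumes "\<And>l. l \<le> k \<Longrightarrow> \<bar>F (x - of_nat l)\<bar> \<le> B"
  shows "\<bar>fdiff k F x\<bar> \<le> 2 ^ k * B"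
proof -
  have "\<bar>fdiff k F x\<bar> \<le> (\<Sum>l\<le>k. \<bar>(-1) ^ l * real (k choose l) * F (x - of_nat l)\<bar>)"
    unfolding fdiff_def by (rule sum_abs)
  also have "\<dots> \<le> (\<Sum>l\<le>k. real (k choose l) * B)"
    using assms by (intro sum_mono) (auto simp: abs_mult intro!: mult_left_mono)
  also have "\<dots> = real (\<Sum>l\<le>k. k choose l) * B"
    by (simp add: sum_distrib_right)
  finally show ?thesis by (simp add: choose_row_sum)
qed

lemma fdiff_cong: "(\<And>l. l \<le> k \<Longrightarrow> F (x - of_nat l) = G (x - of_nat l)) \<Longrightarrow> fdiff k F x = fdiff k G x"
  by (simp add: fdiff_def)

lemma fdiff_sum: "fdiff k (\<lambda>x. \<Sum>r\<in>A. c r * F r x) x = (\<Sum>r\<in>A. c r * fdiff k (F r) x)"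
proof -
  have "fdiff k (\<lambda>x. \<Sum>r\<in>A. c r * F r x) x
     = (\<Sum>l\<le>k. \<Sum>r\<in>A. c r * ((-1) ^ l * real (k choose l) * F r (x - of_nat l)))"
    unfolding fdiff_def sum_distrib_left by (intro sum.cong refl) (simp add: mult_ac)
  then show ?thesis unfolding fdiff_def sum_distrib_left by (subst (asm) sum.swap) simp
qed

lemma fdiff_const:
  assumes "k \<ge> 1"
  shows "fdiff k (\<lambda>_. c) x = 0"
proof -
  obtain r where "k = Suc r" using assms by (cases k) auto
  then show ?thesis by (simp add: fdiff_Suc) (simp add: fdiff_def)
qed

text \<open>Reversing the order of summation. It carries bounds for \<open>x \<ge> 0\<close> over to
  negative \<open>x\<close>, since \<open>real k - x\<close> is then at least
  \<open>\<bar>x\<bar>\<close>.\<close>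

lemma fdiff_even:
  fixes F :: "real \<Rightarrow> real"
  assumes "\<And>x. F (- x) = F x"
  shows "fdiff k F (real k - x) = (-1) ^ k * fdiff k F x"
proof -
  have "fdiff k F (real k - x) = (\<Sum>l\<le>k. (-1) ^ (k - l) * real (k choose (k - l)) * F (real k - x - real (k - l)))"
    unfolding fdiff_def
    by (intro sum.reindex_bij_witness[of _ "\<lambda>l. k - l" "\<lambda>l. k - l"]) auto
  also have "\<dots> = (\<Sum>l\<le>k. (-1) ^ k * ((-1) ^ l * real (k choose l) * F (x - real l)))"
  proof (intro sum.cong refl)
    fix l assume "l \<in> {..k}"
    then have l: "l \<le> k" by simp
    have "(-1::real) ^ (k - l) = (-1) ^ k * (-1) ^ l"
    proof -
      have "(-1::real) ^ k = (-1) ^ (k - l) * (-1) ^ l" using l by (simp add: power_add[symmetric])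
      then show ?thesis by (simp add: mult.assoc flip: power_mult_distrib)
    qed
    moreover have "F (real k - x - real (k - l)) = F (x - real l)"
      using assms[of "x - real l"] l by (simp add: of_nat_diff)
    ultimately show "(-1) ^ (k - l) * real (k choose (k - l)) * F (real k - x - real (k - l))
        = (-1) ^ k * ((-1) ^ l * real (k choose l) * F (x - real l))"
      using l by (simp add: binomial_symmetric[symmetric])
  qed
  finally show ?thesis by (simp add: fdiff_def sum_distrib_left)
qed

lemma fdiff_powr:
  assumes "R > 0" "x - real k > 0"
  shows "\<exists>\<xi>. x - real k \<le> \<xi> \<and> \<xi> \<le> x \<and>
    fdiff k (\<lambda>y. (y / R) powr p) x = (\<Prod>i<k. p - real i) * (\<xi> powr (p - real k) / R powr p)"
proof -
  define F where "F n y = (\<Prod>i<n. p - real i) * (y powr (p - real n) / R powr p)" for n y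
  have der: "(F n has_real_derivative F (Suc n) y) (at y)" if "y > 0" for n y
  proof -
    have "(F n has_real_derivative
        (\<Prod>i<n. p - real i) * ((p - real n) * y powr (p - real n - 1) / R powr p)) (at y)"
      unfolding F_def[abs_def] by (intro DERIV_cmult DERIV_cdivide has_real_derivative_powr that)
    also have "(\<Prod>i<n. p - real i) * ((p - real n) * y powr (p - real n - 1) / R powr p) = F (Suc n) y"
      by (simp add: F_def algebra_simps diff_divide_distrib)
    finally show ?thesis .
  qed
  have "\<exists>\<xi>. x - real k \<le> \<xi> \<and> \<xi> \<le> x \<and> fdiff k (F 0) x = F k \<xi>"
    by (rule fdiff_MVT) (use der assms in auto)
  moreover have "fdiff k (F 0) x = fdiff k (\<lambda>y. (y / R) powr p) x"
  proof (rule fdiff_cong)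
    fix l assume "l \<le> k"
    then have "x - real l > 0" using assms(2) by linarith
    then show "F 0 (x - of_nat l) = ((x - of_nat l) / R) powr p"
      using assms(1) by (simp add: F_def powr_divide)
  qed
  ultimately show ?thesis by (simp add: F_def)
qed

definition cutoff :: "(real \<Rightarrow> real) \<Rightarrow> real \<Rightarrow> real \<Rightarrow> real" where
  "cutoff H R y = (if \<bar>y\<bar> \<le> R then H (\<bar>y\<bar> / R) else 0)"

text \<open>\<open>W\<close> is the size that scaling predicts for a profile with exponents at least
  \<open>real k - \<theta>\<close>: \<open>\<theta> = 0\<close> will serve \<open>plateau\<close>
  and \<open>\<theta> = 1 / 2\<close> will serve \<open>cusp\<close>. The window of the difference,
  from \<open>x - real k\<close> to \<open>x\<close>, can lie beyond the support, across its edge,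
  well inside it or at the origin. The summands of the constant pay, in this order, for small
  \<open>R\<close>, the edge, the interior and the origin.\<close>

lemma cutoff_fdiff_nonneg:
  fixes H :: "real \<Rightarrow> real" and c p :: "nat \<Rightarrow> real"
  assumes k: "k \<ge> 1" and th: "0 \<le> \<theta>" "\<theta> \<le> 1"
    and p: "\<And>r. r \<in> A \<Longrightarrow> p r \<ge> real k - \<theta> \<and> p r > 0"
    and H: "\<And>u. 0 \<le> u \<Longrightarrow> u \<le> 1 \<Longrightarrow> H u = b + (\<Sum>r\<in>A. c r * u powr p r)"
    and HB: "\<And>u. 0 \<le> u \<Longrightarrow> u \<le> 1 \<Longrightarrow> \<bar>H u\<bar> \<le> B * (1 - u) ^ k"
    and R: "R \<ge> 1" and x: "x \<ge> 0"
  defines "W \<equiv> R powr (\<theta> - real k) * (1 + x) powr (- \<theta>)"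
  shows "\<bar>fdiff k (cutoff H R) x\<bar> \<le>
     (2 ^ k * B / (real (k + 1) powr (\<theta> - real k) * real (2 * k + 2) powr (- \<theta>))
      + 2 ^ k * B * real k ^ k * 3 powr \<theta>
      + (\<Sum>r\<in>A. \<bar>c r\<bar> * \<bar>\<Prod>i<k. p r - real i\<bar>) * real (k + 2) powr \<theta>
      + 2 ^ k * (\<Sum>r\<in>A. \<bar>c r\<bar>) * real (k + 1) powr (real k - \<theta>) * real (k + 2) powr \<theta>) * W"
    (is "_ \<le> (?K1 + ?K2 + ?K3 + ?K4) * W")
    and "x \<ge> R + real k \<Longrightarrow> fdiff k (cutoff H R) x = 0"
proof -
  let ?F = "cutoff H R"
  have thk: "\<theta> \<le> real k" using th k by linarith
  have H1: "H 1 = 0" using HB[of 1] k by (simp add: power_0_left)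
  have B0: "0 \<le> B" using HB[of 0] by simp
  have Fout: "?F y = 0" if "\<bar>y\<bar> \<ge> R" for y
    using that H1 R by (auto simp: cutoff_def dest: order_antisym)
  show zero: "fdiff k ?F x = 0" if "x \<ge> R + real k"
  proof -
    have "?F (x - real l) = 0" if "l \<le> k" for l
      using Fout[of "x - real l"] that \<open>x \<ge> R + real k\<close> by linarith
    then show ?thesis by (simp add: fdiff_def)
  qed
  have W0: "W > 0" using R x by (simp add: W_def)
  have K0: "0 \<le> ?K1" "0 \<le> ?K2" "0 \<le> ?K3" "0 \<le> ?K4"
    using B0 by (auto intro!: mult_nonneg_nonneg divide_nonneg_nonneg sum_nonneg)
  consider "x \<ge> R + real k" | "x < R + real k" "R < real (k + 1)"
    | "x < R + real k" "R \<ge> real (k + 1)" "x > R"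
    | "x \<le> R" "R \<ge> real (k + 1)" "x \<ge> real (k + 1)"
    | "x \<le> R" "R \<ge> real (k + 1)" "x < real (k + 1)" by linarith
  then have "\<bar>fdiff k ?F x\<bar> \<le> ?K1 * W \<or> \<bar>fdiff k ?F x\<bar> \<le> ?K2 * W \<or> \<bar>fdiff k ?F x\<bar> \<le> ?K3 * W \<or> \<bar>fdiff k ?F x\<bar> \<le> ?K4 * W"
  proof cases
    case 1
    then show ?thesis using zero K0 W0 by simp
  next
    \<comment> \<open>A small radius bounds \<open>W\<close> from below by the denominator of the
      first summand, so that bounding every value of the cutoff function by \<open>B\<close>
      suffices.\<close>
    case 2
    have "\<bar>?F y\<bar> \<le> B" for y
    proof (cases "\<bar>y\<bar> \<le> R")
      case True
      have u: "0 \<le> \<bar>y\<bar> / R" "\<bar>y\<bar> / R \<le> 1" using True R by auto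
      have "(1 - \<bar>y\<bar> / R) ^ k \<le> 1" using u by (intro power_le_one) auto
      then show ?thesis using HB[OF u] True B0 mult_left_mono[of "(1 - \<bar>y\<bar> / R) ^ k" 1 B]
        by (simp add: cutoff_def)
    next
      case False
      then show ?thesis using B0 by (simp add: cutoff_def)
    qed
    then have "\<bar>fdiff k ?F x\<bar> \<le> 2 ^ k * B" by (intro fdiff_bound)
    moreover have "real (k + 1) powr (\<theta> - real k) * real (2 * k + 2) powr (- \<theta>) \<le> W"
      unfolding W_def using 2 R x th k thk by (intro mult_mono powr_mono2') auto
    moreover have "a \<le> b / w * W" if "a \<le> b" "w \<le> W" "w > 0" "b \<ge> 0" for a b w :: real
      using that mult_left_mono[of w W b] by (simp add: divide_simps) (meson mult_right_mono order_trans less_imp_le)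
    ultimately have "\<bar>fdiff k ?F x\<bar> \<le> ?K1 * W"
      using B0 by simp
    then show ?thesis by blast
  next
    \<comment> \<open>The window meets the edge of the support, where the k-th derivative may jump;
      the zero of order k of \<open>H\<close> at 1 makes every value at most
      \<open>B * (real k / R) ^ k\<close>.\<close>
    case 3
    have "\<bar>?F (x - of_nat l)\<bar> \<le> B * (real k / R) ^ k" if l: "l \<le> k" for l
    proof (cases "x - real l \<le> R")
      case True
      have pos: "x - real l \<ge> 0" using 3 l by linarith
      then have u: "0 \<le> (x - real l) / R" "(x - real l) / R \<le> 1" using True R by auto
      have "1 - (x - real l) / R = (R - x + real l) / R" using R by (simp add: diff_divide_distrib add_divide_distrib)
      also have "\<dots> \<le> real k / R" using 3 R l by (intro divide_right_mono) auto
      finally have "1 - (x - real l) / R \<le> real k / R" .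
      then have "(1 - (x - real l) / R) ^ k \<le> (real k / R) ^ k"
        using u by (intro power_mono) auto
      then have "B * (1 - (x - real l) / R) ^ k \<le> B * (real k / R) ^ k"
        using B0 by (rule mult_left_mono)
      then show ?thesis using HB[OF u] True pos by (simp add: cutoff_def)
    next
      case False
      then show ?thesis using Fout[of "x - real l"] B0 R by simp
    qed
    then have "\<bar>fdiff k ?F x\<bar> \<le> 2 ^ k * (B * (real k / R) ^ k)" by (rule fdiff_bound)
    also have "\<dots> = 2 ^ k * B * real k ^ k * R powr (- real k)"
      using R by (simp add: power_divide powr_minus powr_realpow divide_simps)
    also have "R powr (- real k) \<le> 3 powr \<theta> * W"
    proof -
      have "R powr (- real k) = 3 powr \<theta> * (R powr (\<theta> - real k) * (3 * R) powr (- \<theta>))"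
        using R by (simp add: powr_mult powr_minus powr_diff divide_simps)
      also have "\<dots> \<le> 3 powr \<theta> * W"
        unfolding W_def using 3 R th x by (intro mult_left_mono powr_mono2') auto
      finally show ?thesis .
    qed
    finally have "\<bar>fdiff k ?F x\<bar> \<le> ?K2 * W"
      using B0 by (simp add: mult_left_mono mult.assoc)
    then show ?thesis by blast
  next
    \<comment> \<open>The mean value theorem applies here: the window stays at distance at least 1
      from the origin, and its points are bounded below by a fixed multiple of
      \<open>1 + x\<close>.\<close>
    case 4
    have xk: "x - real k \<ge> 1" using 4 by simp
    have "fdiff k ?F x = fdiff k (\<lambda>y. b - (\<Sum>r\<in>A. (- c r) * (y / R) powr p r)) x"
    proof (rule fdiff_cong)
      fix l assume "l \<le> k"
      then have "0 \<le> x - real l" "x - real l \<le> R" using 4 by linarith+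
      then show "?F (x - of_nat l) = b - (\<Sum>r\<in>A. (- c r) * ((x - of_nat l) / R) powr p r)"
        using R H[of "(x - real l) / R"] by (simp add: cutoff_def sum_negf)
    qed
    also have "\<dots> = (\<Sum>r\<in>A. c r * fdiff k (\<lambda>y. (y / R) powr p r) x)"
      unfolding fdiff_linear fdiff_const[OF k] fdiff_sum by (simp add: sum_negf)
    also have "\<bar>\<dots>\<bar> \<le> (\<Sum>r\<in>A. \<bar>c r\<bar> * (\<bar>\<Prod>i<k. p r - real i\<bar> * (real (k + 2) powr \<theta> * W)))"
    proof (rule order_trans[OF sum_abs], intro sum_mono, simp only: abs_mult, intro mult_left_mono)
      fix r assume r: "r \<in> A"
      obtain \<xi> where \<xi>: "x - real k \<le> \<xi>" "\<xi> \<le> x"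
        "fdiff k (\<lambda>y. (y / R) powr p r) x = (\<Prod>i<k. p r - real i) * (\<xi> powr (p r - real k) / R powr p r)"
        using fdiff_powr[of R x k "p r"] R xk by auto
      have "\<xi> powr (p r - real k) = \<xi> powr (p r - real k + \<theta>) * \<xi> powr (- \<theta>)"
        by (simp add: powr_add[symmetric])
      also have "\<dots> \<le> R powr (p r - real k + \<theta>) * ((1 + x) / real (k + 2)) powr (- \<theta>)"
      proof (rule mult_mono)
        have "real (k + 1) * 1 \<le> real (k + 1) * (x - real k)" using xk by (intro mult_left_mono) auto
        then have "1 + x \<le> (x - real k) * real (k + 2)" by (simp add: algebra_simps)
        also have "\<dots> \<le> \<xi> * real (k + 2)" using \<xi>(1) by (intro mult_right_mono) auto
        finally have "(1 + x) / real (k + 2) \<le> \<xi>" by (subst pos_divide_le_eq) auto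
        then show "\<xi> powr (- \<theta>) \<le> ((1 + x) / real (k + 2)) powr (- \<theta>)"
          using th x by (intro powr_mono2') auto
        show "\<xi> powr (p r - real k + \<theta>) \<le> R powr (p r - real k + \<theta>)"
          using \<xi> xk 4 p[OF r] by (intro powr_mono2) auto
      qed auto
      also have "\<dots> = R powr p r * (real (k + 2) powr \<theta> * W)"
        using R x by (simp add: W_def powr_add powr_diff powr_divide powr_minus divide_simps)
      finally have "\<xi> powr (p r - real k) / R powr p r \<le> real (k + 2) powr \<theta> * W"
        using R by (simp add: divide_le_eq mult.commute)
      then show "\<bar>fdiff k (\<lambda>y. (y / R) powr p r) x\<bar> \<le> \<bar>\<Prod>i<k. p r - real i\<bar> * (real (k + 2) powr \<theta> * W)"
        unfolding \<xi>(3) abs_mult by (intro mult_left_mono) auto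
    qed auto
    also have "\<dots> = ?K3 * W"
      unfolding sum_distrib_right by (intro sum.cong refl) (simp only: mult.assoc)
    finally show ?thesis by blast
  next
    \<comment> \<open>Powers of \<open>\<bar>y\<bar>\<close> may be singular at the origin. The
      difference annihilates the constant \<open>b\<close>, and what remains is small pointwise, as
      every exponent is at least \<open>real k - \<theta>\<close> and
      \<open>real (k + 1) / R \<le> 1\<close>.\<close>
    case 5
    have "fdiff k ?F x = fdiff k (\<lambda>y. ?F y - b) x"
      unfolding fdiff_linear fdiff_const[OF k] by simp
    also have "\<bar>\<dots>\<bar> \<le> 2 ^ k * ((\<Sum>r\<in>A. \<bar>c r\<bar>) * (real (k + 1) powr (real k - \<theta>) * R powr (\<theta> - real k)))"
    proof (rule fdiff_bound)
      fix l assume l: "l \<le> k"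
      let ?y = "\<bar>x - real l\<bar>"
      have y: "?y \<le> real (k + 1)" "?y \<le> R" using 5 x l by auto
      then have u: "0 \<le> ?y / R" "?y / R \<le> 1" using R by auto
      have "?F (x - of_nat l) - b = (\<Sum>r\<in>A. c r * (?y / R) powr p r)"
        using H[OF u] y by (simp add: cutoff_def)
      also have "\<bar>\<dots>\<bar> \<le> (\<Sum>r\<in>A. \<bar>c r\<bar> * (real (k + 1) powr (real k - \<theta>) * R powr (\<theta> - real k)))"
      proof (rule order_trans[OF sum_abs], intro sum_mono, simp only: abs_mult, intro mult_left_mono)
        fix r assume r: "r \<in> A"
        have "(?y / R) powr p r \<le> (real (k + 1) / R) powr p r"
          using y R p[OF r] by (intro powr_mono2) (auto simp: divide_right_mono)
        also have "\<dots> \<le> (real (k + 1) / R) powr (real k - \<theta>)"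
          using 5 R p[OF r] by (intro powr_mono') auto
        also have "\<dots> = real (k + 1) powr (real k - \<theta>) * R powr (\<theta> - real k)"
          using R by (simp add: powr_divide powr_diff divide_simps)
        finally show "\<bar>(?y / R) powr p r\<bar> \<le> real (k + 1) powr (real k - \<theta>) * R powr (\<theta> - real k)" by simp
      qed auto
      finally show "\<bar>?F (x - of_nat l) - b\<bar> \<le> (\<Sum>r\<in>A. \<bar>c r\<bar>) * (real (k + 1) powr (real k - \<theta>) * R powr (\<theta> - real k))"
        by (simp add: sum_distrib_right)
    qed
    also have "\<dots> = 2 ^ k * (\<Sum>r\<in>A. \<bar>c r\<bar>) * real (k + 1) powr (real k - \<theta>) * R powr (\<theta> - real k)"
      by simp
    also have "R powr (\<theta> - real k) \<le> real (k + 2) powr \<theta> * W"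
    proof -
      have "R powr (\<theta> - real k) = real (k + 2) powr \<theta> * (R powr (\<theta> - real k) * real (k + 2) powr (- \<theta>))"
        by (simp add: powr_minus divide_simps)
      also have "\<dots> \<le> real (k + 2) powr \<theta> * W"
        unfolding W_def using 5 R th x by (intro mult_left_mono powr_mono2') auto
      finally show ?thesis .
    qed
    finally have "\<bar>fdiff k ?F x\<bar> \<le> ?K4 * W"
      by (simp add: mult_left_mono mult.assoc sum_nonneg)
    then show ?thesis by blast
  qed
  moreover have "?K1 * W \<ge> 0" "?K2 * W \<ge> 0" "?K3 * W \<ge> 0" "?K4 * W \<ge> 0"
    using K0 W0 less_imp_le mult_nonneg_nonneg by blast+
  ultimately show "\<bar>fdiff k ?F x\<bar> \<le> (?K1 + ?K2 + ?K3 + ?K4) * W"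
    unfolding distrib_right by linarith
qed

lemma cutoff_minus: "cutoff H R (- y) = cutoff H R y"
  by (simp add: cutoff_def)

lemma cutoff_fdiff:
  fixes H :: "real \<Rightarrow> real" and c p :: "nat \<Rightarrow> real"
  assumes k: "k \<ge> 1" and th: "0 \<le> \<theta>" "\<theta> \<le> 1"
    and p: "\<And>r. r \<in> A \<Longrightarrow> p r \<ge> real k - \<theta> \<and> p r > 0"
    and H: "\<And>u. 0 \<le> u \<Longrightarrow> u \<le> 1 \<Longrightarrow> H u = b + (\<Sum>r\<in>A. c r * u powr p r)"
    and HB: "\<And>u. 0 \<le> u \<Longrightarrow> u \<le> 1 \<Longrightarrow> \<bar>H u\<bar> \<le> B * (1 - u) ^ k"
  shows "\<exists>K\<ge>0. \<forall>R\<ge>1. \<forall>x.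
      \<bar>fdiff k (cutoff H R) x\<bar> \<le> K * (R powr (\<theta> - real k) * (1 + \<bar>x\<bar>) powr (- \<theta>))
      \<and> (\<bar>x\<bar> \<ge> R + real k \<longrightarrow> fdiff k (cutoff H R) x = 0)"
proof -
  define K where "K = 2 ^ k * B / (real (k + 1) powr (\<theta> - real k) * real (2 * k + 2) powr (- \<theta>))
      + 2 ^ k * B * real k ^ k * 3 powr \<theta>
      + (\<Sum>r\<in>A. \<bar>c r\<bar> * \<bar>\<Prod>i<k. p r - real i\<bar>) * real (k + 2) powr \<theta>
      + 2 ^ k * (\<Sum>r\<in>A. \<bar>c r\<bar>) * real (k + 1) powr (real k - \<theta>) * real (k + 2) powr \<theta>"
  have B0: "0 \<le> B" using HB[of 0] by simp
  have K0: "K \<ge> 0" unfolding K_def using B0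
    by (intro add_nonneg_nonneg mult_nonneg_nonneg divide_nonneg_nonneg sum_nonneg) auto
  have main: "\<bar>fdiff k (cutoff H R) x\<bar> \<le> K * (R powr (\<theta> - real k) * (1 + \<bar>x\<bar>) powr (- \<theta>))
      \<and> (\<bar>x\<bar> \<ge> R + real k \<longrightarrow> fdiff k (cutoff H R) x = 0)" if R: "R \<ge> 1" for R x
  proof (cases "x \<ge> 0")
    case True
    then show ?thesis
      using cutoff_fdiff_nonneg[OF k th p H HB R True] unfolding K_def by simp
  next
    case False
    then have x: "real k - x \<ge> 0" by simp
    have eq: "\<bar>fdiff k (cutoff H R) (real k - x)\<bar> = \<bar>fdiff k (cutoff H R) x\<bar>"
      using fdiff_even[of "cutoff H R" k x, OF cutoff_minus] by (simp add: abs_mult power_abs)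
    have "\<bar>fdiff k (cutoff H R) x\<bar> \<le> K * (R powr (\<theta> - real k) * (1 + (real k - x)) powr (- \<theta>))"
      using cutoff_fdiff_nonneg(1)[OF k th p H HB R x] unfolding K_def eq by simp
    also have "\<dots> \<le> K * (R powr (\<theta> - real k) * (1 + \<bar>x\<bar>) powr (- \<theta>))"
      using False th K0 by (intro mult_left_mono powr_mono2') auto
    finally have "\<bar>fdiff k (cutoff H R) x\<bar> \<le> K * (R powr (\<theta> - real k) * (1 + \<bar>x\<bar>) powr (- \<theta>))" .
    moreover have "fdiff k (cutoff H R) x = 0" if "\<bar>x\<bar> \<ge> R + real k"
      using cutoff_fdiff_nonneg(2)[OF k th p H HB R x] eq that False by simp
    ultimately show ?thesis by blast
  qed
  show ?thesis using K0 main by blast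
qed

lemma sum_int_abs_le:
  fixes g :: "nat \<Rightarrow> real"
  assumes "finite Z" "\<And>z. z \<in> Z \<Longrightarrow> nat \<bar>z\<bar> \<le> m" "\<And>n. g n \<ge> 0"
  shows "(\<Sum>z\<in>Z. g (nat \<bar>z\<bar>)) \<le> 2 * (\<Sum>n\<le>m. g n)"
proof -
  have "(\<Sum>z\<in>Z. g (nat \<bar>z\<bar>)) = (\<Sum>n\<le>m. \<Sum>z | z \<in> Z \<and> nat \<bar>z\<bar> = n. g (nat \<bar>z\<bar>))"
    using assms(1,2) by (intro sum.group[symmetric]) auto
  also have "\<dots> \<le> (\<Sum>n\<le>m. 2 * g n)"
  proof (intro sum_mono)
    fix n
    let ?S = "{z. z \<in> Z \<and> nat \<bar>z\<bar> = n}"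
    have "card ?S \<le> card {int n, - int n}" by (intro card_mono) auto
    also have "\<dots> \<le> 2" by (simp add: card_insert_if)
    finally have "real (card ?S) * g n \<le> 2 * g n" using assms(3) by (intro mult_right_mono) auto
    moreover have "(\<Sum>z\<in>?S. g (nat \<bar>z\<bar>)) = (\<Sum>z\<in>?S. g n)" by (intro sum.cong) auto
    ultimately show "(\<Sum>z\<in>?S. g (nat \<bar>z\<bar>)) \<le> 2 * g n" by simp
  qed
  finally show ?thesis by (simp add: sum_distrib_left)
qed

text \<open>Source of the logarithm: the sum on the right is of order \<open>R\<close> for
  \<open>\<theta> = 0\<close>, but a harmonic sum, of order \<open>1 + ln R\<close>, for
  \<open>\<theta> = 1 / 2\<close>.\<close>

lemma fdiff_sq_sum:
  fixes F :: "real \<Rightarrow> real"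
  assumes K: "K \<ge> 0" and R: "R \<ge> 1" and k: "k \<ge> 1" and "finite Z"
    and bd: "\<And>x. \<bar>fdiff k F x\<bar> \<le> K * (R powr (\<theta> - real k) * (1 + \<bar>x\<bar>) powr (- \<theta>))"
    and zero: "\<And>x. \<bar>x\<bar> \<ge> R + real k \<Longrightarrow> fdiff k F x = 0"
  shows "(\<Sum>z\<in>Z. (fdiff k F (of_int z))\<^sup>2)
     \<le> 2 * K\<^sup>2 * R powr (2 * \<theta> - 2 * real k) * (\<Sum>n\<le>nat \<lfloor>R + real k\<rfloor>. (1 + real n) powr (- 2 * \<theta>))"
proof -
  define m where "m = nat \<lfloor>R + real k\<rfloor>"
  define Z' where "Z' = {z \<in> Z. \<bar>of_int z\<bar> < R + real k}"
  have sq: "(fdiff k F (of_int z))\<^sup>2 \<le> K\<^sup>2 * R powr (2 * \<theta> - 2 * real k) * (1 + real (nat \<bar>z\<bar>)) powr (- 2 * \<theta>)" for z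
  proof -
    have "(fdiff k F (of_int z))\<^sup>2 = \<bar>fdiff k F (of_int z)\<bar>\<^sup>2" by simp
    also have "\<dots> \<le> (K * (R powr (\<theta> - real k) * (1 + \<bar>of_int z\<bar>) powr (- \<theta>)))\<^sup>2"
      by (intro power_mono bd) auto
    also have "\<dots> = K\<^sup>2 * (R powr (\<theta> - real k))\<^sup>2 * ((1 + \<bar>of_int z\<bar>) powr (- \<theta>))\<^sup>2"
      by (simp add: power_mult_distrib)
    also have "(R powr (\<theta> - real k))\<^sup>2 = R powr (2 * \<theta> - 2 * real k)"
      using R by (simp add: power2_eq_square powr_add[symmetric])
    also have "((1 + \<bar>of_int z\<bar>) powr (- \<theta>))\<^sup>2 = (1 + real (nat \<bar>z\<bar>)) powr (- 2 * \<theta>)"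
      by (simp add: power2_eq_square powr_add[symmetric])
    finally show ?thesis .
  qed
  have "(\<Sum>z\<in>Z. (fdiff k F (of_int z))\<^sup>2) = (\<Sum>z\<in>Z'. (fdiff k F (of_int z))\<^sup>2)"
    using assms(4) zero by (intro sum.mono_neutral_right) (auto simp: Z'_def not_less)
  also have "\<dots> \<le> (\<Sum>z\<in>Z'. K\<^sup>2 * R powr (2 * \<theta> - 2 * real k) * (1 + real (nat \<bar>z\<bar>)) powr (- 2 * \<theta>))"
    by (intro sum_mono sq)
  also have "\<dots> \<le> 2 * (\<Sum>n\<le>m. K\<^sup>2 * R powr (2 * \<theta> - 2 * real k) * (1 + real n) powr (- 2 * \<theta>))"
  proof (rule sum_int_abs_le)
    fix z assume "z \<in> Z'"
    then have "of_int \<bar>z\<bar> \<le> R + real k" by (simp add: Z'_def)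
    then have "\<bar>z\<bar> \<le> \<lfloor>R + real k\<rfloor>" by (simp only: le_floor_iff)
    then show "nat \<bar>z\<bar> \<le> m" by (simp add: m_def)
  qed (use assms(4) in \<open>auto simp: Z'_def\<close>)
  finally show ?thesis by (simp add: m_def sum_distrib_left mult_ac)
qed

section \<open>The smooth and the cuspidal profile of a bump\<close>

lemma one_minus_power_bounds:
  assumes "0 \<le> u" "u \<le> (1::real)"
  shows "0 \<le> 1 - u ^ k" "1 - u ^ k \<le> 1" "1 - u ^ k \<le> real k * (1 - u)"
  using assms power_le_one[of u k] Bernoulli_inequality[of "u - 1" k] by (auto simp: algebra_simps)

lemma one_minus_power_expand:
  "(1 - u ^ k) ^ k = (\<Sum>r\<le>k. (-1) ^ r * real (k choose r) * u ^ (k * r))" for u :: real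
proof -
  have "(1 - u ^ k) ^ k = (- (u ^ k) + 1) ^ k" by simp
  also have "\<dots> = (\<Sum>r\<le>k. real (k choose r) * (- (u ^ k)) ^ r * 1 ^ (k - r))"
    by (rule binomial_ring)
  also have "\<dots> = (\<Sum>r\<le>k. (-1) ^ r * real (k choose r) * u ^ (k * r))"
    by (intro sum.cong refl) (simp add: power_minus[of "u ^ k"] power_mult)
  finally show ?thesis .
qed

text \<open>A polynomial in \<open>u ^ k\<close>: besides the constant 1 only exponents at least k
  occur, so the even extension has differences of the smooth order at 0, and there is a zero of
  order k at 1.\<close>

definition plateau :: "nat \<Rightarrow> real \<Rightarrow> real" where
  "plateau k u = (1 - u ^ k) ^ k"

text \<open>The factor \<open>plateau k u\<close> supplies the zero of order k at 1; being common to
  both profiles, it can be factored out of a bump.\<close>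

definition cusp :: "nat \<Rightarrow> real \<Rightarrow> real" where
  "cusp k u = u powr (real k - 1 / 2) * plateau k u"

lemma plateau_bounds:
  assumes "0 \<le> u" "u \<le> (1::real)"
  shows "0 \<le> plateau k u" "plateau k u \<le> 1" "plateau k u \<le> real k ^ k * (1 - u) ^ k"
  unfolding plateau_def power_mult_distrib[symmetric]
  using one_minus_power_bounds[OF assms, of k] by (auto intro: power_mono power_le_one zero_le_power)

lemma plateau_sq_sum:
  assumes k: "k \<ge> 1"
  shows "\<exists>K\<ge>0. \<forall>R\<ge>1. \<forall>Z. finite Z \<longrightarrow>
     (\<Sum>z\<in>Z. (fdiff k (cutoff (plateau k) R) (of_int z))\<^sup>2) \<le> K * R powr (1 - 2 * real k)"
proof -
  have "\<exists>K\<ge>0. \<forall>R\<ge>1. \<forall>x.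
      \<bar>fdiff k (cutoff (plateau k) R) x\<bar> \<le> K * (R powr (0 - real k) * (1 + \<bar>x\<bar>) powr (- 0))
      \<and> (\<bar>x\<bar> \<ge> R + real k \<longrightarrow> fdiff k (cutoff (plateau k) R) x = 0)"
  proof (rule cutoff_fdiff[where A = "{1..k}" and p = "\<lambda>r. real (k * r)" and b = 1
        and c = "\<lambda>r. (-1) ^ r * real (k choose r)" and B = "real k ^ k"])
    fix u :: real assume u: "0 \<le> u" "u \<le> 1"
    have "plateau k u = (\<Sum>r\<in>insert 0 {1..k}. (-1) ^ r * real (k choose r) * u ^ (k * r))"
      unfolding plateau_def one_minus_power_expand by (intro sum.cong) auto
    also have "\<dots> = 1 + (\<Sum>r=1..k. (-1) ^ r * real (k choose r) * u ^ (k * r))" by simp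
    also have "(\<Sum>r=1..k. (-1) ^ r * real (k choose r) * u ^ (k * r))
       = (\<Sum>r=1..k. (-1) ^ r * real (k choose r) * u powr real (k * r))"
      using u k by (intro sum.cong refl) (auto simp: powr_realpow' simp del: of_nat_mult)
    finally show "plateau k u = 1 + (\<Sum>r=1..k. (-1) ^ r * real (k choose r) * u powr real (k * r))" .
    show "\<bar>plateau k u\<bar> \<le> real k ^ k * (1 - u) ^ k" using plateau_bounds[OF u, of k] by simp
  next
    fix r assume "r \<in> {1..k}"
    then have "k * 1 \<le> k * r" "0 < k * r" using k by (auto intro: mult_le_mono2)
    then show "real k - 0 \<le> real (k * r) \<and> 0 < real (k * r)" by (simp del: of_nat_mult)
  qed (use k in auto)
  then obtain K where K: "K \<ge> 0" "\<And>R x. R \<ge> 1 \<Longrightarrow>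
      \<bar>fdiff k (cutoff (plateau k) R) x\<bar> \<le> K * (R powr (0 - real k) * (1 + \<bar>x\<bar>) powr (- 0))"
      "\<And>R x. R \<ge> 1 \<Longrightarrow> \<bar>x\<bar> \<ge> R + real k \<Longrightarrow> fdiff k (cutoff (plateau k) R) x = 0" by blast
  have "(\<Sum>z\<in>Z. (fdiff k (cutoff (plateau k) R) (of_int z))\<^sup>2) \<le> (2 * K\<^sup>2 * real (k + 2)) * R powr (1 - 2 * real k)"
    if R: "R \<ge> 1" and Z: "finite Z" for R Z
  proof -
    have "(\<Sum>z\<in>Z. (fdiff k (cutoff (plateau k) R) (of_int z))\<^sup>2)
       \<le> 2 * K\<^sup>2 * R powr (2 * 0 - 2 * real k) * (\<Sum>n\<le>nat \<lfloor>R + real k\<rfloor>. (1 + real n) powr (- 2 * 0))"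
      by (rule fdiff_sq_sum[OF K(1) R k Z K(2)[OF R] K(3)[OF R]])
    also have "(\<Sum>n\<le>nat \<lfloor>R + real k\<rfloor>. (1 + real n) powr (- 2 * 0)) = real (nat \<lfloor>R + real k\<rfloor>) + 1" by simp
    also have "\<dots> \<le> real (k + 2) * R"
    proof -
      have "real (nat \<lfloor>R + real k\<rfloor>) \<le> R + real k" using R by simp
      moreover have "real (k + 1) * 1 \<le> real (k + 1) * R" using R by (intro mult_left_mono) auto
      ultimately show ?thesis by (simp add: algebra_simps)
    qed
    also have "2 * K\<^sup>2 * R powr (2 * 0 - 2 * real k) * (real (k + 2) * R) = (2 * K\<^sup>2 * real (k + 2)) * R powr (1 - 2 * real k)"
      using R by (simp add: powr_diff powr_minus divide_simps)
    finally show ?thesis by (simp add: mult_left_mono)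
  qed
  then show ?thesis by (intro exI[of _ "2 * K\<^sup>2 * real (k + 2)"]) auto
qed

lemma cusp_sq_sum:
  assumes k: "k \<ge> 1"
  shows "\<exists>K\<ge>0. \<forall>R\<ge>1. \<forall>Z. finite Z \<longrightarrow>
     (\<Sum>z\<in>Z. (fdiff k (cutoff (cusp k) R) (of_int z))\<^sup>2) \<le> K * (R powr (1 - 2 * real k) * (1 + ln R))"
proof -
  have "\<exists>K\<ge>0. \<forall>R\<ge>1. \<forall>x.
      \<bar>fdiff k (cutoff (cusp k) R) x\<bar> \<le> K * (R powr (1 / 2 - real k) * (1 + \<bar>x\<bar>) powr (- (1 / 2)))
      \<and> (\<bar>x\<bar> \<ge> R + real k \<longrightarrow> fdiff k (cutoff (cusp k) R) x = 0)"
  proof (rule cutoff_fdiff[where A = "{..k}" and p = "\<lambda>r. real k - 1 / 2 + real (k * r)" and b = 0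
        and c = "\<lambda>r. (-1) ^ r * real (k choose r)" and B = "real k ^ k"])
    fix u :: real assume u: "0 \<le> u" "u \<le> 1"
    have "cusp k u = (\<Sum>r\<le>k. (-1) ^ r * real (k choose r) * (u powr (real k - 1 / 2) * u ^ (k * r)))"
      unfolding cusp_def plateau_def one_minus_power_expand sum_distrib_left by (intro sum.cong) auto
    also have "\<dots> = (\<Sum>r\<le>k. (-1) ^ r * real (k choose r) * u powr (real k - 1 / 2 + real (k * r)))"
      using u k by (intro sum.cong refl) (cases "u = 0"; simp add: powr_add powr_realpow del: of_nat_mult)
    finally show "cusp k u = 0 + (\<Sum>r\<le>k. (-1) ^ r * real (k choose r) * u powr (real k - 1 / 2 + real (k * r)))"
      by simp
    have "u powr (real k - 1 / 2) \<le> 1" using u k by (intro powr_le1) auto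
    then have "\<bar>cusp k u\<bar> \<le> 1 * plateau k u"
      unfolding cusp_def using plateau_bounds[OF u, of k]
        mult_right_mono[of "u powr (real k - 1 / 2)" 1 "plateau k u"] by (simp add: abs_mult)
    also have "\<dots> \<le> real k ^ k * (1 - u) ^ k" using plateau_bounds[OF u, of k] by simp
    finally show "\<bar>cusp k u\<bar> \<le> real k ^ k * (1 - u) ^ k" .
  next
    fix r assume "r \<in> {..k}"
    have "real k \<ge> 1" "real (k * r) \<ge> 0" using k by simp_all
    then show "real k - 1 / 2 \<le> real k - 1 / 2 + real (k * r) \<and> 0 < real k - 1 / 2 + real (k * r)"
      by linarith
  qed (use k in auto)
  then obtain K where K: "K \<ge> 0" "\<And>R x. R \<ge> 1 \<Longrightarrow>
      \<bar>fdiff k (cutoff (cusp k) R) x\<bar> \<le> K * (R powr (1 / 2 - real k) * (1 + \<bar>x\<bar>) powr (- (1 / 2)))"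
      "\<And>R x. R \<ge> 1 \<Longrightarrow> \<bar>x\<bar> \<ge> R + real k \<Longrightarrow> fdiff k (cutoff (cusp k) R) x = 0" by blast
  have "(\<Sum>z\<in>Z. (fdiff k (cutoff (cusp k) R) (of_int z))\<^sup>2)
      \<le> (2 * K\<^sup>2 * (1 + ln (real (k + 2)))) * (R powr (1 - 2 * real k) * (1 + ln R))"
    if R: "R \<ge> 1" and Z: "finite Z" for R Z
  proof -
    define m where "m = nat \<lfloor>R + real k\<rfloor>"
    have "(\<Sum>z\<in>Z. (fdiff k (cutoff (cusp k) R) (of_int z))\<^sup>2)
       \<le> 2 * K\<^sup>2 * R powr (2 * (1 / 2) - 2 * real k) * (\<Sum>n\<le>m. (1 + real n) powr (- 2 * (1 / 2)))"
      unfolding m_def by (rule fdiff_sq_sum[OF K(1) R k Z K(2)[OF R] K(3)[OF R]])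
    also have "(\<Sum>n\<le>m. (1 + real n) powr (- 2 * (1 / 2))) = harm (Suc m)"
      unfolding harm_def by (intro sum.reindex_bij_witness[of _ "\<lambda>n. n - 1" Suc])
        (auto simp: powr_minus add.commute)
    also have "harm (Suc m) \<le> 1 + ln (real (Suc m))"
      using decseq_harm_diff_ln[THEN decseqD, of 0 m] by (simp add: harm_expand add.commute)
    also have "ln (real (Suc m)) \<le> ln (real (k + 2) * R)"
    proof -
      have "real m \<le> R + real k" using R by (simp add: m_def)
      moreover have "real (k + 1) * 1 \<le> real (k + 1) * R" using R by (intro mult_left_mono) auto
      ultimately have "real (Suc m) \<le> real (k + 2) * R" by (simp add: algebra_simps)
      then show ?thesis using R by (subst ln_le_cancel_iff) auto
    qed
    also have "1 + ln (real (k + 2) * R) \<le> (1 + ln (real (k + 2))) * (1 + ln R)"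
    proof -
      have "ln (real (k + 2) * R) = ln (real (k + 2)) + ln R" using R by (subst ln_mult) auto
      moreover have "0 \<le> ln (real (k + 2)) * ln R" using R by (intro mult_nonneg_nonneg ln_ge_zero) auto
      ultimately show ?thesis by (simp only: distrib_left distrib_right)
    qed
    also have "2 * K\<^sup>2 * R powr (2 * (1 / 2) - 2 * real k) * ((1 + ln (real (k + 2))) * (1 + ln R))
      = (2 * K\<^sup>2 * (1 + ln (real (k + 2)))) * (R powr (1 - 2 * real k) * (1 + ln R))" by simp
    finally show ?thesis by (simp add: mult_left_mono)
  qed
  then show ?thesis by (intro exI[of _ "2 * K\<^sup>2 * (1 + ln (real (k + 2)))"]) auto
qed

section \<open>Approximating the dictionary by truncated polynomials\<close>

text \<open>Monomials in \<open>x\<close> and not in \<open>x - t\<close>: for \<open>r < k\<close>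
  their combinations are all polynomials of degree below k, cut off below \<open>t\<close>.\<close>

definition tpow :: "nat \<Rightarrow> nat \<Rightarrow> nat \<Rightarrow> real" where
  "tpow t r x = (if x \<ge> t then real x ^ r else 0)"

lemma pochhammer_power_expand:
  "\<exists>\<alpha>. \<forall>x::real. pochhammer (x + c) n = (\<Sum>r\<le>n. \<alpha> r * x ^ r)"
proof -
  have "\<exists>p. degree p \<le> n \<and> (\<forall>x. poly p x = pochhammer (x + c) n)"
  proof (induction n)
    case 0
    then show ?case by (intro exI[of _ 1]) simp
  next
    case (Suc n)
    then obtain p where p: "degree p \<le> n" "\<forall>x. poly p x = pochhammer (x + c) n" by blast
    have "degree (p * [:c + real n, 1:]) \<le> Suc n"
      using p(1) degree_mult_le[of p "[:c + real n, 1:]"] by simp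
    then show ?case using p(2)
      by (intro exI[of _ "p * [:c + real n, 1:]"]) (auto simp: pochhammer_Suc algebra_simps)
  qed
  then obtain p where p: "degree p \<le> n" "\<forall>x. poly p x = pochhammer (x + c) n" by blast
  have "poly p x = (\<Sum>r\<le>n. coeff p r * x ^ r)" for x
    unfolding poly_altdef using p(1) by (intro sum.mono_neutral_left) (auto simp: coeff_eq_0)
  then show ?thesis using p(2) by metis
qed

lemma abs_pochhammer_le:
  assumes "\<bar>z\<bar> \<le> D"
  shows "\<bar>pochhammer (z + 1 :: real) (k - 1)\<bar> \<le> (D + real k) ^ (k - 1)"
proof -
  have "\<bar>pochhammer (z + 1) (k - 1)\<bar> = (\<Prod>i<k - 1. \<bar>z + 1 + real i\<bar>)"
    by (simp add: pochhammer_prod abs_prod atLeast0LessThan)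
  also have "\<dots> \<le> (\<Prod>i<k - 1. D + real k)"
    using assms by (intro prod_mono) auto
  finally show ?thesis by simp
qed

lemma dict_nonneg_le_one:
  assumes "j \<in> {k + 1..N}" "x \<in> {1..N}"
  shows "0 \<le> dict k N j x" "dict k N j x \<le> 1"
proof -
  have *: "0 \<le> dict k N j x \<and> dict k N j x \<le> 1"
  proof (cases "j \<le> x")
    case True
    let ?z = "real x - real j"
    have "0 \<le> pochhammer (?z + 1) (k - 1)" using True by (intro pochhammer_nonneg) auto
    moreover have "pochhammer (?z + 1) (k - 1) \<le> real N ^ (k - 1)"
    proof -
      have "pochhammer (?z + 1) (k - 1) = (\<Prod>i<k - 1. ?z + 1 + real i)"
        by (simp add: pochhammer_prod atLeast0LessThan)
      also have "\<dots> \<le> (\<Prod>i<k - 1. real N)"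
        using True assms by (intro prod_mono) auto
      finally show ?thesis by simp
    qed
    ultimately have "0 \<le> pochhammer (?z + 1) (k - 1) / fact (k - 1)"
      "pochhammer (?z + 1) (k - 1) / fact (k - 1) \<le> real N ^ (k - 1) / 1"
      by (simp, intro frac_le) auto
    moreover have "dict k N j x = pochhammer (?z + 1) (k - 1) / fact (k - 1) / real N ^ (k - 1)"
      using True by (simp add: dict_def kspline_def)
    moreover have "real N ^ (k - 1) > 0" using assms by simp
    moreover have "0 \<le> a / b \<and> a / b \<le> 1" if "0 \<le> a" "a \<le> b / 1" "b > 0" for a b :: real
      using that by simp
    ultimately show ?thesis by metis
  next
    case False
    then show ?thesis by (simp add: dict_def kspline_def)
  qed
  then show "0 \<le> dict k N j x" "dict k N j x \<le> 1" by auto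
qed

text \<open>Each atom agrees beyond \<open>max j t\<close> with a polynomial of degree \<open>< k\<close>, hence there with its truncation at \<open>t\<close>.\<close>

lemma dict_approx:
  assumes k: "k \<ge> 1" and N: "N \<ge> 1"
  defines "D j t \<equiv> \<bar>real j - real t\<bar>"
  shows "\<exists>\<alpha>. \<forall>x. (x < min j t \<or> max j t \<le> x \<longrightarrow> dict k N j x = (\<Sum>r<k. \<alpha> r * tpow t r x)) \<and>
     \<bar>dict k N j x - (\<Sum>r<k. \<alpha> r * tpow t r x)\<bar> \<le> (real (k + 1) * D j t / real N) ^ (k - 1)"
proof -
  have kk: "{..k - 1} = {..<k}" using k by auto
  obtain \<beta> where \<beta>: "\<And>x::real. pochhammer (x + (1 - real j)) (k - 1) = (\<Sum>r<k. \<beta> r * x ^ r)"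
    using pochhammer_power_expand[of "1 - real j" "k - 1"] unfolding kk by blast
  define c where "c = 1 / (fact (k - 1) * real N ^ (k - 1))"
  define q where "q x = c * pochhammer (real x - real j + 1) (k - 1)" for x
  have lin: "(\<Sum>r<k. (c * \<beta> r) * tpow t r x) = (if x \<ge> t then q x else 0)" for x
    using \<beta>[of "real x"] by (auto simp: q_def tpow_def sum_distrib_left mult_ac algebra_simps)
  have dict: "dict k N j x = (if x \<ge> j then q x else 0)" for x
    by (simp add: dict_def kspline_def q_def c_def)
  have qb: "\<bar>q x\<bar> \<le> (real (k + 1) * D j t / real N) ^ (k - 1)"
    if "min j t \<le> x" "x < max j t" for x
  proof -
    \<comment> \<open>The interval between \<open>j\<close> and \<open>t\<close> contains
      \<open>x\<close>, so \<open>D j t\<close> is at least 1. This is what lets the additive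
      \<open>real k\<close> from the Pochhammer factors be absorbed into a multiple of
      \<open>D j t\<close>.\<close>
    have D1: "D j t \<ge> 1" "\<bar>real x - real j\<bar> \<le> D j t" using that by (auto simp: D_def)
    have "\<bar>q x\<bar> = \<bar>pochhammer (real x - real j + 1) (k - 1)\<bar> / (fact (k - 1) * real N ^ (k - 1))"
      using N by (simp add: q_def c_def abs_mult)
    also have "\<dots> \<le> (D j t + real k) ^ (k - 1) / (1 * real N ^ (k - 1))"
      using abs_pochhammer_le[OF D1(2), of k] N D1 by (intro frac_le mult_right_mono) auto
    also have "\<dots> \<le> (real (k + 1) * D j t) ^ (k - 1) / (1 * real N ^ (k - 1))"
    proof (intro divide_right_mono power_mono)
      have "real k * 1 \<le> real k * D j t" using D1 by (intro mult_left_mono) auto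
      then show "D j t + real k \<le> real (k + 1) * D j t" by (simp add: algebra_simps)
    qed (use D1 in auto)
    finally show ?thesis by (simp add: power_divide)
  qed
  have B0: "0 \<le> (real (k + 1) * D j t / real N) ^ (k - 1)" by (simp add: D_def)
  show ?thesis
  proof (intro exI[of _ "\<lambda>r. c * \<beta> r"] allI conjI impI)
    fix x assume "x < min j t \<or> max j t \<le> x"
    then show "dict k N j x = (\<Sum>r<k. (c * \<beta> r) * tpow t r x)" unfolding lin dict by auto
  next
    fix x show "\<bar>dict k N j x - (\<Sum>r<k. (c * \<beta> r) * tpow t r x)\<bar> \<le> (real (k + 1) * D j t / real N) ^ (k - 1)"
      unfolding lin dict using qb[of x] B0 by (auto simp: min_def max_def split: if_splits)
  qed
qed

lemma abs_prod_diff_le: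
  fixes a b :: "'a \<Rightarrow> real"
  assumes "finite I" "B \<ge> 1" "\<And>i. i \<in> I \<Longrightarrow> \<bar>a i\<bar> \<le> B" "\<And>i. i \<in> I \<Longrightarrow> \<bar>b i\<bar> \<le> B"
  shows "\<bar>(\<Prod>i\<in>I. a i) - (\<Prod>i\<in>I. b i)\<bar> \<le> B ^ card I * (\<Sum>i\<in>I. \<bar>a i - b i\<bar>)"
  using assms
proof (induction I)
  case empty
  then show ?case by simp
next
  case (insert i I)
  let ?A = "\<Prod>i\<in>I. a i" and ?P = "\<Prod>i\<in>I. b i" and ?S = "\<Sum>i\<in>I. \<bar>a i - b i\<bar>"
  have A: "\<bar>?A\<bar> \<le> B ^ card I"
    unfolding abs_prod using insert.prems prod_mono[of I "\<lambda>i. \<bar>a i\<bar>" "\<lambda>_. B"] by auto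
  have IH: "\<bar>?A - ?P\<bar> \<le> B ^ card I * ?S" using insert by simp
  have "a i * ?A - b i * ?P = (a i - b i) * ?A + b i * (?A - ?P)" by (simp add: algebra_simps)
  then have "\<bar>a i * ?A - b i * ?P\<bar> \<le> \<bar>a i - b i\<bar> * \<bar>?A\<bar> + \<bar>b i\<bar> * \<bar>?A - ?P\<bar>"
    by (metis abs_mult abs_triangle_ineq)
  also have "\<dots> \<le> \<bar>a i - b i\<bar> * B ^ card I + B * (B ^ card I * ?S)"
    using A IH insert.prems by (intro add_mono mult_mono) auto
  also have "\<dots> \<le> \<bar>a i - b i\<bar> * (B * B ^ card I) + B * (B ^ card I * ?S)"
    using insert.prems(1) mult_right_mono[of 1 B "B ^ card I"] by (intro add_mono mult_left_mono) auto
  also have "\<dots> = B ^ card (insert i I) * (\<Sum>i\<in>insert i I. \<bar>a i - b i\<bar>)"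
    using insert by (simp add: algebra_simps)
  finally show ?case using insert by simp
qed

lemma square_sum_le:
  fixes r :: "'a \<Rightarrow> real"
  shows "(\<Sum>i\<in>I. r i)\<^sup>2 \<le> real (card I) * (\<Sum>i\<in>I. (r i)\<^sup>2)"
  using Cauchy_Schwarz_ineq_sum[of "\<lambda>_. 1" r I] by simp

lemma sum_PiE_coordinate:
  fixes g :: "'b \<Rightarrow> real"
  assumes "finite I" "i \<in> I" "\<And>i. i \<in> I \<Longrightarrow> finite (T i)"
  shows "(\<Sum>x\<in>PiE I T. g (x i)) = (\<Sum>y\<in>T i. g y) * (\<Prod>i'\<in>I - {i}. real (card (T i')))"
proof -
  have "(\<Sum>x\<in>PiE I T. g (x i)) = (\<Sum>x\<in>PiE I T. \<Prod>i'\<in>I. if i' = i then g (x i') else 1)"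
    using assms by (intro sum.cong refl) (simp add: prod.delta)
  also have "\<dots> = (\<Prod>i'\<in>I. \<Sum>y\<in>T i'. if i' = i then g y else 1)"
    by (subst prod_sum_PiE[OF assms(1,3)]) auto
  also have "\<dots> = (\<Sum>y\<in>T i. g y) * (\<Prod>i'\<in>I - {i}. real (card (T i')))"
    using assms by (subst prod.remove[of I i]) (auto intro!: prod.cong)
  finally show ?thesis .
qed

text \<open>With factors bounded by \<open>B\<close>, telescoping reduces the error of the product
  to the sum of the coordinate errors. A coordinate error lives on \<bar>j i - t i\<bar> indices and
  has size of order (\<bar>j i - t i\<bar> / N)^(k - 1), so that its sum of squares gains one
  further power of the distance; the other coordinates contribute
  \<open>N ^ (d - 1)\<close>.\<close>

lemma dict_approx_tensor:
  assumes k: "k \<ge> 1" and N: "N \<ge> 1" and d: "d \<ge> 1"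
    and j: "j \<in> diff_cube d N k" and t: "\<And>i. i \<in> {1..d} \<Longrightarrow> t i \<le> N"
  defines "c \<equiv> real (k + 1) ^ (2 * (k - 1))" and "B \<equiv> 1 + real (k + 1) ^ (k - 1)"
  shows "\<exists>\<alpha>. let u = (\<lambda>x. \<Sum>\<rho>\<in>PiE {1..d} (\<lambda>_. {..<k}). \<alpha> \<rho> * (\<Prod>i=1..d. tpow (t i) (\<rho> i) (x i)));
      r = (\<lambda>x. (\<Prod>i=1..d. dict k N (j i) (x i)) - u x) in
     ip (cube d N) r r \<le> B ^ (2 * d) * real d * c * real N ^ d *
        (\<Sum>i=1..d. (\<bar>real (j i) - real (t i)\<bar> / real N) ^ (2 * k - 1))"
proof -
  let ?D = "\<lambda>i. \<bar>real (j i) - real (t i)\<bar>"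
  let ?I = "cube d N"
  have "\<forall>i. \<exists>\<alpha>. \<forall>x. (x < min (j i) (t i) \<or> max (j i) (t i) \<le> x \<longrightarrow> dict k N (j i) x = (\<Sum>r<k. \<alpha> r * tpow (t i) r x)) \<and>
     \<bar>dict k N (j i) x - (\<Sum>r<k. \<alpha> r * tpow (t i) r x)\<bar> \<le> (real (k + 1) * ?D i / real N) ^ (k - 1)"
    by (intro allI dict_approx[OF k N])
  from choice[OF this] obtain \<alpha> where \<alpha>0: "\<forall>i. \<forall>x. (x < min (j i) (t i) \<or> max (j i) (t i) \<le> x \<longrightarrow>
        dict k N (j i) x = (\<Sum>r<k. \<alpha> i r * tpow (t i) r x)) \<and>
     \<bar>dict k N (j i) x - (\<Sum>r<k. \<alpha> i r * tpow (t i) r x)\<bar> \<le> (real (k + 1) * ?D i / real N) ^ (k - 1)" ..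
  have \<alpha>: "x < min (j i) (t i) \<or> max (j i) (t i) \<le> x \<Longrightarrow>
        dict k N (j i) x = (\<Sum>r<k. \<alpha> i r * tpow (t i) r x)"
     "\<bar>dict k N (j i) x - (\<Sum>r<k. \<alpha> i r * tpow (t i) r x)\<bar> \<le> (real (k + 1) * ?D i / real N) ^ (k - 1)" for i x
    using \<alpha>0 by blast+
  define v where "v i x = (\<Sum>r<k. \<alpha> i r * tpow (t i) r x)" for i x
  define e where "e i x = dict k N (j i) x - v i x" for i x
  have ji: "j i \<in> {k + 1..N}" if "i \<in> {1..d}" for i using j that by (auto simp: idx_def PiE_iff)
  have DN: "?D i \<le> real N" if "i \<in> {1..d}" for i using ji[OF that] t[OF that] by auto
  have e_small: "\<bar>e i x\<bar> \<le> real (k + 1) ^ (k - 1)" if "i \<in> {1..d}" for i x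
  proof -
    have "?D i / real N \<le> 1" using DN[OF that] N by (simp add: divide_le_eq)
    then have "real (k + 1) * (?D i / real N) \<le> real (k + 1) * 1" by (intro mult_left_mono) auto
    then have "(real (k + 1) * ?D i / real N) ^ (k - 1) \<le> real (k + 1) ^ (k - 1)"
      by (intro power_mono) auto
    then show ?thesis using \<alpha>(2)[of i x] unfolding e_def v_def by linarith
  qed
  have e_sum: "(\<Sum>x=1..N. (e i x)\<^sup>2) \<le> c * real N * (?D i / real N) ^ (2 * k - 1)" for i
  proof -
    let ?J = "{min (j i) (t i)..<max (j i) (t i)}"
    have "(\<Sum>x=1..N. (e i x)\<^sup>2) \<le> (\<Sum>x\<in>?J \<union> {1..N}. (e i x)\<^sup>2)"
      by (intro sum_mono2) auto
    also have "\<dots> = (\<Sum>x\<in>?J. (e i x)\<^sup>2)"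
      using \<alpha>(1) by (intro sum.mono_neutral_right) (auto simp: e_def v_def not_less not_le)
    also have "\<dots> \<le> (\<Sum>x\<in>?J. ((real (k + 1) * ?D i / real N) ^ (k - 1))\<^sup>2)"
      using \<alpha>(2) by (intro sum_mono power2_le_iff_abs_le[THEN iffD2]) (auto simp: e_def v_def)
    also have "\<dots> = ?D i * ((real (k + 1) * ?D i / real N) ^ (k - 1))\<^sup>2"
    proof -
      have "real (card ?J) = ?D i" by (auto simp: min_def max_def)
      then show ?thesis by simp
    qed
    also have "((real (k + 1) * ?D i / real N) ^ (k - 1))\<^sup>2 = c * (?D i / real N) ^ (2 * (k - 1))"
      unfolding c_def by (simp add: power_mult_distrib[symmetric] power_mult[symmetric] mult.commute)
    also have "?D i * (c * (?D i / real N) ^ (2 * (k - 1))) = c * real N * (?D i / real N) ^ (2 * k - 1)"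
    proof -
      have "2 * k - 1 = Suc (2 * (k - 1))" using k by simp
      then show ?thesis using N by simp
    qed
    finally show ?thesis .
  qed
  define u where "u x = (\<Sum>\<rho>\<in>PiE {1..d} (\<lambda>_. {..<k}). (\<Prod>i=1..d. \<alpha> i (\<rho> i)) * (\<Prod>i=1..d. tpow (t i) (\<rho> i) (x i)))" for x
  have u: "u x = (\<Prod>i=1..d. v i (x i))" for x
    unfolding u_def v_def by (subst prod_sum_PiE) (auto simp: prod.distrib)
  define r where "r x = (\<Prod>i=1..d. dict k N (j i) (x i)) - u x" for x
  have B1: "B \<ge> 1" by (simp add: B_def)
  have r: "(r x)\<^sup>2 \<le> B ^ (2 * d) * real d * (\<Sum>i=1..d. (e i (x i))\<^sup>2)" if x: "x \<in> ?I" for x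
  proof -
    have xi: "x i \<in> {1..N}" if "i \<in> {1..d}" for i using x that by (auto simp: idx_def PiE_iff)
    have "\<bar>r x\<bar> \<le> B ^ card {1..d} * (\<Sum>i=1..d. \<bar>dict k N (j i) (x i) - v i (x i)\<bar>)"
      unfolding r_def u
    proof (rule abs_prod_diff_le[OF _ B1])
      fix i assume i: "i \<in> {1..d}"
      have "0 \<le> dict k N (j i) (x i)" "dict k N (j i) (x i) \<le> 1"
        using dict_nonneg_le_one[OF ji[OF i] xi[OF i]] .
      moreover have "0 \<le> real (k + 1) ^ (k - 1)" by simp
      ultimately show "\<bar>dict k N (j i) (x i)\<bar> \<le> B" "\<bar>v i (x i)\<bar> \<le> B"
        using e_small[OF i, of "x i"] unfolding B_def e_def by linarith+
    qed simp
    then have "\<bar>r x\<bar> \<le> B ^ d * (\<Sum>i=1..d. \<bar>e i (x i)\<bar>)" by (simp add: e_def)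
    then have "\<bar>r x\<bar>\<^sup>2 \<le> (B ^ d * (\<Sum>i=1..d. \<bar>e i (x i)\<bar>))\<^sup>2" by (intro power_mono) auto
    also have "\<dots> = B ^ (2 * d) * (\<Sum>i=1..d. \<bar>e i (x i)\<bar>)\<^sup>2"
      by (simp add: power_mult_distrib power_mult[symmetric] mult.commute)
    also have "\<dots> \<le> B ^ (2 * d) * (real d * (\<Sum>i=1..d. \<bar>e i (x i)\<bar>\<^sup>2))"
      using B1 square_sum_le[of "\<lambda>i. \<bar>e i (x i)\<bar>" "{1..d}"] by (intro mult_left_mono) auto
    finally show ?thesis by (simp add: mult.assoc)
  qed
  have "ip ?I r r = (\<Sum>x\<in>?I. (r x)\<^sup>2)" by (simp add: ip_def power2_eq_square)
  also have "\<dots> \<le> (\<Sum>x\<in>?I. B ^ (2 * d) * real d * (\<Sum>i=1..d. (e i (x i))\<^sup>2))"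
    by (intro sum_mono r)
  also have "\<dots> = B ^ (2 * d) * real d * (\<Sum>i=1..d. \<Sum>x\<in>?I. (e i (x i))\<^sup>2)"
    by (simp only: sum_distrib_left[symmetric] sum.swap[of _ "{1..d}" ?I])
  also have "(\<Sum>i=1..d. \<Sum>x\<in>?I. (e i (x i))\<^sup>2) = (\<Sum>i=1..d. (\<Sum>y=1..N. (e i y)\<^sup>2) * real N ^ (d - 1))"
  proof (intro sum.cong refl)
    fix i assume i: "i \<in> {1..d}"
    show "(\<Sum>x\<in>?I. (e i (x i))\<^sup>2) = (\<Sum>y=1..N. (e i y)\<^sup>2) * real N ^ (d - 1)"
      unfolding idx_def using i by (subst sum_PiE_coordinate) auto
  qed
  also have "\<dots> \<le> (\<Sum>i=1..d. (c * real N * (?D i / real N) ^ (2 * k - 1)) * real N ^ (d - 1))"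
    by (intro sum_mono mult_right_mono e_sum) auto
  also have "\<dots> = (\<Sum>i=1..d. c * (real N * real N ^ (d - 1)) * (?D i / real N) ^ (2 * k - 1))"
    by (intro sum.cong refl) (simp only: mult_ac)
  also have "\<dots> = c * real N ^ d * (\<Sum>i=1..d. (?D i / real N) ^ (2 * k - 1))"
    using d by (simp only: sum_distrib_left[symmetric] power_eq_if[of "real N" d]) simp
  finally have "ip ?I r r \<le> B ^ (2 * d) * real d * (c * real N ^ d * (\<Sum>i=1..d. (?D i / real N) ^ (2 * k - 1)))"
    using B1 by (simp add: mult_left_mono)
  then show ?thesis unfolding Let_def r_def u_def
    by (intro exI[of _ "\<lambda>\<rho>. \<Prod>i=1..d. \<alpha> i (\<rho> i)"]) (simp add: mult_ac)
qed

section \<open>The interpolating tensor\<close>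

lemma cutoff_eq_0: "H 1 = 0 \<Longrightarrow> \<bar>y\<bar> \<ge> R \<Longrightarrow> R > 0 \<Longrightarrow> cutoff H R y = 0"
  by (auto simp: cutoff_def dest: order_antisym)

lemma plateau_1 [simp]: "k \<ge> 1 \<Longrightarrow> plateau k 1 = 0"
  and cusp_1 [simp]: "k \<ge> 1 \<Longrightarrow> cusp k 1 = 0"
  and plateau_0 [simp]: "k \<ge> 1 \<Longrightarrow> plateau k 0 = 1"
  and cusp_0 [simp]: "cusp k 0 = 0"
  by (simp_all add: plateau_def cusp_def power_0_left)

definition profile :: "nat \<Rightarrow> real \<Rightarrow> nat \<Rightarrow> nat \<Rightarrow> real \<Rightarrow> real" where
  "profile k R e i = cutoff (if i = e then cusp k else plateau k) R"

text \<open>Only one factor of each term carries the cusp (and none for \<open>e = 0\<close>), so that the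
  bump costs a single logarithm.\<close>

definition bump :: "nat \<Rightarrow> nat \<Rightarrow> real \<Rightarrow> (nat \<Rightarrow> nat) \<Rightarrow> (nat \<Rightarrow> nat) \<Rightarrow> real" where
  "bump k d R t j = (\<Sum>e\<le>d. (if e = 0 then 1 else - 1 / real d) *
     (\<Prod>i=1..d. profile k R e i (real (j i) - real (t i))))"

lemma profile_eq_0: "k \<ge> 1 \<Longrightarrow> R > 0 \<Longrightarrow> \<bar>y\<bar> \<ge> R \<Longrightarrow> profile k R e i y = 0"
  unfolding profile_def by (rule cutoff_eq_0) auto

lemma profile_minus: "profile k R e i (- y) = profile k R e i y"
  by (simp add: profile_def cutoff_minus)

lemma bump_eq_0:
  assumes "k \<ge> 1" "R > 0" "i \<in> {1..d}" "\<bar>real (j i) - real (t i)\<bar> \<ge> R"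
  shows "bump k d R t j = 0"
proof -
  have "(\<Prod>i=1..d. profile k R e i (real (j i) - real (t i))) = 0" for e
    using assms(3) profile_eq_0[OF assms(1,2,4), of e i] by (intro prod_zero) auto
  then show ?thesis unfolding bump_def by (intro sum.neutral) simp
qed

text \<open>The definition as a sum of products suits the transpose of the difference matrix; this
  factored form exhibits the pointwise deficit.\<close>

lemma bump_eq:
  assumes "R > 0" "\<And>i. i \<in> {1..d} \<Longrightarrow> \<bar>real (j i) - real (t i)\<bar> \<le> R"
  defines "u i \<equiv> \<bar>real (j i) - real (t i)\<bar> / R"
  shows "bump k d R t j = (\<Prod>i=1..d. plateau k (u i)) *
     (1 - (\<Sum>i=1..d. u i powr (real k - 1 / 2)) / real d)"
proof -
  let ?P = "\<Prod>i=1..d. plateau k (u i)" and ?p = "real k - 1 / 2"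
  have pr: "profile k R e i (real (j i) - real (t i)) = (if i = e then u i powr ?p else 1) * plateau k (u i)"
    if "i \<in> {1..d}" for e i
    using assms(2)[OF that] by (simp add: profile_def cutoff_def u_def cusp_def)
  have *: "(\<Prod>i=1..d. profile k R e i (real (j i) - real (t i))) = (if e \<in> {1..d} then u e powr ?p else 1) * ?P" for e
  proof -
    have "(\<Prod>i=1..d. profile k R e i (real (j i) - real (t i)))
       = (\<Prod>i=1..d. (if i = e then u i powr ?p else 1) * plateau k (u i))"
      by (rule prod.cong) (simp_all only: pr)
    then show ?thesis by (simp add: prod.distrib prod.delta)
  qed
  have "{..d} = insert 0 {1..d}" by auto
  then have "bump k d R t j = ?P + (\<Sum>e=1..d. (- 1 / real d) * (u e powr ?p * ?P))"
    unfolding bump_def * by (simp add: sum.insert)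
  also have "\<dots> = ?P + (- 1 / real d) * ((\<Sum>e=1..d. u e powr ?p) * ?P)"
    by (simp only: sum_distrib_left[symmetric] sum_distrib_right[symmetric])
  also have "\<dots> = ?P * (1 - (\<Sum>i=1..d. u i powr ?p) / real d)"
    by (simp add: right_diff_distrib)
  finally show ?thesis .
qed

lemma bump_self: "k \<ge> 1 \<Longrightarrow> R > 0 \<Longrightarrow> (\<And>i. i \<in> {1..d} \<Longrightarrow> j i = t i) \<Longrightarrow> bump k d R t j = 1"
  by (subst bump_eq) auto

lemma abs_bump_le:
  assumes k: "k \<ge> 1" and d: "d \<ge> 1" and R: "R > 0"
    and near: "\<And>i. i \<in> {1..d} \<Longrightarrow> \<bar>real (j i) - real (t i)\<bar> \<le> R"
  shows "\<bar>bump k d R t j\<bar> \<le> 1 - (\<Sum>i=1..d. (\<bar>real (j i) - real (t i)\<bar> / R) powr (real k - 1 / 2)) / real d"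
proof -
  define u where "u i = \<bar>real (j i) - real (t i)\<bar> / R" for i
  let ?S = "\<Sum>i=1..d. u i powr (real k - 1 / 2)"
  have u: "0 \<le> u i" "u i \<le> 1" if "i \<in> {1..d}" for i using near[OF that] R by (auto simp: u_def)
  have "?S \<le> (\<Sum>i=1..d. 1)" using u k by (intro sum_mono powr_le1) auto
  then have S: "?S / real d \<le> 1" using d by (simp add: divide_le_eq)
  have P: "0 \<le> (\<Prod>i=1..d. plateau k (u i))" "(\<Prod>i=1..d. plateau k (u i)) \<le> 1"
    using plateau_bounds(1,2)[OF u, of _ k] by (auto intro!: prod_nonneg prod_le_1)
  have "bump k d R t j = (\<Prod>i=1..d. plateau k (u i)) * (1 - ?S / real d)"
    unfolding u_def by (rule bump_eq[OF R near])
  then have "\<bar>bump k d R t j\<bar> \<le> 1 * (1 - ?S / real d)"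
    using P S by (simp add: abs_mult mult_left_le_one_le)
  then show ?thesis by (simp add: u_def)
qed

text \<open>Summation by parts without boundary terms: rows outside \<open>{k + 1..N}\<close> are
  absent from the matrix, and \<open>F\<close> vanishes on them because their distance from
  \<open>t\<close> is at least \<open>R\<close>. Evenness turns the resulting forward difference
  into a backward one.\<close>

lemma sum_dcoef_transpose:
  assumes y: "y \<in> {1..N}" and F: "\<And>x. F (- x) = F x" "\<And>x. \<bar>x\<bar> \<ge> R \<Longrightarrow> F x = 0"
    and t: "real k + 1 + R \<le> real t + 1" "real t + R \<le> real N + 1"
  shows "(\<Sum>j\<in>{k + 1..N}. F (real j - real t) * dcoef k N j y)
    = real N ^ (k - 1) * fdiff k F (of_int (int t - int y))"
proof -
  have "(\<Sum>j\<in>{k + 1..N}. F (real j - real t) * dcoef k N j y)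
     = (\<Sum>j\<in>{y..y + k}. F (real j - real t) * dcoef k N j y)"
  proof (intro sum.mono_neutral_cong)
    fix j assume "j \<in> {y..y + k} - {k + 1..N}"
    then have "real j \<le> real k \<or> real j \<ge> real N + 1" by force
    then have "R \<le> \<bar>real j - real t\<bar>" using t by linarith
    then show "F (real j - real t) * dcoef k N j y = 0" using F(2) by simp
  qed (auto simp: dcoef_def)
  also have "\<dots> = (\<Sum>l\<le>k. F (real (y + l) - real t) * dcoef k N (y + l) y)"
    by (intro sum.reindex_bij_witness[of _ "\<lambda>l. y + l" "\<lambda>j. j - y"]) auto
  also have "\<dots> = real N ^ (k - 1) * fdiff k F (of_int (int t - int y))"
    unfolding fdiff_def sum_distrib_left
  proof (intro sum.cong refl)
    fix l assume "l \<in> {..k}"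
    moreover have "F (real (y + l) - real t) = F (of_int (int t - int y) - real l)"
      using F(1)[of "real (y + l) - real t"] by (simp add: algebra_simps)
    ultimately show "F (real (y + l) - real t) * dcoef k N (y + l) y
       = real N ^ (k - 1) * ((-1) ^ l * real (k choose l) * F (of_int (int t - int y) - real l))"
      by (simp add: dcoef_def)
  qed
  finally show ?thesis .
qed

lemma sum_square_disjoint:
  fixes g :: "'a \<Rightarrow> real"
  assumes "finite T" "\<And>t t'. t \<in> T \<Longrightarrow> t' \<in> T \<Longrightarrow> t \<noteq> t' \<Longrightarrow> g t = 0 \<or> g t' = 0"
  shows "(\<Sum>t\<in>T. g t)\<^sup>2 = (\<Sum>t\<in>T. (g t)\<^sup>2)"
proof -
  have "(\<Sum>t\<in>T. g t)\<^sup>2 = (\<Sum>t\<in>T. \<Sum>t'\<in>T. g t * g t')"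
    by (simp add: power2_eq_square sum_product)
  also have "\<dots> = (\<Sum>t\<in>T. \<Sum>t'\<in>T. if t' = t then (g t)\<^sup>2 else 0)"
    using assms(2) by (intro sum.cong refl) (auto simp: power2_eq_square)
  also have "\<dots> = (\<Sum>t\<in>T. (g t)\<^sup>2)" using assms(1) by simp
  finally show ?thesis .
qed

text \<open>One constant for both profiles, packaged so that it can be chosen once, before
  \<open>N\<close> and the grid.\<close>

definition sq_bound :: "nat \<Rightarrow> real \<Rightarrow> bool" where
  "sq_bound k K \<longleftrightarrow> K \<ge> 0 \<and> (\<forall>R\<ge>1. \<forall>Z. finite Z \<longrightarrow>
     (\<Sum>z\<in>Z. (fdiff k (cutoff (plateau k) R) (of_int z))\<^sup>2) \<le> K * R powr (1 - 2 * real k) \<and>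
     (\<Sum>z\<in>Z. (fdiff k (cutoff (cusp k) R) (of_int z))\<^sup>2) \<le> K * (R powr (1 - 2 * real k) * (1 + ln R)))"

lemma sq_bound_exists:
  assumes "k \<ge> 1"
  shows "\<exists>K. sq_bound k K"
proof -
  obtain K1 where K1: "K1 \<ge> 0" "\<And>R Z. R \<ge> 1 \<Longrightarrow> finite Z \<Longrightarrow>
     (\<Sum>z\<in>Z. (fdiff k (cutoff (plateau k) R) (of_int z))\<^sup>2) \<le> K1 * R powr (1 - 2 * real k)"
    using plateau_sq_sum[OF assms] by blast
  obtain K2 where K2: "K2 \<ge> 0" "\<And>R Z. R \<ge> 1 \<Longrightarrow> finite Z \<Longrightarrow>
     (\<Sum>z\<in>Z. (fdiff k (cutoff (cusp k) R) (of_int z))\<^sup>2) \<le> K2 * (R powr (1 - 2 * real k) * (1 + ln R))"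
    using cusp_sq_sum[OF assms] by blast
  show ?thesis unfolding sq_bound_def
  proof (intro exI[of _ "K1 + K2"] conjI allI impI)
    fix R :: real and Z :: "int set" assume "1 \<le> R" "finite Z"
    note RZ = this
    show "(\<Sum>z\<in>Z. (fdiff k (cutoff (plateau k) R) (of_int z))\<^sup>2) \<le> (K1 + K2) * R powr (1 - 2 * real k)"
      by (rule order_trans[OF K1(2)[OF RZ] mult_right_mono]) (use K2(1) in auto)
    show "(\<Sum>z\<in>Z. (fdiff k (cutoff (cusp k) R) (of_int z))\<^sup>2) \<le> (K1 + K2) * (R powr (1 - 2 * real k) * (1 + ln R))"
      by (rule order_trans[OF K2(2)[OF RZ] mult_right_mono]) (use K1(1) RZ in auto)
  qed (use K1 K2 in auto)
qed

text \<open>A transposed profile vanishes at distance \<open>R + real k\<close> from its knot, so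
  the separation by \<open>2 * R + 2 * real k\<close> makes the supports of different knots
  disjoint, and the square of the sum is the sum of the squares.\<close>

lemma profile_transpose_sq_sum:
  fixes T :: "nat set" and e i N :: nat
  assumes k: "k \<ge> 1" and R: "R \<ge> 1" and K: "sq_bound k K" and T: "finite T"
    and sep: "\<And>t t'. t \<in> T \<Longrightarrow> t' \<in> T \<Longrightarrow> t \<noteq> t' \<Longrightarrow> 2 * R + 2 * real k \<le> \<bar>real t - real t'\<bar>"
    and bd: "\<And>t. t \<in> T \<Longrightarrow> real k + R \<le> real t \<and> real t + R \<le> real N + 1"
  defines "\<tau> t y \<equiv> (\<Sum>j\<in>{k + 1..N}. profile k R e i (real j - real t) * dcoef k N j y)"
  shows "(\<Sum>y=1..N. (\<Sum>t\<in>T. \<bar>\<tau> t y\<bar>)\<^sup>2)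
     \<le> (if i = e then 1 + ln R else 1) * (real N ^ (2 * (k - 1)) * real (card T) * K * R powr (1 - 2 * real k))"
proof -
  let ?F = "profile k R e i" and ?c = "if i = e then 1 + ln R else 1"
  have R0: "R > 0" using R by simp
  have \<tau>: "\<tau> t y = real N ^ (k - 1) * fdiff k ?F (of_int (int t - int y))" if "t \<in> T" "y \<in> {1..N}" for t y
    unfolding \<tau>_def using bd[OF that(1)]
    by (intro sum_dcoef_transpose[where R = R] that(2) profile_minus profile_eq_0[OF k R0]) auto
  have zero: "fdiff k ?F x = 0" if "\<bar>x\<bar> \<ge> R + real k" for x
  proof -
    have "?F (x - of_nat l) = 0" if "l \<le> k" for l
      using that \<open>\<bar>x\<bar> \<ge> R + real k\<close> by (intro profile_eq_0[OF k R0]) linarith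
    then show ?thesis by (simp add: fdiff_def)
  qed
  have "(\<Sum>y=1..N. (\<Sum>t\<in>T. \<bar>\<tau> t y\<bar>)\<^sup>2) = (\<Sum>y=1..N. \<Sum>t\<in>T. \<bar>\<tau> t y\<bar>\<^sup>2)"
  proof (intro sum.cong refl sum_square_disjoint T)
    fix y t t' assume y: "y \<in> {1..N}" and t: "t \<in> T" "t' \<in> T" "t \<noteq> t'"
    have "\<bar>real_of_int (int t - int y)\<bar> \<ge> R + real k \<or> \<bar>real_of_int (int t' - int y)\<bar> \<ge> R + real k"
      using sep[OF t] by simp linarith
    then show "\<bar>\<tau> t y\<bar> = 0 \<or> \<bar>\<tau> t' y\<bar> = 0"
      using zero \<tau>[OF t(1) y] \<tau>[OF t(2) y] by auto
  qed
  also have "\<dots> = (\<Sum>t\<in>T. \<Sum>y=1..N. \<bar>\<tau> t y\<bar>\<^sup>2)" by (rule sum.swap)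
  also have "\<dots> \<le> (\<Sum>t\<in>T. real N ^ (2 * (k - 1)) * (?c * (K * R powr (1 - 2 * real k))))"
  proof (intro sum_mono)
    fix t assume t: "t \<in> T"
    have "(\<Sum>y=1..N. \<bar>\<tau> t y\<bar>\<^sup>2) = (\<Sum>y=1..N. real N ^ (2 * (k - 1)) * (fdiff k ?F (of_int (int t - int y)))\<^sup>2)"
      using \<tau>[OF t] by (intro sum.cong) (auto simp: power_mult_distrib power_mult[symmetric] mult.commute)
    also have "\<dots> = real N ^ (2 * (k - 1)) * (\<Sum>z\<in>(\<lambda>y. int t - int y) ` {1..N}. (fdiff k ?F (of_int z))\<^sup>2)"
      by (subst sum.reindex) (auto simp: inj_on_def sum_distrib_left)
    also have "\<dots> \<le> real N ^ (2 * (k - 1)) * (?c * (K * R powr (1 - 2 * real k)))"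
      using K R by (intro mult_left_mono) (auto simp: sq_bound_def profile_def mult_ac)
    finally show "(\<Sum>y=1..N. \<bar>\<tau> t y\<bar>\<^sup>2) \<le> real N ^ (2 * (k - 1)) * (?c * (K * R powr (1 - 2 * real k)))" .
  qed
  also have "\<dots> = ?c * (real N ^ (2 * (k - 1)) * real (card T) * K * R powr (1 - 2 * real k))" by simp
  finally show ?thesis .
qed

lemma interpolation_transpose_norm:
  fixes T :: "nat \<Rightarrow> nat set" and q :: "(nat \<Rightarrow> nat) \<Rightarrow> real"
  assumes k: "k \<ge> 1" and R: "R \<ge> 1" and K: "sq_bound k K"
    and T: "\<And>i. i \<in> {1..d} \<Longrightarrow> finite (T i) \<and> card (T i) = m"
    and sep: "\<And>i t t'. i \<in> {1..d} \<Longrightarrow> t \<in> T i \<Longrightarrow> t' \<in> T i \<Longrightarrow> t \<noteq> t' \<Longrightarrow> 2 * R + 2 * real k \<le> \<bar>real t - real t'\<bar>"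
    and bd: "\<And>i t. i \<in> {1..d} \<Longrightarrow> t \<in> T i \<Longrightarrow> real k + R \<le> real t \<and> real t + R \<le> real N + 1"
    and q: "\<And>t. \<bar>q t\<bar> \<le> 1" and d: "d \<ge> 1"
  defines "S \<equiv> PiE {1..d} T"
  defines "w j \<equiv> (\<Sum>t\<in>S. q t * bump k d R t j)"
  defines "Dw y \<equiv> (\<Sum>j\<in>diff_cube d N k. w j * (\<Prod>i=1..d. dcoef k N (j i) (y i)))"
  shows "ip (cube d N) Dw Dw \<le>
     (real d + 1)\<^sup>2 * (1 + ln R) * (real N ^ (2 * (k - 1)) * real m * K * R powr (1 - 2 * real k)) ^ d"
proof -
  let ?I = "cube d N"
  define \<tau> where "\<tau> e i t y = (\<Sum>j\<in>{k + 1..N}. profile k R e i (real j - real t) * dcoef k N j y)" for e i t y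
  define a where "a e = (if e = 0 then 1 else - 1 / real d)" for e :: nat
  have a: "\<bar>a e\<bar> \<le> 1" for e using d by (simp add: a_def)
  have Dw: "Dw y = (\<Sum>t\<in>S. q t * (\<Sum>e\<le>d. a e * (\<Prod>i=1..d. \<tau> e i (t i) (y i))))" for y
  proof -
    have prodsum: "(\<Prod>i=1..d. \<tau> e i (t i) (y i)) = (\<Sum>j\<in>diff_cube d N k.
        (\<Prod>i=1..d. profile k R e i (real (j i) - real (t i))) * (\<Prod>i=1..d. dcoef k N (j i) (y i)))" for e t
      unfolding \<tau>_def idx_def by (subst prod_sum_PiE) (auto simp: prod.distrib)
    have "Dw y = (\<Sum>t\<in>S. \<Sum>j\<in>diff_cube d N k. q t * bump k d R t j * (\<Prod>i=1..d. dcoef k N (j i) (y i)))"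
      unfolding Dw_def w_def sum_distrib_right by (rule sum.swap)
    also have "\<dots> = (\<Sum>t\<in>S. q t * (\<Sum>e\<le>d. a e * (\<Prod>i=1..d. \<tau> e i (t i) (y i))))"
    proof (intro sum.cong refl)
      fix t
      have "(\<Sum>j\<in>diff_cube d N k. bump k d R t j * (\<Prod>i=1..d. dcoef k N (j i) (y i)))
          = (\<Sum>e\<le>d. a e * (\<Prod>i=1..d. \<tau> e i (t i) (y i)))"
        unfolding prodsum bump_def sum_distrib_right sum_distrib_left a_def
        by (subst sum.swap) (simp only: mult.assoc)
      then show "(\<Sum>j\<in>diff_cube d N k. q t * bump k d R t j * (\<Prod>i=1..d. dcoef k N (j i) (y i)))
          = q t * (\<Sum>e\<le>d. a e * (\<Prod>i=1..d. \<tau> e i (t i) (y i)))"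
        by (simp only: mult.assoc sum_distrib_left[symmetric])
    qed
    finally show ?thesis .
  qed
  define G where "G e i y = (\<Sum>t\<in>T i. \<bar>\<tau> e i t y\<bar>)" for e i y
  \<comment> \<open>The signs \<open>q\<close> destroy the product structure of the sum over the
    grid. Absolute values restore it, as a product of the coordinate sums \<open>G\<close>, and lose
    little because the supports are disjoint. One factor \<open>real d + 1\<close> comes from the
    Cauchy-Schwarz inequality over \<open>e\<close>, the other from summing over
    \<open>e\<close>.\<close>
  have Dw_le: "(Dw y)\<^sup>2 \<le> (real d + 1) * (\<Sum>e\<le>d. \<Prod>i=1..d. (G e i (y i))\<^sup>2)" for y
  proof -
    have "\<bar>Dw y\<bar> \<le> (\<Sum>t\<in>S. \<bar>q t * (\<Sum>e\<le>d. a e * (\<Prod>i=1..d. \<tau> e i (t i) (y i)))\<bar>)"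
      unfolding Dw by (rule sum_abs)
    also have "\<dots> \<le> (\<Sum>t\<in>S. \<Sum>e\<le>d. \<Prod>i=1..d. \<bar>\<tau> e i (t i) (y i)\<bar>)"
    proof (intro sum_mono)
      fix t
      have "\<bar>q t * (\<Sum>e\<le>d. a e * (\<Prod>i=1..d. \<tau> e i (t i) (y i)))\<bar>
          \<le> 1 * \<bar>\<Sum>e\<le>d. a e * (\<Prod>i=1..d. \<tau> e i (t i) (y i))\<bar>"
        unfolding abs_mult using q by (intro mult_right_mono) auto
      also have "\<dots> \<le> (\<Sum>e\<le>d. \<bar>a e * (\<Prod>i=1..d. \<tau> e i (t i) (y i))\<bar>)" by simp
      also have "\<dots> \<le> (\<Sum>e\<le>d. 1 * \<bar>\<Prod>i=1..d. \<tau> e i (t i) (y i)\<bar>)"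
        unfolding abs_mult using a by (intro sum_mono mult_right_mono) auto
      finally show "\<bar>q t * (\<Sum>e\<le>d. a e * (\<Prod>i=1..d. \<tau> e i (t i) (y i)))\<bar>
          \<le> (\<Sum>e\<le>d. \<Prod>i=1..d. \<bar>\<tau> e i (t i) (y i)\<bar>)" by (simp add: abs_prod)
    qed
    also have "\<dots> = (\<Sum>e\<le>d. \<Sum>t\<in>S. \<Prod>i=1..d. \<bar>\<tau> e i (t i) (y i)\<bar>)" by (rule sum.swap)
    also have "\<dots> = (\<Sum>e\<le>d. \<Prod>i=1..d. G e i (y i))"
      unfolding S_def G_def using T by (subst prod_sum_PiE) auto
    finally have "\<bar>Dw y\<bar>\<^sup>2 \<le> (\<Sum>e\<le>d. \<Prod>i=1..d. G e i (y i))\<^sup>2" by (intro power_mono) auto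
    also have "\<dots> \<le> real (card {..d}) * (\<Sum>e\<le>d. (\<Prod>i=1..d. G e i (y i))\<^sup>2)" by (rule square_sum_le)
    finally show ?thesis by (simp add: prod_power_distrib add.commute)
  qed
  define A where "A = real N ^ (2 * (k - 1)) * real m * K * R powr (1 - 2 * real k)"
  have lnR: "0 \<le> ln R" using R by simp
  have A0: "0 \<le> A" using K by (auto simp: sq_bound_def A_def)
  have "ip ?I Dw Dw = (\<Sum>y\<in>?I. (Dw y)\<^sup>2)" by (simp add: ip_def power2_eq_square)
  also have "\<dots> \<le> (\<Sum>y\<in>?I. (real d + 1) * (\<Sum>e\<le>d. \<Prod>i=1..d. (G e i (y i))\<^sup>2))"
    by (intro sum_mono Dw_le)
  also have "\<dots> = (real d + 1) * (\<Sum>e\<le>d. \<Sum>y\<in>?I. \<Prod>i=1..d. (G e i (y i))\<^sup>2)"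
    by (simp only: sum_distrib_left[symmetric] sum.swap[of _ "{..d}" ?I])
  also have "(\<Sum>e\<le>d. \<Sum>y\<in>?I. \<Prod>i=1..d. (G e i (y i))\<^sup>2) \<le> (\<Sum>e\<le>d. (1 + ln R) * A ^ d)"
  proof (intro sum_mono)
    fix e
    have "(\<Sum>y\<in>?I. \<Prod>i=1..d. (G e i (y i))\<^sup>2) = (\<Prod>i=1..d. \<Sum>y=1..N. (G e i y)\<^sup>2)"
      unfolding idx_def by (subst prod_sum_PiE) auto
    also have "\<dots> \<le> (\<Prod>i=1..d. (if i = e then 1 + ln R else 1) * A)"
    proof (intro prod_mono conjI)
      fix i assume i: "i \<in> {1..d}"
      show "(\<Sum>y=1..N. (G e i y)\<^sup>2) \<le> (if i = e then 1 + ln R else 1) * A"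
        unfolding G_def \<tau>_def
        using profile_transpose_sq_sum[OF k R K, of "T i" N e i] T[OF i] sep[OF i] bd[OF i] by (simp add: A_def)
    qed (auto intro: sum_nonneg)
    also have "\<dots> = (if e \<in> {1..d} then 1 + ln R else 1) * A ^ d"
      by (simp only: prod.distrib prod_constant) (simp add: prod.delta)
    also have "\<dots> \<le> (1 + ln R) * A ^ d"
      using lnR A0 by (intro mult_right_mono zero_le_power) auto
    finally show "(\<Sum>y\<in>?I. \<Prod>i=1..d. (G e i (y i))\<^sup>2) \<le> (1 + ln R) * A ^ d" .
  qed
  finally show ?thesis unfolding A_def[symmetric] by (simp add: power2_eq_square mult_ac add.commute)
qed

section \<open>Projection and estimator\<close>

lemma tinner_eq_ip: "tinner d ns f h = ip (full_idx d ns) f h"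
  by (simp add: tinner_def ip_def)

lemma tnorm_sq_eq_ip: "(tnorm d ns f)\<^sup>2 = ip (full_idx d ns) f f"
  by (simp add: tnorm_def L2_set_def ip_def sum_nonneg power2_eq_square)

lemma finite_idx [simp]: "finite (idx d ns a)"
  by (simp add: idx_def finite_PiE)

lemma total_diff_lincomb:
  assumes "j \<in> diff_cube d N k"
  shows "cube_diff d N k (\<lambda>x. f x + c * g x) j
    = cube_diff d N k f j + c * cube_diff d N k g j"
  unfolding total_diff_eq[OF assms] by (simp add: algebra_simps sum.distrib sum_distrib_left)

lemma total_diff_diff:
  assumes "j \<in> diff_cube d N k"
  shows "cube_diff d N k (\<lambda>x. f x - g x) j
    = cube_diff d N k f j - cube_diff d N k g j"
  using total_diff_lincomb[OF assms, of f "-1" g] by simp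

lemma total_diff_cong:
  assumes "j \<in> diff_cube d N k" "\<And>y. y \<in> cube d N \<Longrightarrow> f y = g y"
  shows "cube_diff d N k f j = cube_diff d N k g j"
  unfolding total_diff_eq[OF assms(1)] using assms(2) by (intro sum.cong) auto

lemma fsubspace_null_space: "fsubspace (null_cube d N k)"
  unfolding fsubspace_def null_space_def
  by (auto simp: tensors_def total_diff_lincomb) (simp add: total_diff_eq)

lemma fsubspace_null_perp: "fsubspace (perp_space d N k)"
  unfolding fsubspace_def null_perp_def
  by (auto simp: tensors_def tinner_eq_ip ip_add_left ip_scale_left) (simp add: ip_def)

lemma null_perp_vanish: "f \<in> null_perp d ns k \<Longrightarrow> j \<notin> full_idx d ns \<Longrightarrow> f j = 0"
  by (simp add: null_perp_def tensors_def)

lemma null_perp_ext: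
  assumes "f \<in> null_perp d ns k" "g \<in> null_perp d ns k" "\<And>j. j \<in> full_idx d ns \<Longrightarrow> f j = g j"
  shows "f = g"
proof
  fix j show "f j = g j"
    using assms(3)[of j] null_perp_vanish[OF assms(1), of j] null_perp_vanish[OF assms(2), of j] by metis
qed

lemma proj_perp_unique:
  assumes p: "p \<in> perp_space d N k"
    and eq: "\<And>u. u \<in> perp_space d N k \<Longrightarrow> ip (cube d N) p u = ip (cube d N) f u"
  shows "perp_proj d N k f = p"
  unfolding proj_perp_def
proof (rule the_equality)
  show "p \<in> perp_space d N k \<and> (\<forall>u\<in>perp_space d N k. tinner d (\<lambda>_. N) (\<lambda>j. f j - p j) u = 0)"
    using p eq by (simp add: tinner_eq_ip ip_diff_left)
next
  let ?I = "cube d N"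
  fix p' assume p': "p' \<in> perp_space d N k \<and> (\<forall>u\<in>perp_space d N k. tinner d (\<lambda>_. N) (\<lambda>j. f j - p' j) u = 0)"
  let ?u = "\<lambda>j. p' j - p j"
  have u: "?u \<in> perp_space d N k" using p p' fsubspace_diff[OF fsubspace_null_perp] by blast
  have "ip ?I ?u ?u = ip ?I p' ?u - ip ?I p ?u" by (rule ip_diff_left)
  also have "\<dots> = 0" using p' u eq[OF u] by (auto simp: tinner_eq_ip ip_diff_left)
  finally have "\<forall>j\<in>?I. ?u j = 0" by (subst (asm) ip_self_eq_0_iff) auto
  then show "p' = p" using p p' by (intro null_perp_ext[of p' d "\<lambda>_. N" k p]) auto
qed

text \<open>From \<open>f\<close>, cut off outside the cube so that the result is a tensor, the
  projection onto an orthonormal basis of the null space is subtracted.\<close>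

lemma proj_perp_ex:
  "\<exists>p. p \<in> perp_space d N k \<and> (\<lambda>j. (if j \<in> cube d N then f j else 0) - p j) \<in> null_cube d N k"
proof -
  let ?I = "cube d N" and ?N = "null_cube d N k"
  obtain E where E: "orthonormal ?I E" "E \<subseteq> ?N" "\<And>v x. v \<in> ?N \<Longrightarrow> x \<in> ?I \<Longrightarrow> proj ?I E v x = v x"
    using fsubspace_orthonormal_basis[of ?I ?N, OF finite_idx fsubspace_null_space] by blast
  let ?v = "proj ?I E f"
  have v: "?v \<in> ?N" using proj_in_fsubspace[OF fsubspace_null_space E(2)] .
  define p where "p j = (if j \<in> ?I then f j else 0) - ?v j" for j
  have "ip ?I p h = 0" if h: "h \<in> ?N" for h
  proof -
    have "ip ?I p h = ip ?I (\<lambda>j. f j - ?v j) h" by (rule ip_cong) (auto simp: p_def)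
    also have "\<dots> = ip ?I f h - ip ?I f (proj ?I E h)" by (simp only: ip_diff_left ip_proj_symmetric)
    also have "ip ?I f (proj ?I E h) = ip ?I f h" using E(3)[OF h] by (intro ip_cong) auto
    finally show ?thesis by simp
  qed
  moreover have "p \<in> tensors d (\<lambda>_. N)" using v by (auto simp: tensors_def null_space_def p_def)
  ultimately have "p \<in> perp_space d N k" by (simp add: null_perp_def tinner_eq_ip)
  moreover have "(\<lambda>j. (if j \<in> ?I then f j else 0) - p j) = ?v" by (auto simp: p_def)
  ultimately show ?thesis using v by metis
qed

lemma ip_null_perp_null_space:
  "p \<in> null_perp d ns k \<Longrightarrow> h \<in> null_space d ns k \<Longrightarrow> ip (full_idx d ns) p h = 0"
  by (simp add: null_perp_def tinner_eq_ip)

lemma proj_perp_props: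
  fixes N d k :: nat
  defines "I \<equiv> cube d N" and "V \<equiv> perp_space d N k"
  shows proj_perp_in: "perp_proj d N k f \<in> V"
    and proj_perp_residual: "(\<lambda>j. (if j \<in> I then f j else 0) - perp_proj d N k f j) \<in> null_cube d N k"
    and ip_proj_perp: "u \<in> V \<Longrightarrow> ip I (perp_proj d N k f) u = ip I f u"
proof -
  obtain p where p: "p \<in> V" "(\<lambda>j. (if j \<in> I then f j else 0) - p j) \<in> null_cube d N k"
    using proj_perp_ex unfolding I_def V_def by blast
  have ipu: "ip I p u = ip I f u" if "u \<in> V" for u
  proof -
    have "ip I u (\<lambda>j. (if j \<in> I then f j else 0) - p j) = 0"
      using that p(2) unfolding I_def V_def by (intro ip_null_perp_null_space)
    moreover have "ip I u (\<lambda>j. if j \<in> I then f j else 0) = ip I u f" by (rule ip_cong) auto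
    ultimately show ?thesis by (simp add: ip_diff_right ip_commute[of I _ u])
  qed
  have "perp_proj d N k f = p"
    using p(1) ipu unfolding I_def V_def by (intro proj_perp_unique) auto
  then show "perp_proj d N k f \<in> V" "u \<in> V \<Longrightarrow> ip I (perp_proj d N k f) u = ip I f u"
    "(\<lambda>j. (if j \<in> I then f j else 0) - perp_proj d N k f j) \<in> null_cube d N k"
    using p ipu by auto
qed

lemma proj_perp_diff:
  assumes "f \<in> perp_space d N k"
  shows "perp_proj d N k (\<lambda>j. Y j - f j) = (\<lambda>j. perp_proj d N k Y j - f j)"
proof (rule proj_perp_unique)
  show "(\<lambda>j. perp_proj d N k Y j - f j) \<in> perp_space d N k"
    by (intro fsubspace_diff[OF fsubspace_null_perp] proj_perp_in assms)
qed (simp add: ip_diff_left ip_proj_perp del: One_nat_def)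

lemma proj_perp_add:
  "perp_proj d N k (\<lambda>j. f j + g j) = (\<lambda>j. perp_proj d N k f j + perp_proj d N k g j)"
proof (rule proj_perp_unique)
  show "(\<lambda>j. perp_proj d N k f j + perp_proj d N k g j) \<in> perp_space d N k"
    by (intro fsubspace_add[OF fsubspace_null_perp] proj_perp_in)
qed (simp add: ip_add_left ip_proj_perp del: One_nat_def)

lemma ip_proj_perp_self_le:
  "ip (cube d N) (perp_proj d N k f) (perp_proj d N k f) \<le> ip (cube d N) f f"
proof -
  let ?I = "cube d N" and ?p = "perp_proj d N k f"
  have "0 \<le> ip ?I (\<lambda>j. f j - ?p j) (\<lambda>j. f j - ?p j)" by (rule ip_self_nonneg)
  also have "\<dots> = ip ?I f f - 2 * ip ?I f ?p + ip ?I ?p ?p" by (rule ip_self_diff)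
  also have "ip ?I f ?p = ip ?I ?p ?p" by (rule ip_proj_perp[symmetric]) (rule proj_perp_in)
  finally show ?thesis by simp
qed

lemma total_diff_proj_perp:
  assumes "j \<in> diff_cube d N k"
  shows "cube_diff d N k (perp_proj d N k f) j = cube_diff d N k f j"
proof -
  let ?I = "cube d N"
  have "cube_diff d N k (\<lambda>j. (if j \<in> ?I then f j else 0) - perp_proj d N k f j) j = 0"
    using proj_perp_residual[of d N f k] assms by (simp add: null_space_def)
  moreover have "cube_diff d N k (\<lambda>j. if j \<in> ?I then f j else 0) j = cube_diff d N k f j"
    by (rule total_diff_cong[OF assms]) auto
  ultimately show ?thesis by (simp add: total_diff_diff[OF assms])
qed

text \<open>On the cube, tensors with equal differences differ by an element of the null space,
  which is invisible to \<open>perp_space\<close>. Thus \<open>h\<close> can be recovered from its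
  differences.\<close>

lemma null_perp_eq_iff_total_diff:
  assumes "h \<in> perp_space d N k"
    and "\<And>j. j \<in> diff_cube d N k \<Longrightarrow> cube_diff d N k f j = cube_diff d N k h j"
  shows "perp_proj d N k f = h"
proof (rule proj_perp_unique[OF assms(1)])
  let ?I = "cube d N"
  fix u assume u: "u \<in> perp_space d N k"
  let ?g = "\<lambda>j. if j \<in> ?I then f j - h j else 0"
  have "cube_diff d N k ?g j = 0" if j: "j \<in> diff_cube d N k" for j
  proof -
    have "cube_diff d N k ?g j = cube_diff d N k (\<lambda>j. f j - h j) j"
      by (rule total_diff_cong[OF j]) auto
    then show ?thesis using assms(2)[OF j] by (simp add: total_diff_diff[OF j])
  qed
  then have "?g \<in> null_cube d N k" by (simp add: null_space_def tensors_def)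
  then have "ip ?I u ?g = 0" by (rule ip_null_perp_null_space[OF u])
  moreover have "ip ?I u ?g = ip ?I u (\<lambda>j. f j - h j)" by (rule ip_cong) auto
  ultimately show "ip ?I h u = ip ?I f u" by (simp add: ip_diff_right ip_commute[of ?I _ u] del: One_nat_def)
qed

section \<open>Existence, strong convexity and stability of the minimiser\<close>

lemma TV_convex:
  assumes "0 \<le> \<theta>" "\<theta> \<le> 1"
  shows "cube_TV d N k (\<lambda>x. f x + \<theta> * (g x - f x)) \<le> (1 - \<theta>) * cube_TV d N k f + \<theta> * cube_TV d N k g"
proof -
  let ?D = "cube_diff d N k"
  have "cube_TV d N k (\<lambda>x. f x + \<theta> * (g x - f x)) \<le> (\<Sum>j\<in>diff_cube d N k. (1 - \<theta>) * \<bar>?D f j\<bar> + \<theta> * \<bar>?D g j\<bar>)"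
    unfolding TV_def
  proof (rule sum_mono)
    fix j assume j: "j \<in> diff_cube d N k"
    have "?D (\<lambda>x. f x + \<theta> * (g x - f x)) j = (1 - \<theta>) * ?D f j + \<theta> * ?D g j"
      unfolding total_diff_lincomb[OF j, of f \<theta> "\<lambda>x. g x - f x"] total_diff_diff[OF j, of g f]
      by (simp add: algebra_simps)
    also have "\<bar>\<dots>\<bar> \<le> \<bar>(1 - \<theta>) * ?D f j\<bar> + \<bar>\<theta> * ?D g j\<bar>" by (rule abs_triangle_ineq)
    finally show "\<bar>?D (\<lambda>x. f x + \<theta> * (g x - f x)) j\<bar> \<le> (1 - \<theta>) * \<bar>?D f j\<bar> + \<theta> * \<bar>?D g j\<bar>"
      using assms by (simp add: abs_mult)
  qed
  then show ?thesis by (simp add: TV_def sum.distrib sum_distrib_left)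
qed

lemma TV_zero [simp]: "cube_TV d N k (\<lambda>_. 0) = 0"
  by (simp add: TV_def total_diff_eq)

lemma TV_nonneg: "0 \<le> TV d ns k f"
  by (simp add: TV_def sum_nonneg)

lemma objective_eq:
  fixes Y :: "(nat \<Rightarrow> nat) \<Rightarrow> real"
  assumes "f \<in> perp_space d N k"
  defines "r \<equiv> (\<lambda>j. perp_proj d N k Y j - f j)"
  shows "cube_objective d N k lam Y f = ip (cube d N) r r / real (N ^ d) + 2 * lam * cube_TV d N k f"
  unfolding objective_def tnorm_sq_eq_ip proj_perp_diff[OF assms(1)] by (simp add: r_def)

lemma continuous_on_coordinate: "continuous_on UNIV (\<lambda>f::'a \<Rightarrow> real. f j)"
  by (rule continuous_on_product_coordinates)

lemma continuous_on_objective: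
  "continuous_on UNIV (\<lambda>f. ip (cube d N) (\<lambda>j. p j - f j) (\<lambda>j. p j - f j) / c
     + 2 * lam * cube_TV d N k f)"
proof -
  have "cube_TV d N k f = (\<Sum>j\<in>diff_cube d N k. \<bar>\<Sum>y\<in>cube d N. (\<Prod>i=1..d. dcoef k N (j i) (y i)) * f y\<bar>)" for f
    unfolding TV_def by (intro sum.cong refl) (simp add: total_diff_eq)
  then show ?thesis unfolding ip_def divide_inverse
    by (auto intro!: continuous_intros continuous_on_coordinate)
qed

lemma closed_null_perp: "closed (null_perp d ns k)"
proof -
  have "null_perp d ns k = (\<Inter>j\<in>- full_idx d ns. {f. f j = 0}) \<inter> (\<Inter>h\<in>null_space d ns k. {f. ip (full_idx d ns) f h = 0})"
    by (auto simp: null_perp_def tensors_def tinner_eq_ip)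
  moreover have "closed {f::(nat \<Rightarrow> nat) \<Rightarrow> real. f j = 0}" for j
    by (intro closed_Collect_eq continuous_on_coordinate continuous_on_const)
  moreover have "closed {f. ip (full_idx d ns) f h = 0}" for h
    unfolding ip_def by (intro closed_Collect_eq) (auto intro!: continuous_intros continuous_on_coordinate)
  ultimately show ?thesis by (metis (no_types, lifting) closed_INT closed_Int)
qed

text \<open>Tychonoff's theorem. The minimisation takes place in the product topology on functions
  of all multi-indices, where a common closed interval for the coordinates gives
  compactness.\<close>

lemma compact_box: "compact {f::'a \<Rightarrow> real. \<forall>j. f j \<in> {-B..B}}"
proof -
  have "compactin euclidean (PiE UNIV (\<lambda>_::'a. {-B..B}))"
    unfolding euclidean_product_topology[symmetric] compactin_PiE by simp
  moreover have "PiE UNIV (\<lambda>_::'a. {-B..B}) = {f. \<forall>j. f j \<in> {-B..B}}" by (auto simp: PiE_def Pi_def)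
  ultimately show ?thesis by simp
qed

text \<open>\<open>s\<close> is the norm of the projected data. A competitor outside the box of
  half-width \<open>2 * s\<close> has a residual coordinate of size at least \<open>s\<close>, so
  its fit alone costs at least as much as the zero tensor.\<close>

lemma objective_minimizer_exists:
  assumes N: "N \<ge> 1" and lam: "lam \<ge> 0"
  shows "\<exists>f\<in>perp_space d N k. \<forall>g\<in>perp_space d N k.
    cube_objective d N k lam Y f \<le> cube_objective d N k lam Y g"
proof -
  let ?I = "cube d N" and ?V = "perp_space d N k"
  define p where "p = perp_proj d N k Y"
  define ob where "ob f = ip ?I (\<lambda>j. p j - f j) (\<lambda>j. p j - f j) / real (N ^ d) + 2 * lam * cube_TV d N k f" for f
  have ob: "cube_objective d N k lam Y f = ob f" if "f \<in> ?V" for f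
    using objective_eq[OF that] by (simp add: ob_def p_def)
  define s where "s = sqrt (ip ?I p p)"
  have coord: "\<bar>u j\<bar> \<le> sqrt (ip ?I u u)" if "j \<in> ?I" for u j
  proof -
    have "(u j)\<^sup>2 \<le> ip ?I u u"
      unfolding ip_def power2_eq_square using that by (intro member_le_sum) auto
    then show ?thesis using real_le_rsqrt[of "\<bar>u j\<bar>" "ip ?I u u"] by simp
  qed
  define C where "C = ?V \<inter> {f. \<forall>j. f j \<in> {-(2 * s)..2 * s}}"
  have s0: "s \<ge> 0" by (simp add: s_def ip_self_nonneg)
  have zero: "(\<lambda>_. 0) \<in> ?V" using fsubspace_null_perp by (simp add: fsubspace_def)
  then have zC: "(\<lambda>_. 0) \<in> C" using s0 by (simp add: C_def)
  have "compact C" unfolding C_def by (intro closed_Int_compact closed_null_perp compact_box)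
  moreover have "continuous_on C ob"
    unfolding ob_def by (rule continuous_on_subset[OF continuous_on_objective]) simp
  ultimately obtain f where f: "f \<in> C" "\<And>g. g \<in> C \<Longrightarrow> ob f \<le> ob g"
    using continuous_attains_inf[of C ob] zC by blast
  have "ob f \<le> ob g" if g: "g \<in> ?V" for g
  proof (cases "g \<in> C")
    case True
    then show ?thesis by (rule f(2))
  next
    case False
    then obtain j where "\<not> (- (2 * s) \<le> g j \<and> g j \<le> 2 * s)" using g by (auto simp: C_def)
    then have j: "\<bar>g j\<bar> > 2 * s" by linarith
    then have jI: "j \<in> ?I" using null_perp_vanish[OF g, of j] s0 by force
    have "s \<le> \<bar>p j - g j\<bar>" using j coord[OF jI, of p, folded s_def] by linarith
    also have "\<dots> \<le> sqrt (ip ?I (\<lambda>j. p j - g j) (\<lambda>j. p j - g j))" by (rule coord[OF jI])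
    finally have "ip ?I p p \<le> ip ?I (\<lambda>j. p j - g j) (\<lambda>j. p j - g j)" by (simp add: s_def)
    then have "ip ?I p p / real (N ^ d) \<le> ip ?I (\<lambda>j. p j - g j) (\<lambda>j. p j - g j) / real (N ^ d)"
      by (intro divide_right_mono) auto
    moreover have "0 \<le> 2 * lam * cube_TV d N k g" using lam TV_nonneg by simp
    ultimately have "ob (\<lambda>_. 0) \<le> ob g" by (simp add: ob_def)
    with f(2)[OF zC] show ?thesis by simp
  qed
  then show ?thesis using f(1) ob by (intro bexI[of _ f]) (auto simp: C_def)
qed

lemma estimator_minimizes:
  assumes N: "N \<ge> 1" and lam: "lam \<ge> 0"
  shows estimator_in: "cube_estimator d N k lam Y \<in> perp_space d N k"
    and estimator_le: "g \<in> perp_space d N k \<Longrightarrow>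
      cube_objective d N k lam Y (cube_estimator d N k lam Y) \<le> cube_objective d N k lam Y g"
proof -
  have "\<exists>f. is_arg_min (cube_objective d N k lam Y) (\<lambda>f. f \<in> perp_space d N k) f"
    using objective_minimizer_exists[OF assms, of d k Y] by (auto simp: is_arg_min_def not_less)
  then have "is_arg_min (cube_objective d N k lam Y) (\<lambda>f. f \<in> perp_space d N k) (cube_estimator d N k lam Y)"
    unfolding estimator_def arg_min_def by (rule someI_ex)
  then show "cube_estimator d N k lam Y \<in> perp_space d N k"
    "g \<in> perp_space d N k \<Longrightarrow>
      cube_objective d N k lam Y (cube_estimator d N k lam Y) \<le> cube_objective d N k lam Y g"
    by (auto simp: is_arg_min_def not_less)
qed

text \<open>The minimiser is compared with the point at \<open>\<theta>\<close> on the segment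
  towards \<open>g\<close>. The quadratic identity gains
  \<open>\<theta> * (1 - \<theta>) * D\<close>; after division by \<open>\<theta>\<close>, the limit
  at 0 yields the full squared distance.\<close>

lemma estimator_strong_convexity:
  fixes Y :: "(nat \<Rightarrow> nat) \<Rightarrow> real"
  assumes N: "N \<ge> 1" and lam: "lam \<ge> 0" and g: "g \<in> perp_space d N k"
  defines "fh \<equiv> cube_estimator d N k lam Y"
  shows "cube_objective d N k lam Y fh + ip (cube d N) (\<lambda>j. fh j - g j) (\<lambda>j. fh j - g j) / real (N ^ d)
     \<le> cube_objective d N k lam Y g"
proof -
  let ?I = "cube d N" and ?V = "perp_space d N k" and ?n = "real (N ^ d)"
  let ?ob = "cube_objective d N k lam Y" and ?p = "perp_proj d N k Y"
  define D where "D = ip ?I (\<lambda>j. fh j - g j) (\<lambda>j. fh j - g j) / ?n"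
  have fh: "fh \<in> ?V" unfolding fh_def by (rule estimator_in[OF N lam])
  have step: "?ob fh + (1 - \<theta>) * D \<le> ?ob g" if \<theta>: "0 < \<theta>" "\<theta> < 1" for \<theta>
  proof -
    let ?h = "\<lambda>x. fh x + \<theta> * (g x - fh x)"
    have h: "?h \<in> ?V"
      by (intro fsubspace_lincomb[OF fsubspace_null_perp] fsubspace_diff[OF fsubspace_null_perp] fh g)
    have quad: "ip ?I (\<lambda>j. ?p j - ?h j) (\<lambda>j. ?p j - ?h j)
      = (1 - \<theta>) * ip ?I (\<lambda>j. ?p j - fh j) (\<lambda>j. ?p j - fh j) + \<theta> * ip ?I (\<lambda>j. ?p j - g j) (\<lambda>j. ?p j - g j)
        - \<theta> * (1 - \<theta>) * ip ?I (\<lambda>j. fh j - g j) (\<lambda>j. fh j - g j)"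
      unfolding ip_def sum_distrib_left sum.distrib[symmetric] sum_subtractf[symmetric]
      by (intro sum.cong refl) (simp add: algebra_simps)
    have "2 * lam * cube_TV d N k ?h \<le> 2 * lam * ((1 - \<theta>) * cube_TV d N k fh + \<theta> * cube_TV d N k g)"
      using lam \<theta> by (intro mult_left_mono TV_convex) auto
    then have "?ob ?h \<le> (1 - \<theta>) * ?ob fh + \<theta> * ?ob g - \<theta> * (1 - \<theta>) * D"
      unfolding objective_eq[OF h] objective_eq[OF fh] objective_eq[OF g] quad D_def
      by (simp add: add_divide_distrib diff_divide_distrib algebra_simps)
    moreover have "?ob fh \<le> ?ob ?h" unfolding fh_def by (rule estimator_le[OF N lam h[unfolded fh_def]])
    ultimately have "\<theta> * (?ob fh + (1 - \<theta>) * D) \<le> \<theta> * ?ob g" by (simp add: algebra_simps)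
    then show ?thesis using \<theta> by simp
  qed
  have "((\<lambda>\<theta>. ?ob fh + (1 - \<theta>) * D) \<longlongrightarrow> ?ob fh + (1 - 0) * D) (at_right 0)"
    by (intro tendsto_intros)
  moreover have "eventually (\<lambda>\<theta>. ?ob fh + (1 - \<theta>) * D \<le> ?ob g) (at_right 0)"
    unfolding eventually_at_right_field using step by (intro exI[of _ 1]) auto
  ultimately have "?ob fh + (1 - 0) * D \<le> ?ob g"
    by (intro tendsto_upperbound[of _ _ "at_right 0"]) auto
  then show ?thesis by (simp add: D_def)
qed

text \<open>Strong convexity is used twice, each estimator being the competitor of the other, and
  the penalties cancel in the sum. The purpose is the measurability of the risk.\<close>

lemma estimator_lipschitz:
  fixes Y Y' :: "(nat \<Rightarrow> nat) \<Rightarrow> real" and d k N :: nat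
  assumes N: "N \<ge> 1" and lam: "lam \<ge> 0"
  defines "I \<equiv> cube d N"
  defines "h \<equiv> (\<lambda>j. cube_estimator d N k lam Y j - cube_estimator d N k lam Y' j)"
  shows "ip I h h \<le> ip I (\<lambda>j. Y j - Y' j) (\<lambda>j. Y j - Y' j)"
proof -
  let ?V = "perp_space d N k" and ?n = "real (N ^ d)" and ?P = "perp_proj d N k"
  define f f' where "f = cube_estimator d N k lam Y" and "f' = cube_estimator d N k lam Y'"
  have f: "f \<in> ?V" "f' \<in> ?V" unfolding f_def f'_def by (intro estimator_in[OF N lam])+
  have h: "h = (\<lambda>j. f j - f' j)" by (simp add: h_def f_def f'_def)
  have hV: "h \<in> ?V" unfolding h by (intro fsubspace_diff[OF fsubspace_null_perp] f)
  let ?q = "\<lambda>Y f. ip I (\<lambda>j. ?P Y j - f j) (\<lambda>j. ?P Y j - f j)"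
  have hh': "ip I (\<lambda>j. f' j - f j) (\<lambda>j. f' j - f j) = ip I h h"
    unfolding h ip_def by (intro sum.cong refl) (simp add: algebra_simps)
  have "?q Y f / ?n + ip I h h / ?n + 2 * lam * cube_TV d N k f \<le> ?q Y f' / ?n + 2 * lam * cube_TV d N k f'"
    using estimator_strong_convexity[OF N lam f(2), of Y]
    unfolding f_def[symmetric] objective_eq[OF f(1)] objective_eq[OF f(2)] I_def[symmetric] h by simp
  moreover have "?q Y' f' / ?n + ip I h h / ?n + 2 * lam * cube_TV d N k f' \<le> ?q Y' f / ?n + 2 * lam * cube_TV d N k f"
    using estimator_strong_convexity[OF N lam f(1), of Y']
    unfolding f'_def[symmetric] objective_eq[OF f(1)] objective_eq[OF f(2)] I_def[symmetric] hh' by simp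
  ultimately have "(?q Y f + ip I h h + ?q Y' f' + ip I h h) / ?n \<le> (?q Y f' + ?q Y' f) / ?n"
    by (simp add: add_divide_distrib)
  then have "?q Y f + ip I h h + ?q Y' f' + ip I h h \<le> ?q Y f' + ?q Y' f"
    using N by (subst (asm) divide_le_cancel) auto
  then have "2 * ip I h h \<le> ?q Y f' + ?q Y' f - ?q Y f - ?q Y' f'" by simp
  also have "\<dots> = 2 * (ip I (?P Y) h - ip I (?P Y') h)"
    unfolding h by (simp add: ip_self_diff ip_diff_right algebra_simps)
  also have "\<dots> = 2 * ip I (\<lambda>j. Y j - Y' j) h"
    using hV unfolding I_def by (simp add: ip_proj_perp ip_diff_left del: One_nat_def)
  also have "\<dots> \<le> ip I (\<lambda>j. Y j - Y' j) (\<lambda>j. Y j - Y' j) + ip I h h"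
    using ip_self_nonneg[of I "\<lambda>x. (Y x - Y' x) - h x"] unfolding ip_self_diff by simp
  finally show ?thesis by simp
qed

text \<open>Multi-indices form an uncountable type, for which measurability of the coordinates does
  not in general give Borel measurability of the whole function. The Lipschitz bound makes
  \<open>\<Phi>\<close> depend on the finite set \<open>I\<close> only, so it can be transported to
  sequences indexed by the natural numbers.\<close>

lemma borel_measurable_lipschitz:
  fixes X :: "'a \<Rightarrow> 'w \<Rightarrow> real" and \<Phi> :: "('a \<Rightarrow> real) \<Rightarrow> real"
  assumes I: "finite I" and X: "\<And>j. j \<in> I \<Longrightarrow> X j \<in> borel_measurable M"
    and lip: "\<And>y y'. \<bar>\<Phi> y - \<Phi> y'\<bar> \<le> L2_set (\<lambda>j. y j - y' j) I"
  shows "(\<lambda>\<omega>. \<Phi> (\<lambda>j. X j \<omega>)) \<in> borel_measurable M"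
proof -
  obtain h where h: "bij_betw h {0..<card I} I" using ex_bij_betw_nat_finite[OF I] by blast
  define g where "g = inv_into {0..<card I} h"
  have hg: "j \<in> I \<Longrightarrow> h (g j) = j \<and> g j < card I" for j
    using h bij_betw_inv_into_right[OF h, of j] bij_betw_apply[OF bij_betw_inv_into[OF h], of j]
    by (auto simp: g_def)
  define \<Psi> where "\<Psi> z = \<Phi> (\<lambda>j. z (g j))" for z :: "nat \<Rightarrow> real"
  have "(\<Psi> \<longlongrightarrow> \<Psi> z) (at z)" for z
  proof -
    have "continuous_on UNIV (\<lambda>z'::nat \<Rightarrow> real. L2_set (\<lambda>j. z' (g j) - z (g j)) I)"
      unfolding L2_set_def by (auto intro!: continuous_intros continuous_on_product_coordinates)
    then have "((\<lambda>z'. L2_set (\<lambda>j. z' (g j) - z (g j)) I) \<longlongrightarrow> L2_set (\<lambda>j. z (g j) - z (g j)) I) (at z)"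
      unfolding continuous_on_def by blast
    then have "((\<lambda>z'. L2_set (\<lambda>j. z' (g j) - z (g j)) I) \<longlongrightarrow> 0) (at z)" by (simp add: L2_set_def)
    then have "((\<lambda>z'. \<Psi> z' - \<Psi> z) \<longlongrightarrow> 0) (at z)"
      by (rule Lim_null_comparison[rotated]) (auto simp: \<Psi>_def intro!: always_eventually lip)
    then show ?thesis by (rule LIM_zero_cancel)
  qed
  then have "continuous_on UNIV \<Psi>" by (simp add: continuous_on_def)
  then have \<Psi>: "\<Psi> \<in> borel_measurable borel" by (rule borel_measurable_continuous_onI)
  define X' where "X' n = (if n < card I then X (h n) else (\<lambda>_. 0))" for n
  have "X' n \<in> borel_measurable M" for n
    using X bij_betw_apply[OF h, of n] by (auto simp: X'_def)
  then have "(\<lambda>\<omega> n. X' n \<omega>) \<in> measurable M borel"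
    by (intro measurable_coordinatewise_then_product) auto
  then have "(\<lambda>\<omega>. \<Psi> (\<lambda>n. X' n \<omega>)) \<in> borel_measurable M"
    using measurable_compose[OF _ \<Psi>] by blast
  moreover have "\<Psi> (\<lambda>n. X' n \<omega>) = \<Phi> (\<lambda>j. X j \<omega>)" for \<omega>
  proof -
    have "L2_set (\<lambda>j. X' (g j) \<omega> - X j \<omega>) I = 0"
      using hg by (simp add: L2_set_eq_0_iff I X'_def)
    then show ?thesis using lip[of "\<lambda>j. X' (g j) \<omega>" "\<lambda>j. X j \<omega>"] by (simp add: \<Psi>_def)
  qed
  ultimately show ?thesis by simp
qed

lemma estimator_error_measurable:
  assumes N: "N \<ge> 1" and lam: "lam \<ge> 0" and \<epsilon>: "\<And>j. j \<in> cube d N \<Longrightarrow> \<epsilon> j \<in> borel_measurable M"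
  shows "(\<lambda>\<omega>. cube_norm d N (\<lambda>j. cube_estimator d N k lam (\<lambda>i. f0 i + \<epsilon> i \<omega>) j - a j)) \<in> borel_measurable M"
proof -
  let ?I = "cube d N" and ?e = "cube_estimator d N k lam"
  have "(\<lambda>\<omega>. (\<lambda>Y. cube_norm d N (\<lambda>j. ?e Y j - a j)) (\<lambda>j. f0 j + \<epsilon> j \<omega>)) \<in> borel_measurable M"
  proof (rule borel_measurable_lipschitz[where I = ?I and \<Phi> = "\<lambda>Y. cube_norm d N (\<lambda>j. ?e Y j - a j)"
        and X = "\<lambda>j \<omega>. f0 j + \<epsilon> j \<omega>"])
    fix Y Y' :: "(nat \<Rightarrow> nat) \<Rightarrow> real"
    have tri: "L2_set u ?I \<le> L2_set v ?I + L2_set (\<lambda>j. u j - v j) ?I" for u v :: "(nat \<Rightarrow> nat) \<Rightarrow> real"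
      using L2_set_triangle_ineq[of v "\<lambda>j. u j - v j" ?I] by simp
    have sym: "L2_set (\<lambda>j. v j - u j) ?I = L2_set (\<lambda>j. u j - v j) ?I" for u v :: "(nat \<Rightarrow> nat) \<Rightarrow> real"
      by (simp add: L2_set_def power2_commute)
    have "\<bar>L2_set (\<lambda>j. ?e Y j - a j) ?I - L2_set (\<lambda>j. ?e Y' j - a j) ?I\<bar> \<le> L2_set (\<lambda>j. ?e Y j - ?e Y' j) ?I"
      using tri[of "\<lambda>j. ?e Y j - a j" "\<lambda>j. ?e Y' j - a j"] tri[of "\<lambda>j. ?e Y' j - a j" "\<lambda>j. ?e Y j - a j"]
        sym[of "?e Y" "?e Y'"] by simp
    also have "\<dots> \<le> L2_set (\<lambda>j. Y j - Y' j) ?I"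
      using estimator_lipschitz[OF N lam, of d k Y Y'] by (simp add: L2_set_def ip_def power2_eq_square)
    finally show "\<bar>cube_norm d N (\<lambda>j. ?e Y j - a j) - cube_norm d N (\<lambda>j. ?e Y' j - a j)\<bar> \<le> L2_set (\<lambda>j. Y j - Y' j) ?I"
      by (simp add: tnorm_def)
  qed (use \<epsilon> in auto)
  then show ?thesis by simp
qed

section \<open>The deterministic bound\<close>

lemma total_diff_sum:
  assumes "j \<in> diff_cube d N k"
  shows "cube_diff d N k (\<lambda>x. \<Sum>a\<in>A. c a * f a x) j = (\<Sum>a\<in>A. c a * cube_diff d N k (f a) j)"
  unfolding total_diff_eq[OF assms] sum_distrib_left
  by (subst sum.swap) (simp add: mult_ac)

lemma proj_perp_sum:
  "perp_proj d N k (\<lambda>x. \<Sum>a\<in>A. c a * f a x) = (\<lambda>x. \<Sum>a\<in>A. c a * perp_proj d N k (f a) x)"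
proof (rule proj_perp_unique)
  show "(\<lambda>x. \<Sum>a\<in>A. c a * perp_proj d N k (f a) x) \<in> perp_space d N k"
    by (intro fsubspace_sum[OF fsubspace_null_perp] fsubspace_scale[OF fsubspace_null_perp] proj_perp_in)
qed (simp add: ip_sum_left ip_scale_left ip_proj_perp del: One_nat_def)

definition atom :: "nat \<Rightarrow> nat \<Rightarrow> nat \<Rightarrow> (nat \<Rightarrow> nat) \<Rightarrow> (nat \<Rightarrow> nat) \<Rightarrow> real" where
  "atom d N k j = perp_proj d N k (\<lambda>x. \<Prod>i=1..d. dict k N (j i) (x i))"

text \<open>By biorthogonality, the combination of the unprojected dictionary tensors with
  coefficients \<open>cube_diff d N k h j\<close> has the differences of \<open>h\<close>, so its
  projection is \<open>h\<close>.\<close>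

lemma null_perp_atom_expansion:
  assumes "k \<ge> 1" and h: "h \<in> perp_space d N k"
  shows "h = (\<lambda>x. \<Sum>j\<in>diff_cube d N k. cube_diff d N k h j * atom d N k j x)"
proof -
  let ?J = "diff_cube d N k" and ?D = "cube_diff d N k"
  let ?\<phi> = "\<lambda>j x. \<Prod>i=1..d. dict k N (j i) (x i)"
  have "?D (\<lambda>x. \<Sum>j\<in>?J. ?D h j * ?\<phi> j x) j' = ?D h j'" if j': "j' \<in> ?J" for j'
  proof -
    have "?D (\<lambda>x. \<Sum>j\<in>?J. ?D h j * ?\<phi> j x) j' = (\<Sum>j\<in>?J. ?D h j * ?D (?\<phi> j) j')"
      by (rule total_diff_sum[OF j'])
    also have "\<dots> = (\<Sum>j\<in>?J. if j = j' then ?D h j' else 0)"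
      using total_diff_dict[OF assms(1) j'] by (intro sum.cong) auto
    finally show ?thesis using j' by simp
  qed
  then have "perp_proj d N k (\<lambda>x. \<Sum>j\<in>?J. ?D h j * ?\<phi> j x) = h"
    by (rule null_perp_eq_iff_total_diff[OF h])
  then show ?thesis by (simp add: proj_perp_sum atom_def)
qed

lemma abs_sum_mult_le:
  fixes a b :: "'a \<Rightarrow> real"
  assumes "(\<Sum>e\<in>E. (a e)\<^sup>2) \<le> A" "(\<Sum>e\<in>E. (b e)\<^sup>2) \<le> B"
  shows "\<bar>\<Sum>e\<in>E. a e * b e\<bar> \<le> sqrt A * sqrt B"
proof -
  have "\<bar>\<Sum>e\<in>E. a e * b e\<bar> \<le> sqrt (\<Sum>e\<in>E. (a e)\<^sup>2) * sqrt (\<Sum>e\<in>E. (b e)\<^sup>2)"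
    using ip_Cauchy_Schwarz[of E a b] by (simp add: ip_def power2_eq_square)
  also have "\<dots> \<le> sqrt A * sqrt B"
    using assms by (intro mult_mono real_sqrt_le_mono real_sqrt_ge_zero)
      (auto intro: sum_nonneg order_trans[OF sum_nonneg assms(1)])
  finally show ?thesis .
qed

definition risk_bound :: "nat \<Rightarrow> nat \<Rightarrow> nat \<Rightarrow> real \<Rightarrow> (nat \<Rightarrow> nat) set \<Rightarrow>
    ((nat \<Rightarrow> nat) \<Rightarrow> real) \<Rightarrow> ((nat \<Rightarrow> nat) \<Rightarrow> real) \<Rightarrow> real \<Rightarrow> ((nat \<Rightarrow> nat) \<Rightarrow> real) \<Rightarrow> bool" where
  "risk_bound d N k lam S f0 g r e \<longleftrightarrow>
    (cube_norm d N (\<lambda>j. cube_estimator d N k lam (\<lambda>i. f0 i + e i) j - perp_proj d N k f0 j))\<^sup>2 / real (N ^ d)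
    \<le> (cube_norm d N (\<lambda>j. g j - perp_proj d N k f0 j))\<^sup>2 / real (N ^ d)
      + 4 * lam * (\<Sum>j\<in>diff_cube d N k - S. \<bar>cube_diff d N k g j\<bar>)
      + r"

lemma risk_bound_mono: "risk_bound d N k lam S f0 g r e \<Longrightarrow> r \<le> r' \<Longrightarrow> risk_bound d N k lam S f0 g r' e"
  by (simp add: risk_bound_def)

text \<open>Randomness is replaced by hypotheses on one realisation \<open>e\<close>:
  \<open>A\<close> controls the noise inside the span of \<open>E\<close>, \<open>v\<close> the
  noise along the residual atoms, and \<open>\<Gamma>\<close> is the squared norm allowed to the
  transposed interpolant.\<close>

lemma penalized_risk_bound:
  fixes e f0 g v :: "(nat \<Rightarrow> nat) \<Rightarrow> real"
  assumes k: "k \<ge> 1" and N: "N \<ge> 1" and lam: "lam > 0" and SJ: "S \<subseteq> diff_cube d N k"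
    and E: "orthonormal (cube d N) E"
    and eE: "(\<Sum>b\<in>E. (ip (cube d N) e b)\<^sup>2) \<le> A"
    and ez: "\<And>j. j \<in> diff_cube d N k \<Longrightarrow>
        \<bar>ip (cube d N) e (\<lambda>x. atom d N k j x - proj (cube d N) E (atom d N k j) x)\<bar>
          \<le> real (N ^ d) * lam * v j"
    and vS: "\<And>j. j \<in> S \<Longrightarrow> v j \<le> 0"
    and interp: "\<And>q. (\<And>j. \<bar>q j\<bar> \<le> 1) \<Longrightarrow> \<exists>w. (\<forall>j\<in>S. w j = q j) \<and>
        (\<forall>j\<in>diff_cube d N k - S. \<bar>w j\<bar> \<le> 1 - v j) \<and>
        ip (cube d N) (\<lambda>y. \<Sum>j\<in>diff_cube d N k. w j * (\<Prod>i=1..d. dcoef k N (j i) (y i)))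
          (\<lambda>y. \<Sum>j\<in>diff_cube d N k. w j * (\<Prod>i=1..d. dcoef k N (j i) (y i))) \<le> \<Gamma>"
  shows "risk_bound d N k lam S f0 g (2 * A / real (N ^ d) + 2 * real (N ^ d) * lam\<^sup>2 * \<Gamma>) e"
proof -
  let ?I = "cube d N" and ?J = "diff_cube d N k" and ?V = "perp_space d N k"
  let ?D = "cube_diff d N k" and ?P = "perp_proj d N k" and ?TV = "cube_TV d N k"
  define n where "n = real (N ^ d)"
  have n: "n > 0" using N by (simp add: n_def)
  define Y where "Y i = f0 i + e i" for i
  define fh where "fh = cube_estimator d N k lam Y"
  define p where "p = ?P f0"
  define gp where "gp = ?P g"
  define h where "h j = fh j - gp j" for j
  have fh: "fh \<in> ?V" unfolding fh_def by (rule estimator_in[OF N]) (use lam in simp)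
  have gp: "gp \<in> ?V" and p: "p \<in> ?V" unfolding gp_def p_def by (rule proj_perp_in)+
  have h: "h \<in> ?V" unfolding h_def by (rule fsubspace_diff[OF fsubspace_null_perp fh gp])
  have Dh: "?D h j = ?D fh j - ?D g j" if "j \<in> ?J" for j
    using total_diff_diff[OF that, of fh gp] total_diff_proj_perp[OF that, of g]
    by (simp add: h_def[abs_def] gp_def)
  have PY: "?P Y = (\<lambda>j. p j + ?P e j)" unfolding Y_def p_def by (rule proj_perp_add)
  \<comment> \<open>The term quadratic in the noise does not depend on \<open>f\<close> and cancels
    when two values of the objective are compared.\<close>
  have quad: "ip ?I (\<lambda>j. ?P Y j - f j) (\<lambda>j. ?P Y j - f j)
      = ip ?I (\<lambda>j. f j - p j) (\<lambda>j. f j - p j) + 2 * (ip ?I (?P e) p - ip ?I (?P e) f) + ip ?I (?P e) (?P e)" for f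
  proof -
    have "ip ?I (\<lambda>j. ?P Y j - f j) (\<lambda>j. ?P Y j - f j)
       = (\<Sum>j\<in>?I. (f j - p j) * (f j - p j) + 2 * (?P e j * p j - ?P e j * f j) + ?P e j * ?P e j)"
      unfolding PY ip_def by (intro sum.cong refl) (simp add: algebra_simps)
    then show ?thesis by (simp add: ip_def sum.distrib sum_subtractf sum_distrib_left)
  qed
  let ?Q = "\<lambda>f. ip ?I (\<lambda>j. f j - p j) (\<lambda>j. f j - p j)"
  have basic: "?Q fh + ip ?I h h \<le> ?Q gp + 2 * ip ?I e h + 2 * (n * lam) * (?TV gp - ?TV fh)"
  proof -
    have "ip ?I (\<lambda>j. ?P Y j - fh j) (\<lambda>j. ?P Y j - fh j) / n + 2 * lam * ?TV fh + ip ?I h h / n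
        \<le> ip ?I (\<lambda>j. ?P Y j - gp j) (\<lambda>j. ?P Y j - gp j) / n + 2 * lam * ?TV gp"
      using estimator_strong_convexity[OF N _ gp, of lam Y] lam
      unfolding fh_def[symmetric] objective_eq[OF fh] objective_eq[OF gp] n_def[symmetric] h_def[abs_def] by simp
    then have "n * (ip ?I (\<lambda>j. ?P Y j - fh j) (\<lambda>j. ?P Y j - fh j) / n + 2 * lam * ?TV fh + ip ?I h h / n)
        \<le> n * (ip ?I (\<lambda>j. ?P Y j - gp j) (\<lambda>j. ?P Y j - gp j) / n + 2 * lam * ?TV gp)"
      using n by (intro mult_left_mono) auto
    moreover have "ip ?I (?P e) fh - ip ?I (?P e) gp = ip ?I e h"
      using ip_proj_perp[OF h, of e] by (simp add: h_def[abs_def] ip_diff_right)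
    moreover have "n * (a / n + 2 * lam * t + b / n) = a + 2 * (n * lam) * t + b"
      "n * (a / n + 2 * lam * t) = a + 2 * (n * lam) * t" for a t b
      using n by (simp_all add: distrib_left)
    ultimately show ?thesis unfolding quad right_diff_distrib by simp
  qed
  \<comment> \<open>\<open>g\<close> may have a component in the null space; its projection has the
    same differences and is no farther from \<open>p\<close>.\<close>
  have gp_le: "?Q gp \<le> ip ?I (\<lambda>j. g j - p j) (\<lambda>j. g j - p j)"
    using ip_proj_perp_self_le[of d N k "\<lambda>j. g j - p j"] unfolding proj_perp_diff[OF p] gp_def .
  let ?dh = "\<lambda>j. \<bar>?D h j\<bar>"
  \<comment> \<open>On \<open>S\<close> this is the reverse triangle inequality. Off
    \<open>S\<close> the bound 2 \<bar>D g\<bar> - \<bar>D h\<bar> keeps a negative term, which has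
    to pay for the noise.\<close>
  have TV: "?TV gp - ?TV fh \<le> (\<Sum>j\<in>?J. if j \<in> S then ?dh j else - ?dh j) + 2 * (\<Sum>j\<in>?J - S. \<bar>?D g j\<bar>)"
  proof -
    have "?TV gp - ?TV fh = (\<Sum>j\<in>?J. \<bar>?D g j\<bar> - \<bar>?D fh j\<bar>)"
      unfolding TV_def sum_subtractf gp_def using total_diff_proj_perp by (auto intro!: arg_cong2[where f="(-)"] sum.cong)
    also have "\<dots> \<le> (\<Sum>j\<in>?J. (if j \<in> S then ?dh j else - ?dh j) + (if j \<in> S then 0 else 2 * \<bar>?D g j\<bar>))"
      using Dh by (intro sum_mono) auto
    also have "\<dots> = (\<Sum>j\<in>?J. if j \<in> S then ?dh j else - ?dh j) + (\<Sum>j\<in>?J - S. 2 * \<bar>?D g j\<bar>)"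
      unfolding sum.distrib by (intro arg_cong2[where f="(+)"] refl sum.mono_neutral_cong_right) auto
    finally show ?thesis by (simp add: sum_distrib_left)
  qed
  let ?hn = "sqrt (ip ?I h h)"
  have noise: "ip ?I e h \<le> sqrt A * ?hn + n * lam * (\<Sum>j\<in>?J. v j * ?dh j)"
  proof -
    let ?z = "\<lambda>j x. atom d N k j x - proj ?I E (atom d N k j) x"
    have hx: "h x - proj ?I E h x = (\<Sum>j\<in>?J. ?D h j * ?z j x)" for x
    proof -
      have "h x - proj ?I E h x = (\<Sum>j\<in>?J. ?D h j * atom d N k j x)
          - proj ?I E (\<lambda>x. \<Sum>j\<in>?J. ?D h j * atom d N k j x) x"
        by (rule arg_cong[OF null_perp_atom_expansion[OF k h], of "\<lambda>u. u x - proj ?I E u x"])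
      also have "\<dots> = (\<Sum>j\<in>?J. ?D h j * atom d N k j x) - (\<Sum>j\<in>?J. ?D h j * proj ?I E (atom d N k j) x)"
        by (simp only: proj_sum proj_scale)
      finally show ?thesis by (simp only: right_diff_distrib sum_subtractf)
    qed
    have "ip ?I e h = ip ?I e (proj ?I E h) + ip ?I e (\<lambda>x. h x - proj ?I E h x)"
      by (simp add: ip_diff_right)
    moreover have "ip ?I e (\<lambda>x. h x - proj ?I E h x) = (\<Sum>j\<in>?J. ?D h j * ip ?I e (?z j))"
      unfolding hx ip_sum_right ip_scale_right by (rule refl)
    moreover have "(\<Sum>j\<in>?J. ?D h j * ip ?I e (?z j)) \<le> (\<Sum>j\<in>?J. ?dh j * (n * lam * v j))"
    proof (intro sum_mono)
      fix j assume j: "j \<in> ?J"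
      have "?D h j * ip ?I e (?z j) \<le> \<bar>?D h j * ip ?I e (?z j)\<bar>" by (rule abs_ge_self)
      also have "\<dots> = ?dh j * \<bar>ip ?I e (?z j)\<bar>" by (rule abs_mult)
      also have "\<dots> \<le> ?dh j * (n * lam * v j)" using ez[OF j] by (intro mult_left_mono) (auto simp: n_def)
      finally show "?D h j * ip ?I e (?z j) \<le> ?dh j * (n * lam * v j)" .
    qed
    moreover have "(\<Sum>j\<in>?J. ?dh j * (n * lam * v j)) = n * lam * (\<Sum>j\<in>?J. v j * ?dh j)"
      unfolding sum_distrib_left by (intro sum.cong refl) simp
    moreover have "ip ?I e (proj ?I E h) \<le> sqrt A * ?hn"
    proof -
      have "ip ?I e (proj ?I E h) = (\<Sum>b\<in>E. ip ?I e b * ip ?I h b)"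
        unfolding ip_proj_right by (simp only: mult.commute)
      then show ?thesis using abs_sum_mult_le[OF eE bessel[OF E, of h]] by simp
    qed
    ultimately show ?thesis by linarith
  qed
  \<comment> \<open>Only \<open>\<bar>q j\<bar> \<le> 1\<close> is demanded of the prescribed
    values, so the sign function with \<open>sgn 0 = 0\<close> is admissible.\<close>
  obtain w where w: "\<And>j. j \<in> S \<Longrightarrow> w j = sgn (?D h j)" "\<And>j. j \<in> ?J - S \<Longrightarrow> \<bar>w j\<bar> \<le> 1 - v j"
    "ip ?I (\<lambda>y. \<Sum>j\<in>?J. w j * (\<Prod>i=1..d. dcoef k N (j i) (y i)))
          (\<lambda>y. \<Sum>j\<in>?J. w j * (\<Prod>i=1..d. dcoef k N (j i) (y i))) \<le> \<Gamma>"
    using interp[of "\<lambda>j. sgn (?D h j)"] by (auto simp: abs_sgn_eq)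
  have sparse: "(\<Sum>j\<in>?J. if j \<in> S then ?dh j else - ?dh j) + (\<Sum>j\<in>?J. v j * ?dh j) \<le> sqrt \<Gamma> * ?hn"
  proof -
    let ?Dw = "\<lambda>y. \<Sum>j\<in>?J. w j * (\<Prod>i=1..d. dcoef k N (j i) (y i))"
    have "(\<Sum>j\<in>?J. if j \<in> S then ?dh j else - ?dh j) + (\<Sum>j\<in>?J. v j * ?dh j) \<le> (\<Sum>j\<in>?J. w j * ?D h j)"
      unfolding sum.distrib[symmetric]
    proof (intro sum_mono)
      fix j assume j: "j \<in> ?J"
      show "(if j \<in> S then ?dh j else - ?dh j) + v j * ?dh j \<le> w j * ?D h j"
      proof (cases "j \<in> S")
        case True
        have "v j * ?dh j \<le> 0" using vS[OF True] by (intro mult_nonpos_nonneg) auto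
        moreover have "w j * ?D h j = ?dh j" using w(1)[OF True] by (simp add: abs_sgn mult.commute)
        ultimately show ?thesis using True by simp
      next
        case False
        have "\<bar>w j\<bar> * ?dh j \<le> (1 - v j) * ?dh j" using w(2)[of j] j False by (intro mult_right_mono) auto
        moreover have "- (\<bar>w j\<bar> * ?dh j) \<le> w j * ?D h j" by (metis abs_ge_minus_self abs_mult minus_le_iff)
        ultimately show ?thesis using False by (simp add: algebra_simps)
      qed
    qed
    also have "\<dots> = ip ?I ?Dw h"
    proof -
      have "(\<Sum>j\<in>?J. w j * ?D h j) = (\<Sum>j\<in>?J. \<Sum>y\<in>?I. w j * (\<Prod>i=1..d. dcoef k N (j i) (y i)) * h y)"
        by (intro sum.cong refl) (simp add: total_diff_eq sum_distrib_left mult_ac)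
      also have "\<dots> = ip ?I ?Dw h" unfolding ip_def sum_distrib_right by (rule sum.swap)
      finally show ?thesis .
    qed
    also have "\<dots> \<le> sqrt (ip ?I ?Dw ?Dw) * ?hn" using ip_Cauchy_Schwarz[of ?I ?Dw h] by simp
    also have "\<dots> \<le> sqrt \<Gamma> * ?hn" using w(3) by (intro mult_right_mono) (auto simp: ip_self_nonneg)
    finally show ?thesis .
  qed
  have \<Gamma>0: "\<Gamma> \<ge> 0" using w(3) ip_self_nonneg order_trans by blast
  have A0: "A \<ge> 0" using eE sum_nonneg[of E "\<lambda>b. (ip ?I e b)\<^sup>2"] by simp
  let ?G = "\<Sum>j\<in>?J - S. \<bar>?D g j\<bar>"
  have "?Q fh + ip ?I h h \<le> ip ?I (\<lambda>j. g j - p j) (\<lambda>j. g j - p j) + 2 * (sqrt A * ?hn)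
      + 2 * (n * lam) * (sqrt \<Gamma> * ?hn) + 2 * (n * lam) * (2 * ?G)"
  proof -
    have nl: "0 \<le> 2 * (n * lam)" using n lam by simp
    have "2 * (n * lam) * (?TV gp - ?TV fh) + 2 * (n * lam * (\<Sum>j\<in>?J. v j * ?dh j))
        = 2 * (n * lam) * ((?TV gp - ?TV fh) + (\<Sum>j\<in>?J. v j * ?dh j))" by (simp add: algebra_simps)
    also have "\<dots> \<le> 2 * (n * lam) * (sqrt \<Gamma> * ?hn + 2 * ?G)"
      using TV sparse by (intro mult_left_mono nl) simp
    finally show ?thesis using basic gp_le noise by (simp add: distrib_left)
  qed
  moreover have "2 * (sqrt A * ?hn) + 2 * (n * lam) * (sqrt \<Gamma> * ?hn) - ?hn\<^sup>2 \<le> 2 * A + 2 * n\<^sup>2 * lam\<^sup>2 * \<Gamma>"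
  proof -
    \<comment> \<open>The two terms linear in the norm of \<open>h\<close> are absorbed by the
      quadratic gain from strong convexity; the second square disposes of the mixed product of
      \<open>sqrt A\<close> and \<open>sqrt \<Gamma>\<close>, which is the origin of the factors
      2.\<close>
    have "0 \<le> (sqrt A + n * lam * sqrt \<Gamma> - ?hn)\<^sup>2 + (sqrt A - n * lam * sqrt \<Gamma>)\<^sup>2" by simp
    also have "\<dots> = 2 * (sqrt A)\<^sup>2 + 2 * (n * lam)\<^sup>2 * (sqrt \<Gamma>)\<^sup>2 - 2 * (sqrt A * ?hn) - 2 * (n * lam) * (sqrt \<Gamma> * ?hn) + ?hn\<^sup>2"
      by (simp add: power2_eq_square algebra_simps)
    finally show ?thesis using A0 \<Gamma>0 by (simp add: power_mult_distrib)
  qed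
  moreover have "?hn\<^sup>2 = ip ?I h h" by (simp add: ip_self_nonneg)
  ultimately have "?Q fh \<le> ip ?I (\<lambda>j. g j - p j) (\<lambda>j. g j - p j) + 2 * A + 2 * n\<^sup>2 * lam\<^sup>2 * \<Gamma> + 2 * (n * lam) * (2 * ?G)"
    by linarith
  then have "?Q fh / n \<le> (ip ?I (\<lambda>j. g j - p j) (\<lambda>j. g j - p j) + 2 * A + 2 * n\<^sup>2 * lam\<^sup>2 * \<Gamma> + 2 * (n * lam) * (2 * ?G)) / n"
    using n by (intro divide_right_mono) auto
  also have "\<dots> = ip ?I (\<lambda>j. g j - p j) (\<lambda>j. g j - p j) / n + 4 * lam * ?G + (2 * A / n + 2 * n * lam\<^sup>2 * \<Gamma>)"
    using n by (simp add: field_simps power2_eq_square)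
  finally show ?thesis unfolding risk_bound_def tnorm_sq_eq_ip n_def fh_def Y_def[abs_def] p_def .
qed

section \<open>Geometry of the grid\<close>

lemma hyperrect_fun_upd:
  assumes "t \<in> hyperrect d lo hi" "i \<in> {1..d}" "lo i \<le> y" "y \<le> hi i"
  shows "t(i := y) \<in> hyperrect d lo hi"
  unfolding hyperrect_def
proof (rule PiE_I)
  fix i' assume "i' \<in> {1..d}"
  then show "(t(i := y)) i' \<in> {lo i'..hi i'}"
    using PiE_mem[OF assms(1)[unfolded hyperrect_def]] assms by (cases "i' = i") auto
next
  fix i' assume "i' \<notin> {1..d}"
  then show "(t(i := y)) i' = undefined"
    using PiE_arb[OF assms(1)[unfolded hyperrect_def]] assms(2) by (cases "i' = i") auto
qed

text \<open>The covering by hyperrectangles is turned into gaps between the knots of one coordinate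
  and margins at the boundary. As \<open>S\<close> is a product, both can be read off grid points
  obtained from a fixed \<open>s0\<close> by changing one coordinate.\<close>

lemma regular_grid_facts:
  fixes S :: "(nat \<Rightarrow> nat) set"
  assumes grid: "regular_grid d N k c1 c2 \<delta> S" and d: "d \<ge> 1" and k: "k \<ge> 1"
  shows "\<exists>T m. S = PiE {1..d} T \<and> m \<ge> 1 \<and> card S = m ^ d \<and> (\<forall>i\<in>{1..d}. finite (T i) \<and> card (T i) = m) \<and>
    (\<forall>i\<in>{1..d}. \<forall>t\<in>T i. \<forall>t'\<in>T i. t \<noteq> t' \<longrightarrow>
      c1 * (real N / real m) < \<bar>real t - real t'\<bar> \<and> real (k * (k + 2)) + 1 \<le> \<bar>real t - real t'\<bar>) \<and>
    (\<forall>i\<in>{1..d}. \<forall>t\<in>T i.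
      real (k + 1) + c1 * (real N / real m) \<le> real t \<and> real (k + 1) + real (k * (k + 2)) \<le> real t \<and>
      real t + c1 * (real N / real m) \<le> real N \<and> real t + real (k * (k + 2)) \<le> real N)"
proof -
  note g = grid[unfolded regular_grid_def]
  have ne: "S \<noteq> {}" by (rule conjunct1[OF g])
  from conjunct1[OF conjunct2[OF g]]
  obtain T where T0: "S = PiE {1..d} T \<and> (\<forall>i\<in>{1..d}. finite (T i) \<and> card (T i) ^ d = card S \<and> equispaced \<delta> (T i))"
    by (elim exE)
  then have T: "S = PiE {1..d} T" "\<And>i. i \<in> {1..d} \<Longrightarrow> finite (T i) \<and> card (T i) ^ d = card S"
    by blast+
  define L where "L = real N * real (card S) powr (- 1 / real d)"
  from conjunct2[OF conjunct2[OF g]] obtain lo hi where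
    LH: "(\<Union>t\<in>S. hyperrect d (lo t) (hi t)) = diff_cube d N k \<and>
        (\<forall>t\<in>S. \<forall>t'\<in>S. t \<noteq> t' \<longrightarrow>
           hyperrect d (lo t) (hi t) \<inter> hyperrect_interior d (lo t') (hi t') = {}) \<and>
        (\<forall>t\<in>S. hyperrect d t (\<lambda>i. t i + k - 1) \<subseteq> hyperrect_interior d (lo t) (hi t)) \<and>
        (\<forall>t\<in>S. \<forall>i\<in>{1..d}.
            real (k * (k + 2)) \<le> real (t i) - real (lo t i) \<and>
            real (k * (k + 2)) \<le> real (hi t i) - real (t i) - real k + 1 \<and>
            c1 * L \<le> real (t i) - real (lo t i) \<and> real (t i) - real (lo t i) \<le> c2 * L \<and>
            c1 * L \<le> real (hi t i) - real (t i) - real k + 1 \<and> real (hi t i) - real (t i) - real k + 1 \<le> c2 * L)"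
    unfolding Let_def L_def[symmetric] by (elim exE)
  note un = conjunct1[OF LH] and LH2 = conjunct2[OF LH]
  have disj: "hyperrect d (lo t) (hi t) \<inter> hyperrect_interior d (lo t') (hi t') = {}"
    if "t \<in> S" "t' \<in> S" "t \<noteq> t'" for t t'
    using conjunct1[OF LH2] that by blast
  have block: "hyperrect d t (\<lambda>i. t i + k - 1) \<subseteq> hyperrect_interior d (lo t) (hi t)" if "t \<in> S" for t
    using conjunct1[OF conjunct2[OF LH2]] that by blast
  have dist: "real (k * (k + 2)) \<le> real (t i) - real (lo t i) \<and> real (k * (k + 2)) \<le> real (hi t i) - real (t i) - real k + 1 \<and>
       c1 * L \<le> real (t i) - real (lo t i) \<and> c1 * L \<le> real (hi t i) - real (t i) - real k + 1"
    if "t \<in> S" "i \<in> {1..d}" for t i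
    using conjunct2[OF conjunct2[OF LH2]] that by blast
  define m where "m = card (T 1)"
  have d1: "1 \<in> {1..d}" using d by simp
  have cardT: "card (T i) = m" if "i \<in> {1..d}" for i
  proof -
    have "card (T i) ^ d = card (T 1) ^ d" using T(2)[OF that] T(2)[OF d1] by simp
    then show ?thesis unfolding m_def using d by (subst (asm) power_eq_iff_eq_base) auto
  qed
  obtain s0 where s0: "s0 \<in> S" using ne by blast
  then have "s0 1 \<in> T 1" unfolding T(1) by (rule PiE_mem[OF _ d1])
  then have m: "m \<ge> 1" unfolding m_def using T(2)[OF d1] by (metis One_nat_def Suc_leI card_gt_0_iff empty_iff)
  have cardS: "card S = m ^ d" using T(2)[OF d1] by (simp add: m_def)
  have "real (card S) powr (- 1 / real d) = real m powr - 1"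
  proof -
    have "real (card S) = real m powr real d" using m by (simp add: cardS powr_realpow)
    then show ?thesis using d by (simp add: powr_powr)
  qed
  also have "real m powr - 1 = 1 / real m" using m by (simp add: powr_minus_divide)
  finally have L: "L = real N / real m" unfolding L_def by simp
  have upd: "s0(i := t) \<in> S" if "i \<in> {1..d}" "t \<in> T i" for i t
    using s0 that unfolding T(1) by (auto simp: PiE_iff extensional_def)
  have self: "t \<in> hyperrect_interior d (lo t) (hi t)" if "t \<in> S" for t
  proof -
    have "t \<in> hyperrect d t (\<lambda>i. t i + k - 1)"
      using that k unfolding T(1) hyperrect_def by (auto simp: PiE_iff)
    then show ?thesis using block[OF that] by blast
  qed
  then have self': "t \<in> hyperrect d (lo t) (hi t)" if "t \<in> S" for t
    using that by (force simp: hyperrect_def hyperrect_interior_def PiE_iff)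
  \<comment> \<open>Replacing one coordinate of \<open>t\<close> by that of a corner stays inside
    the hyperrectangle, hence inside the index set that the hyperrectangles cover.\<close>
  have rng: "k + 1 \<le> lo t i \<and> hi t i \<le> N" if t: "t \<in> S" and i: "i \<in> {1..d}" for t i
  proof -
    have loc: "lo t i \<le> t i" "t i \<le> hi t i" using self'[OF t] i by (auto simp: hyperrect_def PiE_iff)
    then have lohi: "lo t i \<le> hi t i" by (rule order_trans)
    have "t(i := lo t i) \<in> hyperrect d (lo t) (hi t)" "t(i := hi t i) \<in> hyperrect d (lo t) (hi t)"
      using lohi by (auto intro!: hyperrect_fun_upd[OF self'[OF t] i])
    then have "t(i := lo t i) \<in> diff_cube d N k" "t(i := hi t i) \<in> diff_cube d N k"
      using t un by blast+
    note in_idx = this[unfolded idx_def]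
    show ?thesis using PiE_mem[OF in_idx(1) i] PiE_mem[OF in_idx(2) i] by simp
  qed
  have far: "c1 * (real N / real m) < \<bar>real t - real t'\<bar> \<and> real (k * (k + 2)) + 1 \<le> \<bar>real t - real t'\<bar>"
    if i: "i \<in> {1..d}" and t: "t \<in> T i" "t' \<in> T i" "t \<noteq> t'" for i t t'
  proof -
    let ?s = "s0(i := t)" and ?s' = "s0(i := t')"
    have s: "?s \<in> S" "?s' \<in> S" "?s \<noteq> ?s'" using upd[OF i] t by (auto dest: fun_cong[where x = i])
    \<comment> \<open>\<open>?s'\<close> is interior to its own hyperrectangle and so avoids that of
      \<open>?s\<close>. The two points agree elsewhere, hence coordinate \<open>i\<close> must
      leave the range from \<open>lo ?s i\<close> to \<open>hi ?s i\<close>.\<close>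
    have "?s' \<notin> hyperrect d (lo ?s) (hi ?s)" using disj[OF s] self[OF s(2)] by blast
    moreover have "?s' \<in> hyperrect d (lo ?s) (hi ?s)" if t': "lo ?s i \<le> t'" "t' \<le> hi ?s i"
      using hyperrect_fun_upd[OF self'[OF s(1)] i t'] by (simp only: fun_upd_upd)
    ultimately have "t' < lo ?s i \<or> t' > hi ?s i" by (meson not_le)
    moreover note ds = dist[OF s(1) i, unfolded L fun_upd_same]
    moreover have "real k \<ge> 1" using k by simp
    ultimately show ?thesis
    proof (elim disjE)
      assume "t' < lo ?s i"
      then have "real t' + 1 \<le> real (lo ?s i)" by linarith
      then show ?thesis using ds by (intro conjI) linarith+
    next
      assume "hi ?s i < t'"
      then have "real (hi ?s i) + 1 \<le> real t'" by linarith
      then show ?thesis using ds \<open>real k \<ge> 1\<close> by (intro conjI) linarith+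
    qed
  qed
  have inner: "real (k + 1) + c1 * (real N / real m) \<le> real t \<and> real (k + 1) + real (k * (k + 2)) \<le> real t \<and>
      real t + c1 * (real N / real m) \<le> real N \<and> real t + real (k * (k + 2)) \<le> real N"
    if i: "i \<in> {1..d}" and t: "t \<in> T i" for i t
    proof -
      have "real (k + 1) \<le> real (lo (s0(i := t)) i)" "real (hi (s0(i := t)) i) \<le> real N"
        using rng[OF upd[OF i t] i] by (simp_all only: of_nat_le_iff)
      moreover have "real k \<ge> 1" using k by simp
      ultimately show ?thesis using dist[OF upd[OF i t] i, unfolded L fun_upd_same]
        by (intro conjI) linarith+
    qed
  show ?thesis
  proof (intro exI)
    show "S = PiE {1..d} T \<and> m \<ge> 1 \<and> card S = m ^ d \<and> (\<forall>i\<in>{1..d}. finite (T i) \<and> card (T i) = m) \<and>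
    (\<forall>i\<in>{1..d}. \<forall>t\<in>T i. \<forall>t'\<in>T i. t \<noteq> t' \<longrightarrow>
      c1 * (real N / real m) < \<bar>real t - real t'\<bar> \<and> real (k * (k + 2)) + 1 \<le> \<bar>real t - real t'\<bar>) \<and>
    (\<forall>i\<in>{1..d}. \<forall>t\<in>T i.
      real (k + 1) + c1 * (real N / real m) \<le> real t \<and> real (k + 1) + real (k * (k + 2)) \<le> real t \<and>
      real t + c1 * (real N / real m) \<le> real N \<and> real t + real (k * (k + 2)) \<le> real N)"
      using T(1,2) m cardS cardT far inner by blast
  qed
qed

lemma mesh_exists:
  fixes \<rho> :: real and T :: "nat set"
  assumes T: "finite T" "\<And>t. t \<in> T \<Longrightarrow> t \<le> N" and \<rho>: "\<rho> > 0"
  shows "\<exists>T'. T \<subseteq> T' \<and> finite T' \<and> (\<forall>t\<in>T'. t \<le> N) \<and> real (card T') \<le> real (card T) + 2 * real N / \<rho> + 1 \<and>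
    (\<forall>x\<le>N. \<exists>t\<in>T'. \<bar>real x - real t\<bar> \<le> \<rho>)"
proof -
  \<comment> \<open>For \<open>\<rho> < 1\<close> the step is 1 and every integer up to
    \<open>N\<close> is a mesh point. Rounding \<open>\<rho>\<close> down to an integer costs at
    most a factor 2, the one in \<open>2 * real N / \<rho>\<close>.\<close>
  define q where "q = max 1 (nat \<lfloor>\<rho>\<rfloor>)"
  have q: "q \<ge> 1" "\<rho> / 2 \<le> real q" unfolding q_def using \<rho> by linarith+
  let ?M = "(\<lambda>a. a * q) ` {..N div q}"
  have "card ?M \<le> N div q + 1" using card_image_le[of "{..N div q}" "\<lambda>a. a * q"] by simp
  then have "real (card (T \<union> ?M)) \<le> real (card T) + (real (N div q) + 1)"
    using card_Un_le[of T ?M] by linarith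
  also have "real (N div q) \<le> real N / real q" by (rule of_nat_div_le_of_nat)
  also have "real N / real q \<le> real N / (\<rho> / 2)" using q \<rho> by (intro divide_left_mono) auto
  finally have card: "real (card (T \<union> ?M)) \<le> real (card T) + 2 * real N / \<rho> + 1" by (simp add: mult.commute)
  have near: "\<exists>t\<in>T \<union> ?M. \<bar>real x - real t\<bar> \<le> \<rho>" if x: "x \<le> N" for x
  proof (intro bexI[of _ "(x div q) * q"])
    have "real x - real ((x div q) * q) = real (x mod q)"
      by (metis add_diff_cancel_left' div_mult_mod_eq of_nat_add)
    moreover have "real (x mod q) \<le> \<rho>"
    proof (cases "q = 1")
      case True
      then show ?thesis using \<rho> by simp
    next
      case False
      then have "q = nat \<lfloor>\<rho>\<rfloor>" by (simp add: q_def max_def split: if_splits)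
      moreover have "x mod q \<le> q" using q by (simp add: less_imp_le)
      ultimately show ?thesis using \<rho> by linarith
    qed
    ultimately show "\<bar>real x - real ((x div q) * q)\<bar> \<le> \<rho>" by simp
    show "(x div q) * q \<in> T \<union> ?M" using x by (auto intro: div_le_mono)
  qed
  have "t \<le> N" if t: "t \<in> ?M" for t
  proof -
    obtain a where "t = a * q" "a \<le> N div q" using t by auto
    then show ?thesis using q by (metis div_times_less_eq_dividend le_trans mult_le_mono1)
  qed
  then show ?thesis using T card near by (intro exI[of _ "T \<union> ?M"]) auto
qed

text \<open>The generating products only, not their span: orthonormalising their projections gives
  the space removed from the atoms, so its dimension is at most their number.\<close>

definition spline_space :: "nat \<Rightarrow> nat \<Rightarrow> (nat \<Rightarrow> nat set) \<Rightarrow> ((nat \<Rightarrow> nat) \<Rightarrow> real) set" where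
  "spline_space d k T = (\<lambda>(t, \<rho>) x. \<Prod>i=1..d. tpow (t i) (\<rho> i) (x i)) `
     (PiE {1..d} T \<times> PiE {1..d} (\<lambda>_. {..<k}))"

lemma spline_space_finite:
  assumes "\<And>i. i \<in> {1..d} \<Longrightarrow> finite (T i)"
  shows "finite (spline_space d k T)" "card (spline_space d k T) \<le> (\<Prod>i=1..d. card (T i)) * k ^ d"
proof -
  have fin: "finite (PiE {1..d} T \<times> PiE {1..d} (\<lambda>_. {..<k}))" using assms by (intro finite_cartesian_product finite_PiE) auto
  then show "finite (spline_space d k T)" by (simp add: spline_space_def)
  show "card (spline_space d k T) \<le> (\<Prod>i=1..d. card (T i)) * k ^ d"
    unfolding spline_space_def using card_image_le[OF fin] by (simp add: card_cartesian_product card_PiE)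
qed

text \<open>The projected approximant from \<open>dict_approx_tensor\<close> is reproduced by
  \<open>E\<close>, so the residual of the atom equals that of the projected approximation error;
  neither projection can increase the norm.\<close>

lemma atom_residual_le:
  assumes k: "k \<ge> 1" and N: "N \<ge> 1" and d: "d \<ge> 1"
    and j: "j \<in> diff_cube d N k" and t: "\<And>i. i \<in> {1..d} \<Longrightarrow> t i \<in> T i \<and> t i \<le> N"
    and E: "orthonormal (cube d N) E"
    and span: "\<And>b x. b \<in> spline_space d k T \<Longrightarrow> x \<in> cube d N \<Longrightarrow>
       proj (cube d N) E (perp_proj d N k b) x = perp_proj d N k b x"
  defines "c \<equiv> real (k + 1) ^ (2 * (k - 1))" and "B \<equiv> 1 + real (k + 1) ^ (k - 1)"
    and "z \<equiv> (\<lambda>x. atom d N k j x - proj (cube d N) E (atom d N k j) x)"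
  shows "ip (cube d N) z z \<le> B ^ (2 * d) * real d * c * real N ^ d *
        (\<Sum>i=1..d. (\<bar>real (j i) - real (t i)\<bar> / real N) ^ (2 * k - 1))"
proof -
  let ?I = "cube d N" and ?P = "perp_proj d N k"
  let ?\<phi> = "\<lambda>x. \<Prod>i=1..d. dict k N (j i) (x i)"
  define t' where "t' = restrict t {1..d}"
  let ?b = "\<lambda>\<rho> x. \<Prod>i=1..d. tpow (t' i) (\<rho> i) (x i)"
  let ?R = "PiE {1..d} (\<lambda>_. {..<k})"
  have "\<exists>\<alpha>. let u = (\<lambda>x. \<Sum>\<rho>\<in>?R. \<alpha> \<rho> * ?b \<rho> x); r = (\<lambda>x. ?\<phi> x - u x) in
     ip ?I r r \<le> B ^ (2 * d) * real d * c * real N ^ d *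
        (\<Sum>i=1..d. (\<bar>real (j i) - real (t' i)\<bar> / real N) ^ (2 * k - 1))"
    unfolding c_def B_def using t by (intro dict_approx_tensor[OF k N d j]) (auto simp: t'_def)
  then obtain \<alpha> where \<alpha>: "ip ?I (\<lambda>x. ?\<phi> x - (\<Sum>\<rho>\<in>?R. \<alpha> \<rho> * ?b \<rho> x)) (\<lambda>x. ?\<phi> x - (\<Sum>\<rho>\<in>?R. \<alpha> \<rho> * ?b \<rho> x))
      \<le> B ^ (2 * d) * real d * c * real N ^ d *
        (\<Sum>i=1..d. (\<bar>real (j i) - real (t' i)\<bar> / real N) ^ (2 * k - 1))"
    unfolding Let_def by blast
  define u where "u x = (\<Sum>\<rho>\<in>?R. \<alpha> \<rho> * ?b \<rho> x)" for x
  define r where "r x = ?\<phi> x - u x" for x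
  have bs: "?b \<rho> \<in> spline_space d k T" if "\<rho> \<in> ?R" for \<rho>
    unfolding spline_space_def using that t by (intro image_eqI[of _ _ "(t', \<rho>)"]) (auto simp: t'_def)
  have Pu: "?P u = (\<lambda>x. \<Sum>\<rho>\<in>?R. \<alpha> \<rho> * ?P (?b \<rho>) x)"
    unfolding u_def by (rule proj_perp_sum)
  have proju: "proj ?I E (?P u) x = ?P u x" if "x \<in> ?I" for x
    unfolding Pu proj_sum proj_scale using span[OF bs that] by (intro sum.cong) auto
  have Pr: "atom d N k j = (\<lambda>x. ?P r x + ?P u x)"
    unfolding atom_def proj_perp_add[symmetric] by (simp add: r_def)
  have z: "z x = ?P r x - proj ?I E (?P r) x" if "x \<in> ?I" for x
    unfolding z_def Pr proj_add using proju[OF that] by simp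
  have "ip ?I z z = ip ?I (\<lambda>x. ?P r x - proj ?I E (?P r) x) (\<lambda>x. ?P r x - proj ?I E (?P r) x)"
    by (rule ip_cong) (auto simp: z)
  also have "\<dots> \<le> ip ?I (?P r) (?P r)"
    unfolding ip_diff_proj[OF E] by (simp add: sum_nonneg)
  also have "\<dots> \<le> ip ?I r r" by (rule ip_proj_perp_self_le)
  also have "\<dots> \<le> B ^ (2 * d) * real d * c * real N ^ d *
        (\<Sum>i=1..d. (\<bar>real (j i) - real (t' i)\<bar> / real N) ^ (2 * k - 1))"
    using \<alpha> unfolding r_def u_def .
  also have "(\<Sum>i=1..d. (\<bar>real (j i) - real (t' i)\<bar> / real N) ^ (2 * k - 1))
     = (\<Sum>i=1..d. (\<bar>real (j i) - real (t i)\<bar> / real N) ^ (2 * k - 1))"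
    by (intro sum.cong) (auto simp: t'_def)
  finally show ?thesis .
qed

text \<open>At most one bump is nonzero at a given \<open>j\<close>: two grid points within distance
  \<open>R\<close> of \<open>j\<close> in every coordinate would violate the separation. The
  pointwise bounds are therefore those of a single bump.\<close>

lemma interpolation_exists:
  fixes T :: "nat \<Rightarrow> nat set" and q :: "(nat \<Rightarrow> nat) \<Rightarrow> real"
  assumes k: "k \<ge> 1" and R: "R \<ge> 1" and K: "sq_bound k K"
    and T: "\<And>i. i \<in> {1..d} \<Longrightarrow> finite (T i) \<and> card (T i) = m"
    and sep: "\<And>i t t'. i \<in> {1..d} \<Longrightarrow> t \<in> T i \<Longrightarrow> t' \<in> T i \<Longrightarrow> t \<noteq> t' \<Longrightarrow> 2 * R + 2 * real k \<le> \<bar>real t - real t'\<bar>"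
    and bd: "\<And>i t. i \<in> {1..d} \<Longrightarrow> t \<in> T i \<Longrightarrow> real k + R \<le> real t \<and> real t + R \<le> real N + 1"
    and q: "\<And>t. \<bar>q t\<bar> \<le> 1" and d: "d \<ge> 1"
  defines "S \<equiv> PiE {1..d} T"
  defines "Dw w y \<equiv> (\<Sum>j\<in>diff_cube d N k. w j * (\<Prod>i=1..d. dcoef k N (j i) (y i)))"
  shows "\<exists>w. (\<forall>j\<in>S. w j = q j) \<and>
    (\<forall>j. w j = 0 \<or> (\<exists>t\<in>S. (\<forall>i\<in>{1..d}. \<bar>real (j i) - real (t i)\<bar> < R) \<and>
       \<bar>w j\<bar> \<le> 1 - (\<Sum>i=1..d. (\<bar>real (j i) - real (t i)\<bar> / R) powr (real k - 1 / 2)) / real d)) \<and>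
    ip (cube d N) (Dw w) (Dw w) \<le>
     (real d + 1)\<^sup>2 * (1 + ln R) * (real N ^ (2 * (k - 1)) * real m * K * R powr (1 - 2 * real k)) ^ d"
proof -
  define w where "w j = (\<Sum>t\<in>S. q t * bump k d R t j)" for j
  have R0: "R > 0" using R by simp
  have finS: "finite S" unfolding S_def using T by (intro finite_PiE) auto
  let ?near = "\<lambda>t j. \<forall>i\<in>{1..d}. \<bar>real (j i) - real (t i)\<bar> < R"
  have far: "bump k d R t j = 0" if far: "\<not> ?near t j" for t j
  proof -
    obtain i where "i \<in> {1..d}" "\<bar>real (j i) - real (t i)\<bar> \<ge> R" using far by (auto simp: not_less)
    then show ?thesis by (rule bump_eq_0[OF k R0])
  qed
  have uniq: "t = t'" if t: "t \<in> S" "t' \<in> S" "?near t j" "?near t' j" for t t' j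
  proof (rule PiE_ext[OF t(1)[unfolded S_def] t(2)[unfolded S_def]])
    fix i assume i: "i \<in> {1..d}"
    show "t i = t' i"
    proof (rule ccontr)
      assume ne: "t i \<noteq> t' i"
      have "2 * R + 2 * real k \<le> \<bar>real (t i) - real (t' i)\<bar>"
        using sep[OF i _ _ ne] PiE_mem[OF t(1)[unfolded S_def] i] PiE_mem[OF t(2)[unfolded S_def] i] by blast
      moreover have "\<bar>real (j i) - real (t i)\<bar> < R" "\<bar>real (j i) - real (t' i)\<bar> < R" using t i by blast+
      ultimately show False by linarith
    qed
  qed
  have w_near: "w j = q t * bump k d R t j" if t: "t \<in> S" "?near t j" for t j
  proof -
    have "w j = (\<Sum>t'\<in>{t}. q t' * bump k d R t' j)"
      unfolding w_def
    proof (intro sum.mono_neutral_right finS ballI)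
      fix t' assume "t' \<in> S - {t}"
      then have "\<not> ?near t' j" using uniq[OF t(1) _ t(2), of t'] by blast
      then have "bump k d R t' j = 0" by (rule far)
      then show "q t' * bump k d R t' j = 0" by simp
    qed (use t in auto)
    then show ?thesis by simp
  qed
  show ?thesis
  proof (intro exI[of _ w] conjI ballI allI)
    fix j assume "j \<in> S"
    then show "w j = q j" using w_near[of j j] bump_self[OF k R0, of d j j] R0 by simp
  next
    fix j
    show "w j = 0 \<or> (\<exists>t\<in>S. ?near t j \<and>
       \<bar>w j\<bar> \<le> 1 - (\<Sum>i=1..d. (\<bar>real (j i) - real (t i)\<bar> / R) powr (real k - 1 / 2)) / real d)"
    proof (cases "\<exists>t\<in>S. ?near t j")
      case True
      then obtain t where t: "t \<in> S" "?near t j" by blast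
      have "\<bar>w j\<bar> \<le> 1 * \<bar>bump k d R t j\<bar>"
        unfolding w_near[OF t] abs_mult using q by (intro mult_right_mono) auto
      also have "\<dots> \<le> 1 - (\<Sum>i=1..d. (\<bar>real (j i) - real (t i)\<bar> / R) powr (real k - 1 / 2)) / real d"
        using abs_bump_le[OF k d R0, of j t] t(2) by (simp add: less_imp_le)
      finally show ?thesis using t by blast
    next
      case False
      have "bump k d R t j = 0" if "t \<in> S" for t using False that by (intro far) blast
      then show ?thesis by (simp add: w_def)
    qed
  next
    show "ip (cube d N) (Dw w) (Dw w) \<le>
     (real d + 1)\<^sup>2 * (1 + ln R) * (real N ^ (2 * (k - 1)) * real m * K * R powr (1 - 2 * real k)) ^ d"
      unfolding Dw_def w_def S_def by (rule interpolation_transpose_norm[OF k R K T sep bd q d])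
  qed
qed

section \<open>The probability bound\<close>

lemma powr_half_sq: "x \<ge> 0 \<Longrightarrow> k \<ge> 1 \<Longrightarrow> (x powr (real k - 1 / 2))\<^sup>2 = x ^ (2 * k - 1)"
proof -
  assume x: "x \<ge> 0" and k: "k \<ge> 1"
  show ?thesis
  proof (cases "x = 0")
    case True
    then show ?thesis using k by simp
  next
    case False
    have "(x powr (real k - 1 / 2))\<^sup>2 = x powr (real (2 * k - 1))"
      using k by (simp add: power2_eq_square powr_add[symmetric] of_nat_diff)
    then show ?thesis using x False by (simp only: powr_realpow)
  qed
qed

lemma sum_power2_le_power2_sum:
  fixes y :: "'a \<Rightarrow> real"
  assumes "finite I" "\<And>i. i \<in> I \<Longrightarrow> y i \<ge> 0"
  shows "(\<Sum>i\<in>I. (y i)\<^sup>2) \<le> (\<Sum>i\<in>I. y i)\<^sup>2"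
proof -
  have "(\<Sum>i\<in>I. (y i)\<^sup>2) \<le> (\<Sum>i\<in>I. y i * (\<Sum>i\<in>I. y i))"
    unfolding power2_eq_square using assms by (intro sum_mono mult_left_mono member_le_sum) auto
  then show ?thesis by (simp add: power2_eq_square sum_distrib_right)
qed

text \<open>The number of grid points is \<open>m ^ d\<close>, which turns the exponent
  \<open>(2 * real k - 1) / (2 * real d)\<close> into \<open>real k - 1 / 2\<close> on
  \<open>m\<close>. At level \<open>ln (2 * real n)\<close> the square of \<open>lambda0\<close> is
  the squared Gaussian threshold divided by \<open>n\<close>, with both logarithms merged into
  \<open>4 * ln (2 * real n)\<close>.\<close>

lemma lambda_lower_bound:
  assumes k: "k \<ge> 1" and d: "d \<ge> 1" and m: "m \<ge> 1" and n: "n \<ge> 1" and \<sigma>: "\<sigma> > 0"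
    and lam: "lam \<ge> real d powr (3 / 2) * lambda0 \<sigma> n (ln (2 * real n))
               / real (m ^ d) powr ((2 * real k - 1) / (2 * real d))"
  shows "lam > 0" "\<sigma>\<^sup>2 * (4 * ln (2 * real n)) / real n \<le> lam\<^sup>2 * real m ^ (2 * k - 1)"
proof -
  let ?l = "lambda0 \<sigma> n (ln (2 * real n))" and ?p = "real m powr (real k - 1 / 2)"
  have ln: "ln (2 * real n) > 0" using n by simp
  have l0: "?l > 0" unfolding lambda0_def using \<sigma> ln n by simp
  have p0: "?p > 0" using m by simp
  have "real (m ^ d) powr ((2 * real k - 1) / (2 * real d)) = (real m powr real d) powr ((2 * real k - 1) / (2 * real d))"
    using m by (simp add: powr_realpow)
  also have "\<dots> = ?p"
  proof -
    have "real d * ((2 * real k - 1) / (2 * real d)) = real k - 1 / 2"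
      using d by (simp add: diff_divide_distrib right_diff_distrib)
    then show ?thesis by (simp only: powr_powr)
  qed
  finally have pw: "real (m ^ d) powr ((2 * real k - 1) / (2 * real d)) = ?p" .
  have "1 \<le> real d powr (3 / 2)" using d by (simp add: ge_one_powr_ge_zero)
  then have "1 * ?l \<le> real d powr (3 / 2) * ?l" using l0 by (intro mult_right_mono) auto
  then have "1 * ?l / ?p \<le> real d powr (3 / 2) * ?l / ?p" using p0 by (intro divide_right_mono) auto
  then have "?l / ?p \<le> lam" using lam unfolding pw by simp
  then have l: "?l \<le> lam * ?p" using p0 by (simp add: divide_le_eq)
  then show "lam > 0" using l0 p0 by (metis less_le_trans zero_less_mult_pos2)
  have "?l\<^sup>2 \<le> (lam * ?p)\<^sup>2" using l l0 by (intro power_mono) auto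
  moreover have "?l\<^sup>2 = \<sigma>\<^sup>2 * (4 * ln (2 * real n)) / real n"
    unfolding lambda0_def using ln n by (simp add: power_mult_distrib)
  moreover have "(lam * ?p)\<^sup>2 = lam\<^sup>2 * real m ^ (2 * k - 1)"
    using k by (simp add: power_mult_distrib powr_half_sq)
  ultimately show "\<sigma>\<^sup>2 * (4 * ln (2 * real n)) / real n \<le> lam\<^sup>2 * real m ^ (2 * k - 1)" by simp
qed

text \<open>\<open>D\<close> will be the distance to the nearest knot and \<open>v\<close> the noise
  weight. Off the bumps the mesh gives \<open>D i \<le> a * L\<close>, and \<open>v \<le> 1\<close>
  is the goal; inside a bump \<open>x\<close> is the distance to its centre, and \<open>v\<close>
  has to stay below the deficit. The factor \<open>(real d)\<^sup>2\<close> in the condition on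
  \<open>a\<close> matches the averaging by \<open>1 / real d\<close>. For \<open>R = 1\<close> the
  only integer point inside a bump is its centre.\<close>

lemma weight_le:
  fixes x D :: "nat \<Rightarrow> real"
  assumes k: "k \<ge> 1" and d: "d \<ge> 1" and cc: "cc \<ge> 0" and L: "L > 0" and a: "a > 0" "cc * a ^ (2 * k - 1) * (real d)\<^sup>2 \<le> 1"
    and R: "R = max (a * L) 1"
    and v: "v\<^sup>2 \<le> cc * (\<Sum>i=1..d. (D i / L) ^ (2 * k - 1))"
    and D: "\<And>i. i \<in> {1..d} \<Longrightarrow> 0 \<le> D i"
  shows "(\<And>i. i \<in> {1..d} \<Longrightarrow> D i \<le> a * L) \<Longrightarrow> v \<le> 1"
    and "(\<And>i. i \<in> {1..d} \<Longrightarrow> D i \<le> x i \<and> x i < R \<and> (R = 1 \<longrightarrow> x i = 0)) \<Longrightarrow>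
       v \<le> (\<Sum>i=1..d. (x i / R) powr (real k - 1 / 2)) / real d"
proof -
  let ?c = "2 * k - 1"
  assume Da: "\<And>i. i \<in> {1..d} \<Longrightarrow> D i \<le> a * L"
  have "(\<Sum>i=1..d. (D i / L) ^ ?c) \<le> (\<Sum>i=1..d. a ^ ?c)"
    using Da D L by (intro sum_mono power_mono) (auto simp: divide_le_eq)
  then have "v\<^sup>2 \<le> cc * (\<Sum>i=1..d. a ^ ?c)" using v cc by (meson mult_left_mono order_trans)
  also have "\<dots> = cc * a ^ ?c * real d" by simp
  also have "\<dots> \<le> cc * a ^ ?c * (real d)\<^sup>2"
    using cc a d by (intro mult_left_mono) (auto simp: power2_eq_square)
  finally have "v\<^sup>2 \<le> 1\<^sup>2" using a by simp
  then show "v \<le> 1" by (rule power2_le_imp_le) simp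
next
  let ?c = "2 * k - 1"
  assume Dx: "\<And>i. i \<in> {1..d} \<Longrightarrow> D i \<le> x i \<and> x i < R \<and> (R = 1 \<longrightarrow> x i = 0)"
  define y where "y i = (x i / R) powr (real k - 1 / 2)" for i
  have R0: "R > 0" using R by simp
  have xL: "D i / L \<le> a * (x i / R)" if i: "i \<in> {1..d}" for i
  proof (cases "R = 1")
    case True
    then have "D i = 0" "x i = 0" using Dx[OF i] D[OF i] by auto
    then show ?thesis by simp
  next
    case False
    then have "R = a * L" using R by (auto simp: max_def split: if_splits)
    then show ?thesis using Dx[OF i] L a by (simp add: divide_right_mono)
  qed
  have x0: "0 \<le> x i / R" if "i \<in> {1..d}" for i using Dx[OF that] D[OF that] R0 by simp
  have "(\<Sum>i=1..d. (D i / L) ^ ?c) \<le> (\<Sum>i=1..d. a ^ ?c * (y i)\<^sup>2)"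
  proof (intro sum_mono)
    fix i assume i: "i \<in> {1..d}"
    have "(D i / L) ^ ?c \<le> (a * (x i / R)) ^ ?c" using xL[OF i] D[OF i] L by (intro power_mono) auto
    also have "\<dots> = a ^ ?c * (y i)\<^sup>2" unfolding y_def powr_half_sq[OF x0[OF i] k] by (rule power_mult_distrib)
    finally show "(D i / L) ^ ?c \<le> a ^ ?c * (y i)\<^sup>2" .
  qed
  then have "v\<^sup>2 \<le> cc * (\<Sum>i=1..d. a ^ ?c * (y i)\<^sup>2)" using v cc by (meson mult_left_mono order_trans)
  also have "\<dots> = cc * a ^ ?c * (\<Sum>i=1..d. (y i)\<^sup>2)" by (simp add: sum_distrib_left mult_ac)
  also have "\<dots> \<le> cc * a ^ ?c * (\<Sum>i=1..d. y i)\<^sup>2"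
    using cc a by (intro mult_left_mono sum_power2_le_power2_sum) (auto simp: y_def)
  also have "\<dots> \<le> 1 / (real d)\<^sup>2 * (\<Sum>i=1..d. y i)\<^sup>2"
    using a(2) d by (intro mult_right_mono) (auto simp: pos_le_divide_eq)
  also have "\<dots> = ((\<Sum>i=1..d. y i) / real d)\<^sup>2" by (simp add: power_divide)
  finally show "v \<le> (\<Sum>i=1..d. (x i / R) powr (real k - 1 / 2)) / real d"
    unfolding y_def by (rule power2_le_imp_le) (simp add: sum_nonneg)
qed

text \<open>In \<open>real N * ?X\<close>, the share of one coordinate in the interpolation term,
  the powers of \<open>N\<close> cancel once \<open>R \<ge> a * L\<close> is inserted, and a
  multiple of \<open>m ^ (2 * k)\<close> remains, whose d-th power is of order
  \<open>s ^ (2 * k)\<close>. The removed dimensions contribute a multiple of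
  \<open>s * m ^ (2 * k - 1)\<close>, which \<open>s ^ (2 * k)\<close> dominates.\<close>

lemma rate_bound:
  fixes N m d k :: nat
  assumes k: "k \<ge> 1" and d: "d \<ge> 1" and m: "m \<ge> 1" and N: "2 * m \<le> N"
    and a: "0 < a" "a \<le> 1" and R: "R = max (a * (real N / real m)) 1" and Kq: "Kq \<ge> 0" and K1: "K1 \<ge> 0"
    and A: "A \<le> K1 * real (m ^ d) * W" and W: "W / real (N ^ d) \<le> lam\<^sup>2 * real m ^ (2 * k - 1)" and W0: "W \<ge> 0"
    and \<Gamma>: "\<Gamma> = (real d + 1)\<^sup>2 * (1 + ln R) * (real N ^ (2 * (k - 1)) * real m * Kq * R powr (1 - 2 * real k)) ^ d"
  shows "2 * A / real (N ^ d) + 2 * real (N ^ d) * lam\<^sup>2 * \<Gamma> \<le>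
    (2 * K1 / ln 2 + 2 * (real d + 1)\<^sup>2 * (Kq * a powr (1 - 2 * real k)) ^ d * (1 + 1 / ln 2)) *
    (lam\<^sup>2 * real (m ^ d) ^ (2 * k) * ln (real (N ^ d) / real (m ^ d)))"
proof -
  let ?l = "ln (real (N ^ d) / real (m ^ d))" and ?s = "real (m ^ d)" and ?n = "real (N ^ d)"
  define L where "L = real N / real m"
  have m0: "real m > 0" using m by simp
  have N0: "real N > 0" using N m by simp
  have L2: "L \<ge> 2" unfolding L_def using m0 N by (simp add: le_divide_eq)
  have "?l = ln (L ^ d)" by (simp add: L_def power_divide)
  also have "\<dots> = real d * ln L" using L2 by (simp add: ln_realpow)
  finally have l: "?l = real d * ln L" .
  have lnL: "ln L \<ge> ln 2" using L2 by simp
  have ln2: "ln (2::real) > 0" by simp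
  have "ln L \<ge> 0" using lnL ln2 by linarith
  then have lL: "ln L \<le> ?l" unfolding l using d mult_right_mono[of 1 "real d" "ln L"] by simp
  \<comment> \<open>A consequence of \<open>2 * m \<le> N\<close>; it supplies the logarithm to the
    terms that have none.\<close>
  have l2: "ln 2 \<le> ?l" using lL lnL by linarith
  have s1: "?s \<ge> real m" using m d by (simp add: self_le_power)
  have R1: "R \<ge> 1" "R \<ge> a * L" using R by (auto simp: L_def)
  have RL: "R \<le> L" using R a L2 mult_right_mono[of a 1 L] by (simp add: L_def[symmetric])
  have S: "lam\<^sup>2 * ?s ^ (2 * k) \<ge> 0" by simp
  have first: "2 * A / ?n \<le> 2 * K1 / ln 2 * (lam\<^sup>2 * ?s ^ (2 * k) * ?l)"
  proof -
    have "2 * A / ?n \<le> 2 * (K1 * ?s * W) / ?n" using A N0 by (intro divide_right_mono) auto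
    also have "\<dots> = 2 * K1 * (?s * (W / ?n))" by simp
    also have "\<dots> \<le> 2 * K1 * (?s * (lam\<^sup>2 * ?s ^ (2 * k - 1)))"
    proof -
      have "lam\<^sup>2 * real m ^ (2 * k - 1) \<le> lam\<^sup>2 * ?s ^ (2 * k - 1)"
        using s1 by (intro mult_left_mono power_mono) auto
      then have "W / ?n \<le> lam\<^sup>2 * ?s ^ (2 * k - 1)" using W by (rule order_trans[rotated])
      then show ?thesis using K1 by (intro mult_left_mono) auto
    qed
    also have "\<dots> = 2 * K1 * (lam\<^sup>2 * ?s ^ (2 * k)) * 1"
      using power_Suc[of ?s "2 * k - 1"] k by (simp add: Suc_diff_le)
    also have "\<dots> \<le> 2 * K1 * (lam\<^sup>2 * ?s ^ (2 * k)) * (?l / ln 2)"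
      using l2 ln2 K1 S by (intro mult_left_mono mult_nonneg_nonneg) (auto simp: le_divide_eq)
    finally show ?thesis by simp
  qed
  have second: "2 * ?n * lam\<^sup>2 * \<Gamma> \<le> 2 * (real d + 1)\<^sup>2 * (Kq * a powr (1 - 2 * real k)) ^ d * (1 + 1 / ln 2)
      * (lam\<^sup>2 * ?s ^ (2 * k) * ?l)"
  proof -
    let ?X = "real N ^ (2 * (k - 1)) * real m * Kq * R powr (1 - 2 * real k)"
    have X: "real N * ?X \<le> real m ^ (2 * k) * (Kq * a powr (1 - 2 * real k))"
    proof -
      have "R powr (1 - 2 * real k) \<le> (a * L) powr (1 - 2 * real k)"
        using R1 a L2 k by (intro powr_mono2') auto
      also have "\<dots> = a powr (1 - 2 * real k) * L powr (1 - 2 * real k)" using a L2 by (simp add: powr_mult)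
      also have "L powr (1 - 2 * real k) = real m ^ (2 * k - 1) / real N ^ (2 * k - 1)"
      proof -
        have "L powr (1 - 2 * real k) = L powr (- real (2 * k - 1))" using k by (simp add: of_nat_diff)
        also have "\<dots> = 1 / L ^ (2 * k - 1)" using L2 by (simp only: powr_minus powr_realpow inverse_eq_divide)
        also have "\<dots> = real m ^ (2 * k - 1) / real N ^ (2 * k - 1)" by (simp add: L_def power_divide)
        finally show ?thesis .
      qed
      finally have "R powr (1 - 2 * real k) \<le> a powr (1 - 2 * real k) * (real m ^ (2 * k - 1) / real N ^ (2 * k - 1))" .
      then have "(real N * real N ^ (2 * (k - 1)) * real m * Kq) * R powr (1 - 2 * real k)
         \<le> (real N * real N ^ (2 * (k - 1)) * real m * Kq) * (a powr (1 - 2 * real k) * (real m ^ (2 * k - 1) / real N ^ (2 * k - 1)))"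
        using Kq by (intro mult_left_mono) auto
      also have "real N * real N ^ (2 * (k - 1)) = real N ^ (2 * k - 1)"
      proof -
        have "2 * k - 1 = Suc (2 * (k - 1))" using k by simp
        then show ?thesis by simp
      qed
      also have "(real N ^ (2 * k - 1) * real m * Kq) * (a powr (1 - 2 * real k) * (real m ^ (2 * k - 1) / real N ^ (2 * k - 1)))
         = (real m * real m ^ (2 * k - 1)) * (Kq * a powr (1 - 2 * real k))" using N0 by simp
      also have "real m * real m ^ (2 * k - 1) = real m ^ (2 * k)"
      proof -
        have "2 * k = Suc (2 * k - 1)" using k by simp
        then show ?thesis by (metis power_Suc)
      qed
      also have "real N ^ (2 * k - 1) = real N * real N ^ (2 * (k - 1))"
      proof -
        have "2 * k - 1 = Suc (2 * (k - 1))" using k by simp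
        then show ?thesis by simp
      qed
      finally show ?thesis by (simp only: mult.assoc)
    qed
    have lnR: "1 + ln R \<le> (1 + 1 / ln 2) * ?l"
    proof -
      have "ln R \<le> ?l" using R1 RL lL by (meson ln_le_cancel_iff less_le_trans order_trans zero_less_one)
      moreover have "1 \<le> ?l / ln 2" using l2 ln2 by (simp add: le_divide_eq)
      moreover have "(1 + 1 / ln 2) * ?l = ?l + ?l / ln 2" by (simp add: distrib_right)
      ultimately show ?thesis by linarith
    qed
    have "0 \<le> real N * ?X" using Kq by simp
    then have "(real N * ?X) ^ d \<le> (real m ^ (2 * k) * (Kq * a powr (1 - 2 * real k))) ^ d"
      by (rule power_mono[OF X])
    moreover have "0 \<le> (1 + 1 / ln 2) * ?l" using l2 ln2 by (intro mult_nonneg_nonneg add_nonneg_nonneg divide_nonneg_nonneg) linarith+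
    moreover have "0 \<le> (real N * ?X) ^ d" using \<open>0 \<le> real N * ?X\<close> by (rule zero_le_power)
    ultimately have lX: "(1 + ln R) * (real N * ?X) ^ d \<le>
        ((1 + 1 / ln 2) * ?l) * (real m ^ (2 * k) * (Kq * a powr (1 - 2 * real k))) ^ d"
      by (rule mult_mono[OF lnR])
    have "2 * ?n * lam\<^sup>2 * \<Gamma> = 2 * lam\<^sup>2 * (real d + 1)\<^sup>2 * ((1 + ln R) * (real N * ?X) ^ d)"
      unfolding \<Gamma> by (simp only: of_nat_power power_mult_distrib mult_ac)
    also have "\<dots> \<le> 2 * lam\<^sup>2 * (real d + 1)\<^sup>2 * (((1 + 1 / ln 2) * ?l) * (real m ^ (2 * k) * (Kq * a powr (1 - 2 * real k))) ^ d)"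
      by (rule mult_left_mono[OF lX]) simp
    also have "(real m ^ (2 * k) * (Kq * a powr (1 - 2 * real k))) ^ d = ?s ^ (2 * k) * (Kq * a powr (1 - 2 * real k)) ^ d"
      by (simp only: power_mult_distrib of_nat_power power_mult[symmetric] mult.commute)
    finally show ?thesis by (simp only: mult_ac)
  qed
  show ?thesis using first second by (simp only: distrib_right)
qed

text \<open>Knots at least 2 apart are disjoint from their successors, and both sets lie in
  \<open>{1..N}\<close>.\<close>

lemma grid_spacing:
  assumes T: "finite T" "card T = m" "m \<ge> 1"
    and sep: "\<And>t t'. t \<in> T \<Longrightarrow> t' \<in> T \<Longrightarrow> t \<noteq> t' \<Longrightarrow> 2 \<le> \<bar>real t - real t'\<bar>"
    and bd: "\<And>t. t \<in> T \<Longrightarrow> 1 \<le> t \<and> t + 1 \<le> N"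
  shows "2 * m \<le> N"
proof -
  have "T \<inter> Suc ` T = {}"
  proof (rule ccontr)
    assume "T \<inter> Suc ` T \<noteq> {}"
    then obtain t where "t \<in> T" "Suc t \<in> T" by auto
    then show False using sep[of "Suc t" t] by simp
  qed
  then have "2 * m = card (T \<union> Suc ` T)" using T by (simp add: card_Un_disjoint card_image)
  also have "\<dots> \<le> card {1..N}" by (intro card_mono) (auto dest!: bd)
  finally show ?thesis by simp
qed

lemma grid_risk_bound:
  fixes k d :: nat and c1 c2 \<delta> :: real
  assumes k: "k \<ge> 1" and d: "d \<ge> 1" and c1: "c1 > 0"
  shows "\<exists>K\<ge>0. \<forall>N S (f0::(nat \<Rightarrow> nat) \<Rightarrow> real) (g::(nat \<Rightarrow> nat) \<Rightarrow> real) \<sigma> lam (M::'w measure) \<epsilon>.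
     \<sigma> > 0 \<and> gaussian_noise M (cube d N) \<sigma> \<epsilon> \<and> regular_grid d N k c1 c2 \<delta> S \<and>
     S \<subseteq> diff_cube d N k \<and>
     lam \<ge> real d powr (3 / 2) * lambda0 \<sigma> (N ^ d) (ln (2 * real (N ^ d)))
             / real (card S) powr ((2 * real k - 1) / (2 * real d))
     \<longrightarrow> measure M {\<omega> \<in> space M. risk_bound d N k lam S f0 g
         (K * (lam\<^sup>2 * real (card S) ^ (2 * k) * ln (real (N ^ d) / real (card S)))) (\<lambda>i. \<epsilon> i \<omega>)}
        \<ge> 1 - 1 / real (N ^ d)"
proof -
  \<comment> \<open>The factor in \<open>atom_residual_le\<close> in front of
    \<open>real N ^ d\<close> and the sum of powers of relative distances.\<close>
  define cc where "cc = (1 + real (k + 1) ^ (k - 1)) ^ (2 * d) * real d * real (k + 1) ^ (2 * (k - 1))"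
  have "1 + real (k + 1) ^ (k - 1) > 0" by (intro add_pos_nonneg) auto
  then have cc: "cc > 0" unfolding cc_def using d by (intro mult_pos_pos zero_less_power) auto
  \<comment> \<open>Three demands: bumps, widened by the reach of the difference, fit between
    neighbouring knots; the radius does not exceed \<open>L\<close>; the noise weight stays below
    the deficit of a bump.\<close>
  define a where "a = min (c1 / real (2 * k + 2)) (min 1 (1 / (cc * (real d)\<^sup>2)))"
  have a: "a > 0" "a \<le> 1" "a * real (2 * k + 2) \<le> c1" "cc * a ^ (2 * k - 1) * (real d)\<^sup>2 \<le> 1"
  proof -
    show a0: "a > 0" and a1: "a \<le> 1" using cc c1 d by (auto simp: a_def)
    have "a \<le> c1 / real (2 * k + 2)" by (simp add: a_def)
    then show "a * real (2 * k + 2) \<le> c1" by (subst (asm) pos_le_divide_eq) auto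
    have cd: "cc * (real d)\<^sup>2 > 0" using cc d by simp
    have "a ^ (2 * k - 1) \<le> a ^ 1" using a0 a1 k by (intro power_decreasing) auto
    also have "a ^ 1 \<le> 1 / (cc * (real d)\<^sup>2)" by (simp add: a_def)
    finally have "a ^ (2 * k - 1) * (cc * (real d)\<^sup>2) \<le> 1" using cd by (subst (asm) pos_le_divide_eq) auto
    then show "cc * a ^ (2 * k - 1) * (real d)\<^sup>2 \<le> 1" by (simp only: mult_ac)
  qed
  obtain Kq where Kq: "sq_bound k Kq" using sq_bound_exists[OF k] by blast
  then have Kq0: "Kq \<ge> 0" by (simp add: sq_bound_def)
  \<comment> \<open>Per coordinate there are at most \<open>(2 + 2 / a) * real m\<close> knots, from
    grid and mesh together, and k exponents for each.\<close>
  define K1 where "K1 = ((2 + 2 / a) * real k) ^ d"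
  have K10: "K1 \<ge> 0" using a by (simp add: K1_def)
  define K where "K = 2 * K1 / ln 2 + 2 * (real d + 1)\<^sup>2 * (Kq * a powr (1 - 2 * real k)) ^ d * (1 + 1 / ln 2)"
  have K0: "K \<ge> 0" unfolding K_def using K10 Kq0 by simp
  show ?thesis
  proof (intro exI[of _ K] conjI K0 allI impI, elim conjE)
    fix N :: nat and S :: "(nat \<Rightarrow> nat) set" and f0 g :: "(nat \<Rightarrow> nat) \<Rightarrow> real" and \<sigma> lam :: real
      and M :: "'w measure" and \<epsilon> :: "(nat \<Rightarrow> nat) \<Rightarrow> 'w \<Rightarrow> real"
    assume \<sigma>: "\<sigma> > 0" and noise: "gaussian_noise M (cube d N) \<sigma> \<epsilon>"
      and grid: "regular_grid d N k c1 c2 \<delta> S" and SJ: "S \<subseteq> diff_cube d N k"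
      and lam_ge: "lam \<ge> real d powr (3 / 2) * lambda0 \<sigma> (N ^ d) (ln (2 * real (N ^ d)))
             / real (card S) powr ((2 * real k - 1) / (2 * real d))"
    let ?I = "cube d N" and ?J = "diff_cube d N k"
    interpret prob_space M using noise by (simp add: gaussian_noise_def)
    from regular_grid_facts[OF grid d k] obtain T m where Tm: "S = PiE {1..d} T \<and> m \<ge> 1 \<and> card S = m ^ d \<and> (\<forall>i\<in>{1..d}. finite (T i) \<and> card (T i) = m) \<and>
    (\<forall>i\<in>{1..d}. \<forall>t\<in>T i. \<forall>t'\<in>T i. t \<noteq> t' \<longrightarrow>
      c1 * (real N / real m) < \<bar>real t - real t'\<bar> \<and> real (k * (k + 2)) + 1 \<le> \<bar>real t - real t'\<bar>) \<and>
    (\<forall>i\<in>{1..d}. \<forall>t\<in>T i.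
      real (k + 1) + c1 * (real N / real m) \<le> real t \<and> real (k + 1) + real (k * (k + 2)) \<le> real t \<and>
      real t + c1 * (real N / real m) \<le> real N \<and> real t + real (k * (k + 2)) \<le> real N)"
      by (elim exE)
    have S: "S = PiE {1..d} T" and m: "m \<ge> 1" and cardS: "card S = m ^ d" using Tm by blast+
    have T: "finite (T i) \<and> card (T i) = m" if "i \<in> {1..d}" for i using Tm that by blast
    have sep: "c1 * (real N / real m) < \<bar>real t - real t'\<bar> \<and> real (k * (k + 2)) + 1 \<le> \<bar>real t - real t'\<bar>"
      if "i \<in> {1..d}" "t \<in> T i" "t' \<in> T i" "t \<noteq> t'" for i t t' using Tm that by blast
    have bd: "real (k + 1) + c1 * (real N / real m) \<le> real t \<and> real (k + 1) + real (k * (k + 2)) \<le> real t \<and>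
      real t + c1 * (real N / real m) \<le> real N \<and> real t + real (k * (k + 2)) \<le> real N"
      if "i \<in> {1..d}" "t \<in> T i" for i t using Tm that by blast
    define L where "L = real N / real m"
    have kk: "real (k * (k + 2)) \<ge> 2 * real k + 1"
    proof -
      have "real k * 1 \<le> real k * real k" using k by (intro mult_left_mono) auto
      moreover have "real k \<ge> 1" using k by simp
      moreover have "real (k * (k + 2)) = real k * real k + 2 * real k" by (simp add: algebra_simps)
      ultimately show ?thesis by linarith
    qed
    have k1: "real k \<ge> 1" using k by simp
    have bd1: "1 \<le> t \<and> t + 1 \<le> N" if "i \<in> {1..d}" "t \<in> T i" for i t
    proof -
      have "real t + 1 \<le> real N" "1 \<le> real t" using bd[OF that] kk k1 by linarith+
      then show ?thesis by linarith
    qed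
    have Nm: "2 * m \<le> N"
    proof (rule grid_spacing[of "T 1"])
      show "2 \<le> \<bar>real t - real t'\<bar>" if "t \<in> T 1" "t' \<in> T 1" "t \<noteq> t'" for t t'
        using sep[of 1 t t'] that d kk k1 by simp
    qed (use T[of 1] d m bd1[of 1] in auto)
    have N: "N \<ge> 1" using Nm m by linarith
    have L0: "L > 0" using N m by (simp add: L_def)
    define n where "n = N ^ d"
    have n1: "n \<ge> 1" using N by (simp add: n_def)
    have n0: "real n > 0" using n1 by simp
    define R where "R = max (a * L) 1"
    have R1: "R \<ge> 1" by (simp add: R_def)
    have caL: "(2 * real k + 2) * (a * L) \<le> c1 * L"
    proof -
      have "a * real (2 * k + 2) * L \<le> c1 * L" using a(3) L0 by (intro mult_right_mono) auto
      then show ?thesis by (simp add: algebra_simps)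
    qed
    have aL: "a * L \<le> c1 * L"
    proof -
      have "1 * (a * L) \<le> (2 * real k + 2) * (a * L)" using a(1) L0 by (intro mult_right_mono) auto
      then show ?thesis using caL by simp
    qed
    \<comment> \<open>If \<open>a * L \<le> 1\<close>, the radius is 1 and the gap
      \<open>k * (k + 2) + 1\<close> is wide enough. Otherwise \<open>1 < a * L\<close> lets
      \<open>2 * real k\<close> be absorbed into a multiple of \<open>a * L\<close>, and the gap
      \<open>c1 * L\<close> decides.\<close>
    have sepR: "2 * R + 2 * real k \<le> \<bar>real t - real t'\<bar>" if "i \<in> {1..d}" "t \<in> T i" "t' \<in> T i" "t \<noteq> t'" for i t t'
    proof (cases "a * L \<le> 1")
      case True
      then show ?thesis using sep[OF that] kk by (simp add: R_def max_def)
    next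
      case False
      then have R: "R = a * L" by (simp add: R_def)
      have "2 * real k * 1 \<le> 2 * real k * (a * L)" using False by (intro mult_left_mono) auto
      then have "2 * R + 2 * real k \<le> (2 * real k + 2) * (a * L)" by (simp add: R algebra_simps)
      then show ?thesis using caL sep[OF that, folded L_def] by linarith
    qed
    have bdR: "real k + R \<le> real t \<and> real t + R \<le> real N + 1" if "i \<in> {1..d}" "t \<in> T i" for i t
    proof (cases "a * L \<le> 1")
      case True
      then have "R = 1" by (simp add: R_def)
      then show ?thesis using bd[OF that] kk k1 by simp
    next
      case False
      then have "R = a * L" by (simp add: R_def)
      then show ?thesis using bd[OF that, folded L_def] aL by simp
    qed
    have lam: "lam > 0" "\<sigma>\<^sup>2 * (4 * ln (2 * real n)) / real n \<le> lam\<^sup>2 * real m ^ (2 * k - 1)"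
      using lambda_lower_bound[OF k d m n1 \<sigma>, of lam] lam_ge unfolding cardS n_def by auto
    \<comment> \<open>With this \<open>\<tau>\<close> each of the at most \<open>2n\<close> Gaussian tail events has probability at most \<open>1/(2n\<^sup>2)\<close>.\<close>
    define \<tau> where "\<tau> = 2 * sqrt (ln (2 * real n))"
    have lnn: "ln (2 * real n) > 0" using n1 by simp
    have \<tau>0: "\<tau> \<ge> 0" using lnn by (simp add: \<tau>_def)
    have \<tau>sq: "\<tau>\<^sup>2 = 4 * ln (2 * real n)" using lnn by (simp add: \<tau>_def power_mult_distrib)
    define W where "W = (\<tau> * \<sigma>)\<^sup>2"
    have W: "W / real n \<le> lam\<^sup>2 * real m ^ (2 * k - 1)"
      using lam(2) by (simp add: W_def power_mult_distrib \<tau>sq mult.commute)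
    have "\<forall>i. \<exists>T'. i \<in> {1..d} \<longrightarrow> T i \<subseteq> T' \<and> finite T' \<and> (\<forall>t\<in>T'. t \<le> N) \<and>
        real (card T') \<le> real (card (T i)) + 2 * real N / (a * L) + 1 \<and>
        (\<forall>x\<le>N. \<exists>t\<in>T'. \<bar>real x - real t\<bar> \<le> a * L)"
    proof
      fix i
      show "\<exists>T'. i \<in> {1..d} \<longrightarrow> T i \<subseteq> T' \<and> finite T' \<and> (\<forall>t\<in>T'. t \<le> N) \<and>
        real (card T') \<le> real (card (T i)) + 2 * real N / (a * L) + 1 \<and>
        (\<forall>x\<le>N. \<exists>t\<in>T'. \<bar>real x - real t\<bar> \<le> a * L)"
      proof (cases "i \<in> {1..d}")
        case True
        have "t \<le> N" if "t \<in> T i" for t using bd1[OF True that] by simp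
        then show ?thesis using mesh_exists[of "T i" N "a * L"] T[OF True] a(1) L0 by auto
      qed auto
    qed
    from choice[OF this] obtain T' where T'0: "\<forall>i. i \<in> {1..d} \<longrightarrow> T i \<subseteq> T' i \<and> finite (T' i) \<and> (\<forall>t\<in>T' i. t \<le> N) \<and>
        real (card (T' i)) \<le> real (card (T i)) + 2 * real N / (a * L) + 1 \<and>
        (\<forall>x\<le>N. \<exists>t\<in>T' i. \<bar>real x - real t\<bar> \<le> a * L)" ..
    have T': "T i \<subseteq> T' i" "finite (T' i)" "\<And>t. t \<in> T' i \<Longrightarrow> t \<le> N"
      "real (card (T' i)) \<le> (2 + 2 / a) * real m" "\<And>x. x \<le> N \<Longrightarrow> \<exists>t\<in>T' i. \<bar>real x - real t\<bar> \<le> a * L"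
      if i: "i \<in> {1..d}" for i
    proof -
      show "T i \<subseteq> T' i" "finite (T' i)" "\<And>t. t \<in> T' i \<Longrightarrow> t \<le> N"
        "\<And>x. x \<le> N \<Longrightarrow> \<exists>t\<in>T' i. \<bar>real x - real t\<bar> \<le> a * L" using T'0 i by blast+
      have "real (card (T' i)) \<le> real m + 2 * real N / (a * L) + 1" using T'0 i T[OF i] by auto
      also have "2 * real N / (a * L) = 2 / a * real m" using a(1) N m by (simp add: L_def field_simps)
      also have "real m + 2 / a * real m + 1 \<le> (2 + 2 / a) * real m" using m by (simp add: distrib_right)
      finally show "real (card (T' i)) \<le> (2 + 2 / a) * real m" .
    qed
    let ?B = "perp_proj d N k ` spline_space d k T'"
    have finB: "finite ?B" using spline_space_finite(1)[of d T' k] T'(2) by auto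
    obtain E where E: "orthonormal ?I E" "card E \<le> card ?B" "\<And>b x. b \<in> ?B \<Longrightarrow> x \<in> ?I \<Longrightarrow> proj ?I E b x = b x"
      using gram_schmidt[of ?I ?B, OF finite_idx finB] by blast
    have finE: "finite E" using E(1) by (simp add: orthonormal_def)
    have cardE: "real (card E) \<le> K1 * real (m ^ d)"
    proof -
      have "card E \<le> card (spline_space d k T')"
        using E(2) card_image_le[OF spline_space_finite(1)[of d T' k]] T'(2) by (meson order_trans)
      also have "\<dots> \<le> (\<Prod>i=1..d. card (T' i)) * k ^ d" using T'(2) by (intro spline_space_finite(2))
      finally have "real (card E) \<le> (\<Prod>i=1..d. real (card (T' i))) * real k ^ d"
        by (metis (mono_tags, lifting) of_nat_le_iff of_nat_mult of_nat_power of_nat_prod prod.cong)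
      also have "\<dots> \<le> (\<Prod>i=1..d. (2 + 2 / a) * real m) * real k ^ d"
        using T'(4) by (intro mult_right_mono prod_mono) auto
      also have "\<dots> = K1 * real (m ^ d)" by (simp add: K1_def power_mult_distrib mult_ac)
      finally show ?thesis .
    qed
    \<comment> \<open>A nearest knot, from grid or mesh alike, makes one and the same distance
      comparable with the mesh width and with the distance to any grid point.\<close>
    have "\<exists>t. \<forall>i\<in>{1..d}. t i \<in> T' i \<and> (\<forall>t'\<in>T' i. \<bar>real (j i) - real (t i)\<bar> \<le> \<bar>real (j i) - real t'\<bar>)" for j :: "nat \<Rightarrow> nat"
    proof (intro bchoice ballI)
      fix i assume i: "i \<in> {1..d}"
      have "T' i \<noteq> {}" using T'(5)[OF i, of 0] by auto
      from ex_min_if_finite[of "(\<lambda>t. \<bar>real (j i) - real t\<bar>) ` T' i"] T'(2)[OF i] this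
      show "\<exists>t. t \<in> T' i \<and> (\<forall>t'\<in>T' i. \<bar>real (j i) - real t\<bar> \<le> \<bar>real (j i) - real t'\<bar>)"
        by (auto simp: not_less)
    qed
    then obtain tn where tn: "\<And>j i. i \<in> {1..d} \<Longrightarrow> tn j i \<in> T' i"
      "\<And>j i t'. i \<in> {1..d} \<Longrightarrow> t' \<in> T' i \<Longrightarrow> \<bar>real (j i) - real (tn j i)\<bar> \<le> \<bar>real (j i) - real t'\<bar>"
      by metis
    define D where "D j i = \<bar>real (j i) - real (tn j i)\<bar>" for j i
    define z where "z j x = atom d N k j x - proj ?I E (atom d N k j) x" for j x
    have zz: "ip ?I (z j) (z j) \<le> cc * real n * (\<Sum>i=1..d. (D j i / real N) ^ (2 * k - 1))" if j: "j \<in> ?J" for j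
      using atom_residual_le[OF k N d j, of "tn j" T' E] tn(1) T'(3) E(1,3)
      unfolding z_def[abs_def] cc_def D_def n_def of_nat_power by blast
    \<comment> \<open>Normalised so that \<open>real n * lam * v j\<close> is exactly the Gaussian
      threshold for the residual atom \<open>z j\<close>.\<close>
    define v where "v j = \<tau> * \<sigma> * sqrt (ip ?I (z j) (z j)) / (real n * lam)" for j
    have vv: "(v j)\<^sup>2 \<le> cc * (\<Sum>i=1..d. (D j i / L) ^ (2 * k - 1))" if j: "j \<in> ?J" for j
    proof -
      let ?\<Sigma> = "\<Sum>i=1..d. (D j i / real N) ^ (2 * k - 1)"
      have \<Sigma>0: "?\<Sigma> \<ge> 0" by (intro sum_nonneg) (simp add: D_def)
      have "(v j)\<^sup>2 = W * ip ?I (z j) (z j) / (real n * lam)\<^sup>2"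
        by (simp add: v_def W_def power_divide power_mult_distrib ip_self_nonneg)
      also have "\<dots> \<le> W * (cc * real n * ?\<Sigma>) / (real n * lam)\<^sup>2"
        using zz[OF j] by (intro divide_right_mono mult_left_mono) (auto simp: W_def)
      also have "\<dots> = (W / real n) * (cc * ?\<Sigma> / lam\<^sup>2)"
        using n0 by (simp add: power2_eq_square)
      also have "\<dots> \<le> (lam\<^sup>2 * real m ^ (2 * k - 1)) * (cc * ?\<Sigma> / lam\<^sup>2)"
        using W cc \<Sigma>0 by (intro mult_right_mono) auto
      also have "\<dots> = cc * (real m ^ (2 * k - 1) * ?\<Sigma>)" using lam(1) by simp
      also have "real m ^ (2 * k - 1) * ?\<Sigma> = (\<Sum>i=1..d. (D j i / L) ^ (2 * k - 1))"
        unfolding sum_distrib_left power_mult_distrib[symmetric] by (intro sum.cong refl) (simp add: L_def mult.commute)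
      finally show ?thesis .
    qed
    \<comment> \<open>The coordinates of grid points are knots themselves, so the residual atoms at
      points of \<open>S\<close> vanish on the cube.\<close>
    have vS: "v j \<le> 0" if j: "j \<in> S" for j
    proof -
      have jJ: "j \<in> ?J" using j SJ by blast
      have "D j i = 0" if i: "i \<in> {1..d}" for i
        using tn(2)[OF i, of "j i" j] T'(1)[OF i] PiE_mem[OF j[unfolded S] i] by (auto simp: D_def)
      then have "(v j)\<^sup>2 \<le> 0" using vv[OF jJ] k by (simp add: power_0_left)
      then show ?thesis by simp
    qed
    define \<Gamma> where "\<Gamma> = (real d + 1)\<^sup>2 * (1 + ln R) * (real N ^ (2 * (k - 1)) * real m * Kq * R powr (1 - 2 * real k)) ^ d"
    let ?Dw = "\<lambda>w y. \<Sum>j\<in>?J. w j * (\<Prod>i=1..d. dcoef k N (j i) (y i))"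
    have interp: "\<exists>w. (\<forall>j\<in>S. w j = q j) \<and> (\<forall>j\<in>?J - S. \<bar>w j\<bar> \<le> 1 - v j) \<and> ip ?I (?Dw w) (?Dw w) \<le> \<Gamma>"
      if q: "\<And>j. \<bar>q j\<bar> \<le> 1" for q
    proof -
      have "\<exists>w. (\<forall>j\<in>S. w j = q j) \<and>
        (\<forall>j. w j = 0 \<or> (\<exists>t\<in>S. (\<forall>i\<in>{1..d}. \<bar>real (j i) - real (t i)\<bar> < R) \<and>
           \<bar>w j\<bar> \<le> 1 - (\<Sum>i=1..d. (\<bar>real (j i) - real (t i)\<bar> / R) powr (real k - 1 / 2)) / real d)) \<and>
        ip ?I (?Dw w) (?Dw w) \<le> \<Gamma>"
        unfolding S \<Gamma>_def by (rule interpolation_exists[OF k R1 Kq T sepR bdR q d])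
      then obtain w where w0: "(\<forall>j\<in>S. w j = q j) \<and>
        (\<forall>j. w j = 0 \<or> (\<exists>t\<in>S. (\<forall>i\<in>{1..d}. \<bar>real (j i) - real (t i)\<bar> < R) \<and>
           \<bar>w j\<bar> \<le> 1 - (\<Sum>i=1..d. (\<bar>real (j i) - real (t i)\<bar> / R) powr (real k - 1 / 2)) / real d)) \<and>
        ip ?I (?Dw w) (?Dw w) \<le> \<Gamma>" by (elim exE)
      note w = conjunct1[OF w0] spec[OF conjunct1[OF conjunct2[OF w0]]] conjunct2[OF conjunct2[OF w0]]
      have "\<bar>w j\<bar> \<le> 1 - v j" if j: "j \<in> ?J" for j
      proof -
        have D0: "0 \<le> D j i" for i by (simp add: D_def)
        note wl = weight_le[OF k d less_imp_le[OF cc] L0 a(1,4) R_def vv[OF j] D0]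
        show ?thesis
        proof (cases "w j = 0")
          case True
          have "D j i \<le> a * L" if i: "i \<in> {1..d}" for i
          proof -
            have "j i \<le> N" using PiE_mem[OF j[unfolded idx_def] i] by simp
            then obtain t where "t \<in> T' i" "\<bar>real (j i) - real t\<bar> \<le> a * L" using T'(5)[OF i] by blast
            then show ?thesis using tn(2)[OF i, of t j] by (simp add: D_def)
          qed
          then have "v j \<le> 1" by (rule wl(1))
          then show ?thesis using True by simp
        next
          case False
          then obtain t where t: "t \<in> S" "\<forall>i\<in>{1..d}. \<bar>real (j i) - real (t i)\<bar> < R"
            "\<bar>w j\<bar> \<le> 1 - (\<Sum>i=1..d. (\<bar>real (j i) - real (t i)\<bar> / R) powr (real k - 1 / 2)) / real d"
            using w(2)[of j] by blast
          have "v j \<le> (\<Sum>i=1..d. (\<bar>real (j i) - real (t i)\<bar> / R) powr (real k - 1 / 2)) / real d"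
          proof (rule wl(2))
            fix i assume i: "i \<in> {1..d}"
            have "t i \<in> T' i" using PiE_mem[OF t(1)[unfolded S] i] T'(1)[OF i] by blast
            then have "D j i \<le> \<bar>real (j i) - real (t i)\<bar>" unfolding D_def by (rule tn(2)[OF i])
            \<comment> \<open>Distances of indices are integers, so below 1 they are 0; this settles
              the case \<open>R = 1\<close> of \<open>weight_le\<close>.\<close>
            moreover have "\<bar>real (j i) - real (t i)\<bar> = 0" if "\<bar>real (j i) - real (t i)\<bar> < 1"
            proof -
              have "\<not> j i < t i" "\<not> t i < j i" using that by linarith+
              then show ?thesis by simp
            qed
            ultimately show "D j i \<le> \<bar>real (j i) - real (t i)\<bar> \<and> \<bar>real (j i) - real (t i)\<bar> < R \<and>
                (R = 1 \<longrightarrow> \<bar>real (j i) - real (t i)\<bar> = 0)" using t(2) i by auto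
          qed
          then show ?thesis using t(3) by linarith
        qed
      qed
      then have "\<forall>j\<in>?J - S. \<bar>w j\<bar> \<le> 1 - v j" by simp
      with w(1) w(3) show ?thesis by (intro exI[of _ w] conjI)
    qed
    \<comment> \<open>The finitely many directions in which the noise has to be controlled: at most
      n basis vectors and at most n residual atoms.\<close>
    define Z where "Z = E \<union> z ` ?J"
    have finZ: "finite Z" using finE by (simp add: Z_def)
    have cardZ: "real (card Z) \<le> 2 * real n"
    proof -
      have "card E \<le> n"
        using orthonormal_card_le[OF finite_idx E(1)] by (simp add: n_def idx_def card_PiE)
      moreover have "card (z ` ?J) \<le> n"
      proof -
        have "card (z ` ?J) \<le> card ?J" by (rule card_image_le) simp
        also have "\<dots> \<le> n" unfolding n_def idx_def by (simp add: card_PiE power_mono)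
        finally show ?thesis .
      qed
      moreover have "card Z \<le> card E + card (z ` ?J)" unfolding Z_def by (rule card_Un_le)
      ultimately show ?thesis by linarith
    qed
    define A where "A = {\<omega> \<in> space M. \<forall>b\<in>Z. \<bar>ip ?I (\<lambda>i. \<epsilon> i \<omega>) b\<bar> \<le> \<tau> * \<sigma> * sqrt (ip ?I b b)}"
    have A: "A \<in> sets M" "measure M A \<ge> 1 - real (card Z) * (2 * exp (- \<tau>\<^sup>2 / 2))"
      unfolding A_def by (rule gaussian_noise_union[OF noise finite_idx \<sigma> \<tau>0 finZ])+
    have probA: "measure M A \<ge> 1 - 1 / real n"
    proof -
      have "exp (- \<tau>\<^sup>2 / 2) = 1 / (2 * real n)\<^sup>2"
      proof -
        have "- \<tau>\<^sup>2 / 2 = - (real 2 * ln (2 * real n))" unfolding \<tau>sq by simp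
        then show ?thesis using n0 by (simp only: exp_minus exp_of_nat_mult exp_ln) (simp add: inverse_eq_divide)
      qed
      then have "real (card Z) * (2 * exp (- \<tau>\<^sup>2 / 2)) \<le> 2 * real n * (2 * (1 / (2 * real n)\<^sup>2))"
        using cardZ by (intro mult_mono) auto
      also have "\<dots> = 1 / real n" using n0 by (simp add: power2_eq_square)
      finally show ?thesis using A(2) by linarith
    qed
    let ?P = "\<lambda>\<omega>. risk_bound d N k lam S f0 g
      (K * (lam\<^sup>2 * real (card S) ^ (2 * k) * ln (real (N ^ d) / real (card S)))) (\<lambda>i. \<epsilon> i \<omega>)"
    have "?P \<omega>" if \<omega>: "\<omega> \<in> A" for \<omega>
    proof -
      let ?e = "\<lambda>i. \<epsilon> i \<omega>"
      have bnd: "\<bar>ip ?I ?e b\<bar> \<le> \<tau> * \<sigma> * sqrt (ip ?I b b)" if "b \<in> Z" for b using \<omega> that by (auto simp: A_def)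
      have eE: "(\<Sum>b\<in>E. (ip ?I ?e b)\<^sup>2) \<le> real (card E) * W"
      proof -
        have "(\<Sum>b\<in>E. (ip ?I ?e b)\<^sup>2) \<le> (\<Sum>b\<in>E. W)"
        proof (rule sum_mono)
          fix b assume b: "b \<in> E"
          then have "ip ?I b b = 1" using E(1) by (simp add: orthonormal_def)
          then have "\<bar>ip ?I ?e b\<bar> \<le> \<tau> * \<sigma>" using bnd[of b] b by (simp add: Z_def)
          then have "\<bar>ip ?I ?e b\<bar>\<^sup>2 \<le> (\<tau> * \<sigma>)\<^sup>2" by (intro power_mono) auto
          then show "(ip ?I ?e b)\<^sup>2 \<le> W" by (simp add: W_def)
        qed
        then show ?thesis by simp
      qed
      have ez: "\<bar>ip ?I ?e (\<lambda>x. atom d N k j x - proj ?I E (atom d N k j) x)\<bar> \<le> real (N ^ d) * lam * v j"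
        if j: "j \<in> ?J" for j
      proof -
        have "\<bar>ip ?I ?e (z j)\<bar> \<le> \<tau> * \<sigma> * sqrt (ip ?I (z j) (z j))" using j by (intro bnd) (simp add: Z_def)
        also have "\<dots> = real n * lam * v j" using n0 lam(1) by (simp add: v_def)
        finally show ?thesis by (simp only: n_def z_def[abs_def])
      qed
      have rate: "2 * (real (card E) * W) / real (N ^ d) + 2 * real (N ^ d) * lam\<^sup>2 * \<Gamma>
          \<le> K * (lam\<^sup>2 * real (card S) ^ (2 * k) * ln (real (N ^ d) / real (card S)))"
        unfolding K_def cardS
      proof (rule rate_bound[OF k d m Nm a(1,2) _ Kq0 K10 _ _ _ \<Gamma>_def])
        show "R = max (a * (real N / real m)) 1" by (simp add: R_def L_def)
        show "real (card E) * W \<le> K1 * real (m ^ d) * W" using cardE by (intro mult_right_mono) (auto simp: W_def)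
        show "W / real (N ^ d) \<le> lam\<^sup>2 * real m ^ (2 * k - 1)" using W by (simp only: n_def)
        show "W \<ge> 0" by (simp add: W_def)
      qed
      show ?thesis
        by (rule risk_bound_mono[OF penalized_risk_bound[OF k N lam(1) SJ E(1) eE ez vS interp] rate])
    qed
    then have sub: "A \<subseteq> {\<omega> \<in> space M. ?P \<omega>}" by (auto simp: A_def)
    have meas: "{\<omega> \<in> space M. ?P \<omega>} \<in> sets M"
    proof -
      have [measurable]: "(\<lambda>\<omega>. cube_norm d N (\<lambda>j. cube_estimator d N k lam (\<lambda>i. f0 i + \<epsilon> i \<omega>) j
                                 - perp_proj d N k f0 j)) \<in> borel_measurable M"
        using lam(1) gaussian_noise_measurable[OF noise] by (intro estimator_error_measurable[OF N]) auto
      show ?thesis unfolding risk_bound_def by measurable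
    qed
    have "1 - 1 / real (N ^ d) \<le> measure M A" using probA by (simp only: n_def)
    also have "\<dots> \<le> measure M {\<omega> \<in> space M. ?P \<omega>}" by (rule finite_measure_mono[OF sub meas])
    finally show "measure M {\<omega> \<in> space M. ?P \<omega>} \<ge> 1 - 1 / real (N ^ d)" .
  qed
qed

theorem theorem3p1:
  fixes k :: nat
  assumes "k \<in> {1, 2, 3, 4}"
  shows "\<exists>C::real. C > 0 \<and>
    (\<forall>d::nat. d \<ge> 1 \<longrightarrow>
      (\<forall>c1 c2 \<delta>::real. 0 < c1 \<and> c1 \<le> c2 \<and> 0 \<le> \<delta> \<and> \<delta> < 1 \<longrightarrow>
        (\<exists>K::real. K \<ge> 0 \<and>
          (\<forall>(N::nat) (n::nat) (ns::nat \<Rightarrow> nat) (S::(nat \<Rightarrow> nat) set) (s::nat)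
             (f0::(nat \<Rightarrow> nat) \<Rightarrow> real) (g::(nat \<Rightarrow> nat) \<Rightarrow> real)
             (\<sigma>::real) (lam::real) (M::'w measure) (\<epsilon>::(nat \<Rightarrow> nat) \<Rightarrow> 'w \<Rightarrow> real).
             ns = (\<lambda>_. N) \<and> n = N ^ d \<and>
             f0 \<in> tensors d ns \<and> g \<in> tensors d ns \<and>
             \<sigma> > 0 \<and> gaussian_noise M (full_idx d ns) \<sigma> \<epsilon> \<and>
             S \<subseteq> (\<Pi>\<^sub>E i\<in>{1..d}. {k + 2..N - 1}) \<and> s = card S \<and>
             regular_grid d N k c1 c2 \<delta> S \<and>
             lam \<ge> C * real d powr (3 / 2) * lambda0 \<sigma> n (ln (2 * real n))
                     / real s powr ((2 * real k - 1) / (2 * real d))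
             \<longrightarrow>
             \<P>(\<omega> in M.
                (tnorm d ns (\<lambda>j. estimator d ns k lam (\<lambda>i. f0 i + \<epsilon> i \<omega>) j
                                 - proj_perp d ns k f0 j))\<^sup>2 / real n
                \<le> (tnorm d ns (\<lambda>j. g j - proj_perp d ns k f0 j))\<^sup>2 / real n
                  + 4 * lam * (\<Sum>j\<in>diff_idx d ns k - S. \<bar>total_diff d ns k g j\<bar>)
                  + K * (lam\<^sup>2 * real s ^ (2 * k) * ln (real n / real s)))
             \<ge> 1 - 1 / real n))))"
proof -
  have k: "k \<ge> 1" using assms by auto
  have sub: "(\<Pi>\<^sub>E i\<in>{1..d}. {k + 2..N - 1}) \<subseteq> diff_idx d (\<lambda>_. N) k" for d N
    unfolding idx_def by (intro PiE_mono) auto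
  show ?thesis
  proof (rule exI[of _ 1], intro conjI allI impI zero_less_one, goal_cases)
    case (1 d c1 c2 \<delta>)
    then have d: "d \<ge> 1" and c1: "c1 > 0" by simp_all
    show ?case
    proof (rule exE[OF grid_risk_bound[OF k d c1, where ?c2.0 = c2 and \<delta> = \<delta>, where 'w = 'w]], goal_cases)
      case (1 K)
      note K = this
      show ?case
      proof (intro exI[of _ K] conjI allI impI conjunct1[OF K], goal_cases)
        case (1 N n ns S s f0 g \<sigma> lam M \<epsilon>)
        then have eq: "ns = (\<lambda>_. N)" "n = N ^ d" "s = card S" by blast+
        from 1 sub[of d N] have "S \<subseteq> diff_idx d (\<lambda>_. N) k" by blast
        with 1 show ?case
          using conjunct2[OF K, rule_format, of \<sigma> M N \<epsilon> S lam f0 g]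
          unfolding eq risk_bound_def mult_1 by blast
      qed
    qed
  qed
qed

end
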